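(* Suppose $\mathbb{P}\{S_0=\infty\}<1$. Then for all $\delta\ge 0$ and $x\ge 0$ the limit defining $\mathcal{B}_Z^\delta(x)$ exists and $$\mathcal{B}_Z^\delta(x)=\int_0^\infty \mathbb{E}\left\{\frac{Z(0)}{S_\delta}\,\mathbb{I}\left(\int_{\delta\mathbb{Z}^d}\mathbb{I}(Z(t)>s)\,\lambda_\delta(dt)>x\right)\right\}\lambda(ds)<\infty .$$ Moreover, the same formula holds with $S_\delta$ replaced by $S_\eta$, where $\eta>0$ is arbitrary if $\delta=0$, and $\eta=k\delta$ with $k\in\mathbb{N}$ if $\delta>0$, provided that, almost surely, $$\{S_0(Z)<\infty\}\subset\{S_\eta(B^rZ)\in(0,\infty)\}\qquad\text{for all } r\in\delta\mathbb{Z}^d .$$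
   Context: Let $d\ge1$. $D$ is the space of generalised c\`adl\`ag functions $f:\mathbb{R}^d\to[0,\infty)$ (limits exist at every point within each of the $2^d$ quadrants, and $f(s)\to f(t)$ as $s\to t$ with $s\ge t$ componentwise), equipped with Skorohod's $J_1$-topology and the $\sigma$-field generated by the projections $f\mapsto f(t)$. The underlying probability space is complete and non-atomic. $Z(t),t\in\mathbb{R}^d$, is a random field with almost all sample paths in $D$ such that $\mathbb{E}\{Z(t)\}=1$ for all $t\in\mathbb{R}^d$, $\mathbb{E}\{\sup_{t\in[0,T]^d}Z(t)\}<\infty$ for all $T>0$, $\mathbb{P}\{\sup_{t\in\mathbb{R}^d}Z(t)>0\}=1$, and $Z$ is a spectral random field of a stationary max-stable random field $X$: the field $X(t)=\max_{i\ge1}\Gamma_i^{-1}Z^{(i)}(t)$, $t\in\mathbb{R}^d$, is stationary, where $\Gamma_i=\sum_{k=1}^i\mathcal{V}_k$, the $\mathcal{V}_k$ are i.i.d. unit exponential, independent of the i.i.d. copies $Z^{(i)}$ of $Z$. With $B^hZ(\cdot)=Z(\cdot-h)$, stationarity of $X$ is equivalent to $\mathbb{E}\{Z(h)F(Z)\}=\mathbb{E}\{Z(0)F(B^hZ)\}$ for all $h\in\mathbb{R}^d$ and all measurable $F:D\to[0,\infty]$ with $F(cf)=F(f)$ for all $f\in D,c>0$. $\mathbb{I}$ denotes an indicator. $\lambda_0=\lambda$ is Lebesgue measure and $0\mathbb{Z}^d:=\mathbb{R}^d$; for $\delta>0$, $\lambda_\delta$ is $\delta^d$ times the counting measure on $\delta\mathbb{Z}^d$.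 Set $S_\delta=S_\delta(Z)=\int_{\delta\mathbb{Z}^d}Z(t)\,\lambda_\delta(dt)$ and similarly $S_\delta(f)$ for other $f$. For the fixed $\delta\ge 0$ under consideration $Z$ is chosen so that $S_\delta>0$ almost surely. Conventions: $0/0=0$, $\infty\cdot0=0$, $1/\infty=0$. The Berman function is, for $\delta,x\ge0$, $$\mathcal{B}_Z^\delta(x)=\lim_{T\to\infty}\frac1{T^d}\int_0^\infty\mathbb{P}\left\{\int_{[0,T]^d\cap\delta\mathbb{Z}^d}\mathbb{I}(Z(t)>s)\,\lambda_\delta(dt)>x\right\}ds .$$ *)

theory Defs
  imports "HOL-Probability.Probability"
begin

section \<open>Generalised cadlag functions\<close>

text \<open>
  The \<open>2\<^sup>d\<close> half-open quadrants \<open>quadrant Q t\<close>, with \<open>Q\<close> ranging over the sets of coordinates,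
  partition the space; \<open>quadrant UNIV t\<close> is \<open>{s. s \<ge> t}\<close> and the only one containing \<open>t\<close>.
\<close>

definition quadrant :: "'n set \<Rightarrow> real^'n \<Rightarrow> (real^'n) set" where
  "quadrant Q t = {s. \<forall>i. if i \<in> Q then t $ i \<le> s $ i else s $ i < t $ i}"

definition cadlag_space :: "(real^'n \<Rightarrow> real) set" where
  "cadlag_space = {f. (\<forall>t. 0 \<le> f t) \<and>
     (\<forall>t Q. \<exists>l. (f \<longlongrightarrow> l) (at t within quadrant Q t)) \<and>
     (\<forall>t. (f \<longlongrightarrow> f t) (at t within quadrant UNIV t))}"


section \<open>Probabilistic notions\<close>

definition non_atomic :: "'a measure \<Rightarrow> bool" where
  "non_atomic M \<longleftrightarrow> (\<forall>A\<in>sets M. 0 < emeasure M A \<longrightarrow>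
     (\<exists>B\<in>sets M. B \<subseteq> A \<and> 0 < emeasure M B \<and> emeasure M B < emeasure M A))"

text \<open>
  Random fields are path-valued, \<open>Z \<omega> t\<close>. The product \<open>\<sigma>\<close>-algebra is the one generated by the
  projections \<open>f \<mapsto> f t\<close>.
\<close>

abbreviation field_borel :: "(real^'n \<Rightarrow> 'b::topological_space) measure" where
  "field_borel \<equiv> Pi\<^sub>M UNIV (\<lambda>_. borel)"

definition stationary_field ::
    "'a measure \<Rightarrow> ('a \<Rightarrow> real^'n \<Rightarrow> 'b::topological_space) \<Rightarrow> bool" where
  "stationary_field M X \<longleftrightarrow>
     (\<forall>h. distr M field_borel (\<lambda>\<omega> t. X \<omega> (t + h)) = distr M field_borel X)"

definition iid_unit_exponential :: "'a measure \<Rightarrow> (nat \<Rightarrow> 'a \<Rightarrow> real) \<Rightarrow> bool" where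
  "iid_unit_exponential M V \<longleftrightarrow>
     prob_space.indep_vars M (\<lambda>_. borel) V UNIV \<and>
     (\<forall>k. distributed M lborel (V k) (\<lambda>v. ennreal (exponential_density 1 v)))"

definition iid_copies ::
    "'a measure \<Rightarrow> ('a \<Rightarrow> real^'n \<Rightarrow> real) \<Rightarrow> (nat \<Rightarrow> 'a \<Rightarrow> real^'n \<Rightarrow> real) \<Rightarrow> bool" where
  "iid_copies M Z W \<longleftrightarrow>
     prob_space.indep_vars M (\<lambda>_. field_borel) W UNIV \<and>
     (\<forall>i. distr M field_borel (W i) = distr M field_borel Z)"

text \<open>
  The sequences \<open>V\<close> and \<open>W\<close> have different value types, so their independence is expressed through
  the \<open>\<sigma>\<close>-algebras they generate.
\<close>

definition indep_sequences ::
    "'a measure \<Rightarrow> (nat \<Rightarrow> 'a \<Rightarrow> real) \<Rightarrow> (nat \<Rightarrow> 'a \<Rightarrow> real^'n \<Rightarrow> real) \<Rightarrow> bool" where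
  "indep_sequences M V W \<longleftrightarrow> prob_space.indep_set M
     (sets (vimage_algebra (space M) (\<lambda>\<omega> k. V k \<omega>) (Pi\<^sub>M UNIV (\<lambda>_. borel))))
     (sets (vimage_algebra (space M) (\<lambda>\<omega> i. W i \<omega>) (Pi\<^sub>M UNIV (\<lambda>_. field_borel))))"

text \<open>
  The sequences are indexed from 0, so \<open>\<Gamma> i = V 0 + \<dots> + V i\<close> is the arrival time number \<open>i + 1\<close>.
  Taking the maximum as a supremum in \<^typ>\<open>ennreal\<close> avoids arbitrary values on the exceptional null
  set where it might be infinite or not attained.
\<close>

definition max_stable_field ::
    "(nat \<Rightarrow> 'a \<Rightarrow> real) \<Rightarrow> (nat \<Rightarrow> 'a \<Rightarrow> real^'n \<Rightarrow> real) \<Rightarrow> 'a \<Rightarrow> real^'n \<Rightarrow> ennreal" where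
  "max_stable_field V W \<omega> t = (SUP i. ennreal (W i \<omega> t / (\<Sum>k\<le>i. V k \<omega>)))"


section \<open>Grid measures, integral functionals and the Berman function\<close>

definition grid :: "real \<Rightarrow> (real^'n) set" where
  "grid \<delta> = (if \<delta> = 0 then UNIV else {t. \<forall>i. \<exists>k::int. t $ i = \<delta> * of_int k})"

definition grid_measure :: "real \<Rightarrow> (real^'n) measure" where
  "grid_measure \<delta> = (if \<delta> = 0 then lborel
     else scale_measure (ennreal (\<delta> ^ CARD('n))) (count_space (grid \<delta>)))"

definition backshift :: "real^'n \<Rightarrow> (real^'n \<Rightarrow> real) \<Rightarrow> real^'n \<Rightarrow> real" where
  "backshift h f = (\<lambda>t. f (t - h))"

definition S_int :: "real \<Rightarrow> (real^'n \<Rightarrow> real) \<Rightarrow> ennreal" where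
  "S_int \<delta> f = (\<integral>\<^sup>+t\<in>grid \<delta>. ennreal (f t) \<partial>grid_measure \<delta>)"

definition sojourn :: "real \<Rightarrow> (real^'n) set \<Rightarrow> (real^'n \<Rightarrow> real) \<Rightarrow> real \<Rightarrow> ennreal" where
  "sojourn \<delta> A f s = (\<integral>\<^sup>+t\<in>A \<inter> grid \<delta>. indicator {u. f u > s} t \<partial>grid_measure \<delta>)"

definition berman_average ::
    "'a measure \<Rightarrow> ('a \<Rightarrow> real^'n \<Rightarrow> real) \<Rightarrow> real \<Rightarrow> real \<Rightarrow> real \<Rightarrow> ennreal" where
  "berman_average M Z \<delta> x T = ennreal (1 / T ^ CARD('n)) *
     (\<integral>\<^sup>+s\<in>{0..}. emeasure M {\<omega>\<in>space M. sojourn \<delta> (cbox 0 (vec T)) (Z \<omega>) s > ennreal x} \<partial>lborel)"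

definition berman ::
    "'a measure \<Rightarrow> ('a \<Rightarrow> real^'n \<Rightarrow> real) \<Rightarrow> real \<Rightarrow> real \<Rightarrow> ennreal" where
  "berman M Z \<delta> x = Lim at_top (berman_average M Z \<delta> x)"

end

theory Submission
  imports Defs
begin

text \<open>
  The proof has two halves: a probabilistic one, which extracts from the stationarity of the
  max-stable field the invariance of the law of \<open>Z\<close> on homogeneous functionals, and a
  mass-transport argument, which only uses that invariance.

  For a nonnegative functional \<open>g\<close> of a path, let \<open>p c\<close> be the probability that some \<open>i\<close> satisfies
  \<open>g (W i) > c * \<Gamma> i\<close>. Since the arrival times have constant intensity 1, the expected number of
  such \<open>i\<close> is \<open>E g(Z) / c\<close>, and the expected number of pairs is at most its square; hence \<open>c * p c\<close>
  tends to \<open>E g(Z)\<close>. For \<open>g\<close> a weighted maximum over finitely many sites, \<open>p c\<close> is a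
  finite-dimensional probability of the max-stable field, so these means are invariant under shifts
  of the sites. Differentiating them in one weight gives the law of \<open>Z / Z t\<close> under the
  probability weighted by \<open>Z t\<close>, and by homogeneity \<open>E G(Z) = E G(backshift h Z)\<close> for every
  measurable \<open>G\<close> that is homogeneous of degree one (\<open>shift_invariance\<close>).

  Integrating the indicator of \<open>sojourn > x\<close> over all levels yields such a functional, called
  \<open>excess\<close>. Cut the space into cells of side \<open>L\<close>, where \<open>L\<close> is a multiple of \<open>\<delta>\<close> (any positive
  number if \<open>\<delta> = 0\<close>). On the event that the total mass \<open>S\<close> is finite, distribute the excess of a
  large window over the cells in proportion to their shares of \<open>S\<close>. Shifting each cell to
  the origin shows that a cell deep inside the window contributes almost
  the mean of the share of the cell at 0 times the excess over the whole space, which is \<open>L^d\<close> times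
  the claimed formula. What lands outside the window, and the whole event \<open>S = \<infinity>\<close>, is estimated by the suprema of
  the path over the cells, which have finite mean: for a cell deep inside the window the share of mass
  outside is small, and if \<open>S = \<infinity>\<close> the suprema over the cells have infinite sum, so that the one
  over the given cell is below any fixed fraction of the sum over a large enough window.
  These are \<open>windowed_lower\<close> and \<open>windowed_upper\<close>.

  For the second normalisation, \<open>change_of_normalisation\<close> inserts the factor
  \<open>\<integral> Z r dr / S\<^sub>\<delta> = 1\<close> and shifts \<open>r\<close> to the origin. This turns \<open>Z 0 / S\<^sub>\<eta>\<close> into
  \<open>Z 0 / S\<^sub>\<delta>\<close> times \<open>\<integral> Z (- r) / S\<^sub>\<eta> (backshift r Z) dr\<close>, and the last integral is 1, as one sees by
  folding it onto one cell of the grid of spacing \<open>\<eta>\<close>.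
\<close>

section \<open>Path space\<close>

text \<open>
  Restricting to cadlag paths is essential: only there is a path determined by countably many
  values, so that suprema and integrals over time are measurable for the \<open>\<sigma>\<close>-algebra of the
  projections.
\<close>

definition path_space :: "(real^'n \<Rightarrow> real) measure" where
  "path_space = restrict_space field_borel cadlag_space"

lemma space_path_space [simp]: "space path_space = cadlag_space"
  by (simp add: path_space_def space_restrict_space space_PiM)

text \<open>
  The approximation is strictly larger in every coordinate, so it tends to \<open>t\<close> inside
  \<open>quadrant UNIV t\<close> without ever hitting \<open>t\<close>; right continuity then recovers \<open>f t\<close>.
\<close>

definition dyadic_above :: "nat \<Rightarrow> real^'n \<Rightarrow> real^'n" where
  "dyadic_above n t = (\<chi> i. (of_int \<lfloor>2 ^ n * t $ i\<rfloor> + 1) / 2 ^ n)"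

definition dyadics :: "(real^'n) set" where
  "dyadics = range (\<lambda>(n::nat, k::'n \<Rightarrow> int). \<chi> i. of_int (k i) / 2 ^ n)"

lemma countable_dyadics: "countable dyadics"
  unfolding dyadics_def by (rule countable_image) simp

lemma dyadic_above_in_dyadics: "dyadic_above n t \<in> dyadics"
proof -
  have "dyadic_above n t = (case (n, \<lambda>i. \<lfloor>2 ^ n * t $ i\<rfloor> + 1) of (n, k) \<Rightarrow> \<chi> i. of_int (k i) / 2 ^ n)"
    by (simp add: dyadic_above_def)
  then show ?thesis unfolding dyadics_def by blast
qed

lemma dyadic_above_gt: "t $ i < dyadic_above n t $ i"
proof -
  have "2 ^ n * t $ i < of_int \<lfloor>2 ^ n * t $ i\<rfloor> + 1" by linarith
  then show ?thesis by (simp add: dyadic_above_def field_simps)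
qed

lemma dyadic_above_le: "dyadic_above n t $ i \<le> t $ i + 1 / 2 ^ n"
proof -
  have "of_int \<lfloor>2 ^ n * t $ i\<rfloor> + 1 \<le> 2 ^ n * t $ i + 1" by linarith
  then show ?thesis by (simp add: dyadic_above_def field_simps)
qed

lemma dyadic_above_tendsto_nth: "(\<lambda>n. dyadic_above n t $ i) \<longlonglongrightarrow> t $ i"
proof (rule tendsto_sandwich)
  show "\<forall>\<^sub>F n in sequentially. t $ i \<le> dyadic_above n t $ i"
    using dyadic_above_gt by (intro always_eventually allI less_imp_le)
  show "\<forall>\<^sub>F n in sequentially. dyadic_above n t $ i \<le> t $ i + 1 / 2 ^ n"
    using dyadic_above_le by (intro always_eventually allI)
  have "(\<lambda>n. t $ i + (1/2) ^ n) \<longlonglongrightarrow> t $ i + 0"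
    by (intro tendsto_intros LIMSEQ_realpow_zero) auto
  then show "(\<lambda>n. t $ i + 1 / 2 ^ n) \<longlonglongrightarrow> t $ i" by (simp add: power_one_over)
qed simp

lemma cadlag_dyadic_limit:
  assumes "f \<in> cadlag_space"
  shows "(\<lambda>n. f (dyadic_above n t)) \<longlonglongrightarrow> f t"
proof -
  have lim: "(f \<longlongrightarrow> f t) (at t within quadrant UNIV t)"
    using assms by (auto simp: cadlag_space_def)
  have "filterlim (\<lambda>n. dyadic_above n t) (at t within quadrant UNIV t) sequentially"
    unfolding filterlim_at
  proof (intro conjI always_eventually allI)
    show "(\<lambda>n. dyadic_above n t) \<longlonglongrightarrow> t"
      by (rule vec_tendstoI) (rule dyadic_above_tendsto_nth)
    show "dyadic_above n t \<in> quadrant UNIV t" for n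
      unfolding quadrant_def using less_imp_le[OF dyadic_above_gt] by auto
    show "dyadic_above n t \<noteq> t" for n
      using dyadic_above_gt[of t undefined n] by auto
  qed
  then show ?thesis using lim by (rule filterlim_compose[rotated])
qed

lemma eval_measurable: "(\<lambda>f. f t) \<in> borel_measurable path_space"
  unfolding path_space_def by (intro measurable_restrict_space1) simp

lemma dyadic_above_measurable [measurable]: "dyadic_above n \<in> borel_measurable borel"
proof (subst borel_measurable_euclidean_space, intro ballI)
  fix b :: "real^'n" assume "b \<in> Basis"
  then obtain i where b: "b = axis i 1" by (auto simp: Basis_vec_def)
  have "(\<lambda>t::real^'n. t $ i) \<in> borel_measurable borel"
    by (intro borel_measurable_continuous_onI continuous_intros)
  then have "(\<lambda>t::real^'n. (of_int \<lfloor>2 ^ n * t $ i\<rfloor> + 1) / (2 ^ n :: real)) \<in> borel_measurable borel"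
    by measurable
  then show "(\<lambda>t. dyadic_above n t \<bullet> b) \<in> borel_measurable borel"
    by (simp add: b dyadic_above_def inner_axis)
qed

lemma dyadic_above_measurable_count [measurable]:
  "dyadic_above n \<in> measurable borel (count_space dyadics)"
proof (subst measurable_count_space_eq_countable[OF countable_dyadics], intro conjI ballI)
  show "dyadic_above n \<in> space borel \<rightarrow> dyadics" using dyadic_above_in_dyadics by auto
  fix a :: "real^'n" 
  have "dyadic_above n -` {a} \<inter> space borel \<in> sets borel"
    by (rule measurable_sets[OF dyadic_above_measurable]) simp
  then show "dyadic_above n -` {a} \<inter> space borel \<in> sets borel" .
qed

text \<open>
  The evaluation is a pointwise limit of evaluations at dyadic points, and each of these takes only
  countably many sites.
\<close>

lemma eval_pair_measurable:
  "(\<lambda>(f, t). f t) \<in> borel_measurable (path_space \<Otimes>\<^sub>M borel)"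
proof (rule borel_measurable_LIMSEQ_real)
  fix p :: "(real^'n \<Rightarrow> real) \<times> (real^'n)" assume "p \<in> space (path_space \<Otimes>\<^sub>M borel)"
  then have "fst p \<in> cadlag_space" by (auto simp: space_pair_measure)
  then show "(\<lambda>n. fst p (dyadic_above n (snd p))) \<longlonglongrightarrow> (case p of (f, t) \<Rightarrow> f t)"
    using cadlag_dyadic_limit by (auto simp: case_prod_beta)
next
  fix n
  show "(\<lambda>p. fst p (dyadic_above n (snd p))) \<in> borel_measurable (path_space \<Otimes>\<^sub>M borel)"
    by (rule measurable_compose_countable'[where I=dyadics and f="\<lambda>q p. fst p q"])
       (auto simp: countable_dyadics intro!: measurable_compose[OF measurable_fst eval_measurable])
qed

lemma eval_measurable_compose:
  assumes "F \<in> measurable N path_space" "g \<in> measurable N borel"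
  shows "(\<lambda>x. F x (g x)) \<in> borel_measurable N"
  using measurable_compose[OF measurable_Pair[OF assms] eval_pair_measurable] by simp

lemma path_measurable: "f \<in> cadlag_space \<Longrightarrow> f \<in> borel_measurable borel"
proof -
  assume "f \<in> cadlag_space"
  then have "(\<lambda>_. f) \<in> measurable borel path_space" by simp
  from eval_measurable_compose[OF this measurable_ident] show ?thesis by simp
qed

lemma path_nonneg: "f \<in> cadlag_space \<Longrightarrow> 0 \<le> f t"
  by (simp add: cadlag_space_def)

lemma quadrant_minus: "(\<lambda>s. s - h) ` quadrant Q t = quadrant Q (t - h)"
  apply (auto simp: quadrant_def split: if_splits)
  subgoal for s
    apply (rule image_eqI[of _ _ "s + h"])
     apply (auto simp: algebra_simps)
    done
  done

lemma tendsto_backshift: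
  assumes "(f \<longlongrightarrow> l) (at (t - h) within quadrant Q (t - h))"
  shows "(backshift h f \<longlongrightarrow> l) (at t within quadrant Q t)"
proof -
  have "filterlim (\<lambda>s. s - h) (at (t - h) within quadrant Q (t - h)) (at t within quadrant Q t)"
    unfolding filterlim_at
  proof (intro conjI)
    show "((\<lambda>s. s - h) \<longlongrightarrow> t - h) (at t within quadrant Q t)" by (intro tendsto_intros)
    show "\<forall>\<^sub>F s in at t within quadrant Q t. s - h \<in> quadrant Q (t - h) \<and> s - h \<noteq> t - h"
      by (auto simp: eventually_at_filter quadrant_minus[symmetric])
  qed
  from filterlim_compose[OF assms this] show ?thesis
    by (simp add: backshift_def)
qed

lemma backshift_cadlag: 
  assumes "f \<in> cadlag_space" shows "backshift h f \<in> cadlag_space"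
proof -
  have "\<exists>l. (f \<longlongrightarrow> l) (at t within quadrant Q t)" for t Q
    using assms by (auto simp: cadlag_space_def)
  then have 1: "\<exists>l. (backshift h f \<longlongrightarrow> l) (at t within quadrant Q t)" for t Q
    using tendsto_backshift by blast
  have "(f \<longlongrightarrow> f t) (at t within quadrant UNIV t)" for t
    using assms by (auto simp: cadlag_space_def)
  from tendsto_backshift[OF this]
  have "(backshift h f \<longlongrightarrow> backshift h f t) (at t within quadrant UNIV t)" for t
    by (simp add: backshift_def)
  with 1 show ?thesis using assms by (auto simp: cadlag_space_def backshift_def)
qed

lemma scale_cadlag:
  assumes "f \<in> cadlag_space" "0 \<le> c" shows "(\<lambda>t. c * f t) \<in> cadlag_space"
  using assms unfolding cadlag_space_def
  by (auto intro!: tendsto_mult_left) (blast intro: tendsto_mult_left)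

lemma zero_cadlag: "(\<lambda>_. 0) \<in> cadlag_space"
  by (auto simp: cadlag_space_def intro!: exI[of _ 0])

lemma measurable_path_spaceI:
  assumes "\<And>x. x \<in> space N \<Longrightarrow> F x \<in> cadlag_space"
    and "\<And>t. (\<lambda>x. F x t) \<in> borel_measurable N"
  shows "F \<in> measurable N path_space"
  unfolding path_space_def
proof (rule measurable_restrict_space2)
  show "F \<in> space N \<rightarrow> cadlag_space" using assms by auto
  show "F \<in> measurable N field_borel"
    by (rule measurable_PiM_single') (use assms in auto)
qed

lemma backshift_measurable [measurable]: "backshift h \<in> measurable path_space path_space"
  by (rule measurable_path_spaceI) (auto simp: backshift_cadlag, simp add: backshift_def eval_measurable)

lemma backshift_pair_measurable:
  assumes "F \<in> measurable N path_space" "g \<in> measurable N borel"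
  shows "(\<lambda>x. backshift (g x) (F x)) \<in> measurable N path_space"
proof (rule measurable_path_spaceI)
  show "backshift (g x) (F x) \<in> cadlag_space" if "x \<in> space N" for x
    using measurable_space[OF assms(1) that] by (simp add: backshift_cadlag)
  show "(\<lambda>x. backshift (g x) (F x) t) \<in> borel_measurable N" for t
    unfolding backshift_def using assms by (intro eval_measurable_compose) auto
qed

lemma path_pos_dyadic:
  assumes "f \<in> cadlag_space" "0 < f t" shows "\<exists>q\<in>dyadics. 0 < f q"
proof -
  have "\<forall>\<^sub>F n in sequentially. 0 < f (dyadic_above n t)"
    using cadlag_dyadic_limit[OF assms(1)] assms(2) by (rule order_tendstoD)
  then obtain n where "0 < f (dyadic_above n t)" by (auto simp: eventually_sequentially)
  then show ?thesis using dyadic_above_in_dyadics by blast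
qed

text \<open>
  Half-open cells tile the space, and a point of a cell is approached by dyadic points above it that
  lie in the same cell. The supremum over a cell is therefore a supremum over countably many sites.
\<close>

definition cell :: "real \<Rightarrow> real^'n \<Rightarrow> (real^'n) set" where
  "cell L c = {t. \<forall>i. c $ i \<le> t $ i \<and> t $ i < c $ i + L}"

definition cell_sup :: "real \<Rightarrow> real^'n \<Rightarrow> (real^'n \<Rightarrow> real) \<Rightarrow> ennreal" where
  "cell_sup L c f = (SUP t\<in>cell L c. ennreal (f t))"

lemma dyadic_above_cell:
  assumes "t \<in> cell L c"
  shows "\<forall>\<^sub>F n in sequentially. dyadic_above n t \<in> cell L c"
proof -
  have "\<forall>\<^sub>F n in sequentially. \<forall>i. dyadic_above n t $ i < c $ i + L"
  proof (rule eventually_all_finite)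
    fix i 
    show "\<forall>\<^sub>F n in sequentially. dyadic_above n t $ i < c $ i + L"
      using dyadic_above_tendsto_nth[of t i] assms by (intro order_tendstoD) (auto simp: cell_def)
  qed
  then show ?thesis
  proof eventually_elim
    case (elim n)
    have "c $ i \<le> dyadic_above n t $ i" for i
      using assms less_imp_le[OF dyadic_above_gt[of t i n]] order_trans[of "c $ i" "t $ i"] unfolding cell_def by blast
    with elim show ?case by (auto simp: cell_def)
  qed
qed

lemma cell_sup_dyadic:
  assumes "f \<in> cadlag_space"
  shows "cell_sup L c f = (SUP t\<in>cell L c \<inter> dyadics. ennreal (f t))"
  unfolding cell_sup_def
proof (rule antisym)
  show "(SUP t\<in>cell L c. ennreal (f t)) \<le> (SUP t\<in>cell L c \<inter> dyadics. ennreal (f t))"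
  proof (rule SUP_least)
    fix t assume t: "t \<in> cell L c"
    have "(\<lambda>n. ennreal (f (dyadic_above n t))) \<longlonglongrightarrow> ennreal (f t)"
      by (intro tendsto_ennrealI cadlag_dyadic_limit assms)
    then show "ennreal (f t) \<le> (SUP t\<in>cell L c \<inter> dyadics. ennreal (f t))"
    proof (rule tendsto_upperbound)
      show "\<forall>\<^sub>F n in sequentially. ennreal (f (dyadic_above n t)) \<le> (SUP t\<in>cell L c \<inter> dyadics. ennreal (f t))"
        using dyadic_above_cell[OF t]
      proof eventually_elim
        case (elim n)
        then show ?case by (intro SUP_upper) (auto simp: dyadic_above_in_dyadics)
      qed
    qed simp
  qed
qed (rule SUP_subset_mono, auto)

lemma cell_sup_measurable [measurable]: "cell_sup L c \<in> borel_measurable path_space"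
proof -
  have "(\<lambda>f. SUP t\<in>cell L c \<inter> dyadics. ennreal (f t)) \<in> borel_measurable path_space"
    by (rule borel_measurable_SUP)
       (auto intro: countable_subset[OF _ countable_dyadics] measurable_compose[OF eval_measurable])
  then show ?thesis by (rule measurable_cong[THEN iffD1, rotated]) (simp add: cell_sup_dyadic)
qed

section \<open>Exceedances of a marked Poisson process\<close>

text \<open>
  Adding the event \<open>A n\<close> to a union increases its probability by that of \<open>A n\<close>, up to the
  intersections of \<open>A n\<close> with the earlier events.
\<close>

lemma (in prob_space) bonferroni_lower:
  fixes A :: "nat \<Rightarrow> 'a set"
  assumes A: "\<And>i. A i \<in> events"
  shows "(\<Sum>i<n. emeasure M (A i)) \<le>
     emeasure M (\<Union>i<n. A i) + (\<Sum>j<n. \<Sum>i<j. emeasure M (A i \<inter> A j))"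
proof (induction n)
  case (Suc n)
  let ?U = "\<Union>i<n. A i"
  have U: "?U \<in> events" using A by auto
  have "emeasure M ?U + emeasure M (A n) = emeasure M (?U \<union> A n) + emeasure M (?U \<inter> A n)"
    using emeasure_Un_Int[OF U A] .
  also have "emeasure M (?U \<inter> A n) \<le> (\<Sum>i<n. emeasure M (A i \<inter> A n))"
  proof -
    have "?U \<inter> A n = (\<Union>i<n. A i \<inter> A n)" by auto
    then show ?thesis using emeasure_subadditive_finite[of "{..<n}" "\<lambda>i. A i \<inter> A n" M] A by auto
  qed
  finally have step: "emeasure M ?U + emeasure M (A n)
      \<le> emeasure M (?U \<union> A n) + (\<Sum>i<n. emeasure M (A i \<inter> A n))" by (simp add: add_left_mono)
  have eq: "(\<Union>i<Suc n. A i) = ?U \<union> A n" by (auto simp: less_Suc_eq)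
  have "(\<Sum>i<Suc n. emeasure M (A i)) = (\<Sum>i<n. emeasure M (A i)) + emeasure M (A n)" by simp
  also have "\<dots> \<le> (emeasure M ?U + (\<Sum>j<n. \<Sum>i<j. emeasure M (A i \<inter> A j))) + emeasure M (A n)"
    by (intro add_right_mono Suc)
  also have "\<dots> = (emeasure M ?U + emeasure M (A n)) + (\<Sum>j<n. \<Sum>i<j. emeasure M (A i \<inter> A j))"
    by (simp add: ac_simps)
  also have "\<dots> \<le> (emeasure M (?U \<union> A n) + (\<Sum>i<n. emeasure M (A i \<inter> A n)))
      + (\<Sum>j<n. \<Sum>i<j. emeasure M (A i \<inter> A j))"
    by (intro add_right_mono step)
  finally show ?case unfolding eq by (simp add: ac_simps)
qed simp

lemma nn_integral_pair_mult:
  assumes "sigma_finite_measure B"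
    and [measurable]: "F \<in> borel_measurable A" "G \<in> borel_measurable B"
  shows "(\<integral>\<^sup>+z. F (fst z) * G (snd z) \<partial>(A \<Otimes>\<^sub>M B)) = (\<integral>\<^sup>+x. F x \<partial>A) * (\<integral>\<^sup>+y. G y \<partial>B)"
proof -
  interpret B: sigma_finite_measure B by fact
  have "(\<integral>\<^sup>+z. F (fst z) * G (snd z) \<partial>(A \<Otimes>\<^sub>M B)) = (\<integral>\<^sup>+x. \<integral>\<^sup>+y. F x * G y \<partial>B \<partial>A)"
    by (subst B.nn_integral_fst[symmetric]) auto
  then show ?thesis by (simp add: nn_integral_cmult nn_integral_multc)
qed

text \<open>
  The intensity of the arrival times of a Poisson process of rate one is constant.
\<close>

lemma suminf_erlang_density:
  "(\<Sum>k. ennreal (erlang_density k 1 v)) = indicator {0..} v"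
proof (cases "v < 0")
  case False
  have "(\<lambda>k. exp (- v) * (v ^ k /\<^sub>R fact k)) sums (exp (- v) * exp v)"
    by (intro sums_mult exp_converges)
  then have "(\<lambda>k. erlang_density k 1 v) sums 1"
    using False by (simp add: erlang_density_def exp_minus divide_inverse mult_ac)
  then have "(\<Sum>k. ennreal (erlang_density k 1 v)) = ennreal 1"
    using False by (intro suminf_ennreal_eq) (auto simp: erlang_density_def)
  with False show ?thesis by simp
qed (simp add: erlang_density_def)

lemma nn_integral_level_ennreal:
  assumes "0 < c"
  shows "(\<integral>\<^sup>+v\<in>{0..}. indicator {v. ennreal (c * v) < u} v \<partial>lborel) = u / ennreal c"
proof (cases u rule: ennreal_cases)
  case (real r)
  have "(\<integral>\<^sup>+v\<in>{0..}. indicator {v. ennreal (c * v) < u} v \<partial>lborel) = (\<integral>\<^sup>+v. indicator {0..<r / c} v \<partial>lborel)"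
    using assms real by (intro nn_integral_cong)
      (auto simp: indicator_def ennreal_less_iff field_simps)
  also have "\<dots> = ennreal (r / c)" using assms real by (simp add: emeasure_lborel_Ico)
  finally show ?thesis using assms real by (simp add: divide_ennreal)
next
  case top
  have "(\<integral>\<^sup>+v\<in>{0..}. indicator {v. ennreal (c * v) < u} v \<partial>lborel) = (\<integral>\<^sup>+v. indicator {0..} v \<partial>(lborel::real measure))"
    using top by (intro nn_integral_cong) (auto simp: indicator_def less_top[symmetric])
  also have "\<dots> = emeasure lborel {0::real..}" by simp
  also have "\<dots> = \<infinity>" 
  proof -
    have "ennreal (real n) \<le> emeasure lborel {0::real..}" for n
      using emeasure_mono[of "{0..real n}" "{0..}" lborel] by auto
    then show ?thesis by (metis ennreal_le_of_nat_iff ennreal_of_nat_eq_real_of_nat infinity_ennreal_def linorder_not_less ennreal_Ex_less_of_nat less_top)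
  qed
  finally show ?thesis using top assms by (simp add: ennreal_top_divide)
qed

text \<open>
  The law of the arrival time with index \<open>k\<close>, counted from 0.
\<close>

definition erlang_measure :: "nat \<Rightarrow> real measure" where
  "erlang_measure k = density lborel (\<lambda>v. ennreal (erlang_density k 1 v))"

lemma sets_erlang [measurable_cong, simp]: "sets (erlang_measure k) = sets borel"
  by (simp add: erlang_measure_def)

definition exceed_prob :: "'b measure \<Rightarrow> ('b \<Rightarrow> ennreal) \<Rightarrow> real \<Rightarrow> real \<Rightarrow> ennreal" where
  "exceed_prob Q g c v = emeasure Q {w\<in>space Q. ennreal (c * v) < g w}"

lemma exceed_prob_measurable:
  assumes "prob_space Q" and [measurable]: "g \<in> borel_measurable Q"
  shows "exceed_prob Q g c \<in> borel_measurable borel"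
proof -
  interpret prob_space Q by fact
  have "exceed_prob Q g c = (\<lambda>v. \<integral>\<^sup>+w. indicator {z. ennreal (c * fst z) < g (snd z)} (v, w) \<partial>Q)"
  proof
    fix v
    have "(\<integral>\<^sup>+w. indicator {z. ennreal (c * fst z) < g (snd z)} (v, w) \<partial>Q)
        = (\<integral>\<^sup>+w. indicator {w\<in>space Q. ennreal (c * v) < g w} w \<partial>Q)"
      by (intro nn_integral_cong) (auto simp: indicator_def)
    then show "exceed_prob Q g c v = (\<integral>\<^sup>+w. indicator {z. ennreal (c * fst z) < g (snd z)} (v, w) \<partial>Q)"
      by (simp add: exceed_prob_def)
  qed
  also have "\<dots> \<in> borel_measurable borel"
  proof (rule borel_measurable_nn_integral)
    have "(\<lambda>z. indicator {z. ennreal (c * fst z) < g (snd z)} z :: ennreal) \<in> borel_measurable (borel \<Otimes>\<^sub>M Q)"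
      by measurable
    then show "case_prod (\<lambda>v w. indicator {z. ennreal (c * fst z) < g (snd z)} (v, w) :: ennreal) \<in> borel_measurable (borel \<Otimes>\<^sub>M Q)"
      by (simp add: case_prod_beta' cong: measurable_cong)
  qed
  finally show ?thesis .
qed

text \<open>
  The expected number of marked arrivals with \<open>g w > c * v\<close>: as the arrivals have intensity one, it is
  the mean length of the set of all \<open>v \<ge> 0\<close> with \<open>c * v < g w\<close>.
\<close>

lemma suminf_exceed:
  assumes Q: "prob_space Q" and g[measurable]: "g \<in> borel_measurable Q" and c: "0 < c"
  shows "(\<Sum>k. \<integral>\<^sup>+v. exceed_prob Q g c v \<partial>erlang_measure k) = (\<integral>\<^sup>+w. g w \<partial>Q) / ennreal c"
proof -
  interpret Q: prob_space Q by fact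
  interpret P: pair_sigma_finite Q lborel ..
  note [measurable] = exceed_prob_measurable[OF Q g]
  let ?k = "\<lambda>v w. indicator {z. ennreal (c * fst z) < g (snd z)} (v, w) :: ennreal"
  have "(\<Sum>k. \<integral>\<^sup>+v. exceed_prob Q g c v \<partial>erlang_measure k)
      = (\<Sum>k. \<integral>\<^sup>+v. ennreal (erlang_density k 1 v) * exceed_prob Q g c v \<partial>lborel)"
    unfolding erlang_measure_def by (subst nn_integral_density) auto
  also have "\<dots> = (\<integral>\<^sup>+v. (\<Sum>k. ennreal (erlang_density k 1 v) * exceed_prob Q g c v) \<partial>lborel)"
    by (intro nn_integral_suminf[symmetric]) auto
  also have "\<dots> = (\<integral>\<^sup>+v. indicator {0..} v * exceed_prob Q g c v \<partial>lborel)"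
    by (intro nn_integral_cong) (simp add: ennreal_suminf_multc suminf_erlang_density)
  also have "\<dots> = (\<integral>\<^sup>+v. \<integral>\<^sup>+w. indicator {0..} v * ?k v w \<partial>Q \<partial>lborel)"
  proof (intro nn_integral_cong)
    fix v
    have "(\<integral>\<^sup>+w. ?k v w \<partial>Q) = (\<integral>\<^sup>+w. indicator {w\<in>space Q. ennreal (c * v) < g w} w \<partial>Q)"
      by (intro nn_integral_cong) (auto simp: indicator_def)
    also have "\<dots> = exceed_prob Q g c v" by (simp add: exceed_prob_def)
    finally show "indicator {0..} v * exceed_prob Q g c v = (\<integral>\<^sup>+w. indicator {0..} v * ?k v w \<partial>Q)"
      by (subst nn_integral_cmult) auto
  qed
  also have "\<dots> = (\<integral>\<^sup>+w. \<integral>\<^sup>+v. indicator {0..} v * ?k v w \<partial>lborel \<partial>Q)"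
    by (rule P.Fubini') measurable
  also have "\<dots> = (\<integral>\<^sup>+w. g w / ennreal c \<partial>Q)"
  proof (intro nn_integral_cong)
    fix w
    show "(\<integral>\<^sup>+v. indicator {0..} v * ?k v w \<partial>lborel) = g w / ennreal c"
      unfolding nn_integral_level_ennreal[OF c, symmetric]
      by (intro nn_integral_cong) (auto simp: indicator_def)
  qed
  also have "\<dots> = (\<integral>\<^sup>+w. g w \<partial>Q) / ennreal c" by (rule nn_integral_divide) simp
  finally show ?thesis .
qed

locale spectral_construction = prob_space M for M :: "'a measure" +
  fixes Z :: "'a \<Rightarrow> real^'n \<Rightarrow> real"
    and V :: "nat \<Rightarrow> 'a \<Rightarrow> real"
    and W :: "nat \<Rightarrow> 'a \<Rightarrow> real^'n \<Rightarrow> real"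
  assumes Z_measurable: "Z \<in> measurable M field_borel"
    and exponential: "iid_unit_exponential M V"
    and copies: "iid_copies M Z W"
    and indep: "indep_sequences M V W"
begin

definition arrival :: "nat \<Rightarrow> 'a \<Rightarrow> real" where
  "arrival i \<omega> = (\<Sum>k\<le>i. V k \<omega>)"

lemma V_indep: "indep_vars (\<lambda>_. borel) V UNIV"
  using exponential by (simp add: iid_unit_exponential_def)

lemma V_measurable [measurable]: "V k \<in> borel_measurable M"
  using V_indep by (simp add: indep_vars_def2)

lemma W_measurable [measurable]: "W i \<in> measurable M field_borel"
  using copies by (simp add: iid_copies_def indep_vars_def2)

lemma W_distr: "distr M field_borel (W i) = distr M field_borel Z"
  using copies by (simp add: iid_copies_def)

lemma arrival_measurable [measurable]: "arrival i \<in> borel_measurable M"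
  unfolding arrival_def by measurable

lemma V_sum_distr:
  assumes "finite I" "I \<noteq> {}"
  shows "distr M borel (\<lambda>\<omega>. \<Sum>k\<in>I. V k \<omega>) = erlang_measure (card I - 1)"
proof -
  have "distributed M lborel (\<lambda>\<omega>. \<Sum>k\<in>I. V k \<omega>) (erlang_density (card I - 1) 1)"
    by (rule exponential_distributed_sum[OF assms])
      (use exponential in \<open>auto simp: iid_unit_exponential_def intro: indep_vars_subset\<close>)
  from distributed_distr_eq_density[OF this]
  show ?thesis by (simp add: erlang_measure_def cong: distr_cong)
qed

lemma arrival_distr: "distr M borel (arrival i) = erlang_measure i"
  using V_sum_distr[of "{..i}"] by (simp add: arrival_def[abs_def])

lemma arrival_pos: "AE \<omega> in M. 0 < arrival i \<omega>"
proof -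
  have "AE v in erlang_measure i. 0 < v"
    unfolding erlang_measure_def
  proof (subst AE_density)
    have "AE v in lborel. v \<noteq> (0::real)" by (rule AE_lborel_singleton)
    then show "AE v in lborel. 0 < ennreal (erlang_density i 1 v) \<longrightarrow> 0 < v"
      by eventually_elim (auto simp: erlang_density_def split: if_splits)
  qed simp
  then have "AE v in distr M borel (arrival i). 0 < v" unfolding arrival_distr .
  then show ?thesis by (subst (asm) AE_distr_iff) auto
qed

text \<open>
  The arrivals and the marks take values in different types; their independence is used as a
  product formula for the joint law of any functional of the one and any functional of the other.
\<close>

lemma sequences_joint_distr:
  assumes p [measurable]: "p \<in> measurable (Pi\<^sub>M UNIV (\<lambda>_. borel)) S"
    and q [measurable]: "q \<in> measurable (Pi\<^sub>M UNIV (\<lambda>_. field_borel)) T"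
  shows "distr M (S \<Otimes>\<^sub>M T) (\<lambda>\<omega>. (p (\<lambda>k. V k \<omega>), q (\<lambda>i. W i \<omega>))) =
    distr M S (\<lambda>\<omega>. p (\<lambda>k. V k \<omega>)) \<Otimes>\<^sub>M distr M T (\<lambda>\<omega>. q (\<lambda>i. W i \<omega>))"
proof (rule sym, rule pair_measure_eqI)
  have V[measurable]: "(\<lambda>\<omega> k. V k \<omega>) \<in> measurable M (Pi\<^sub>M UNIV (\<lambda>_. borel))"
    by (rule measurable_PiM_single') auto
  have W[measurable]: "(\<lambda>\<omega> i. W i \<omega>) \<in> measurable M (Pi\<^sub>M UNIV (\<lambda>_. field_borel))"
    by (rule measurable_PiM_single') (auto simp: space_PiM)
  show "sigma_finite_measure (distr M S (\<lambda>\<omega>. p (\<lambda>k. V k \<omega>)))"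
    by (intro prob_space_imp_sigma_finite prob_space_distr) measurable
  show "sigma_finite_measure (distr M T (\<lambda>\<omega>. q (\<lambda>i. W i \<omega>)))"
    by (intro prob_space_imp_sigma_finite prob_space_distr) measurable
  show "sets (distr M S (\<lambda>\<omega>. p (\<lambda>k. V k \<omega>)) \<Otimes>\<^sub>M distr M T (\<lambda>\<omega>. q (\<lambda>i. W i \<omega>)))
     = sets (distr M (S \<Otimes>\<^sub>M T) (\<lambda>\<omega>. (p (\<lambda>k. V k \<omega>), q (\<lambda>i. W i \<omega>))))"
    by (simp cong: sets_pair_measure_cong)
  fix A B assume "A \<in> sets (distr M S (\<lambda>\<omega>. p (\<lambda>k. V k \<omega>)))" "B \<in> sets (distr M T (\<lambda>\<omega>. q (\<lambda>i. W i \<omega>)))"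
  then have A[measurable]: "A \<in> sets S" and B[measurable]: "B \<in> sets T" by auto
  let ?a = "(\<lambda>\<omega> k. V k \<omega>) -` (p -` A \<inter> space (Pi\<^sub>M UNIV (\<lambda>_. borel))) \<inter> space M"
  let ?b = "(\<lambda>\<omega> i. W i \<omega>) -` (q -` B \<inter> space (Pi\<^sub>M UNIV (\<lambda>_. field_borel))) \<inter> space M"
  have a: "?a \<in> sets (vimage_algebra (space M) (\<lambda>\<omega> k. V k \<omega>) (Pi\<^sub>M UNIV (\<lambda>_. borel)))"
    by (rule in_vimage_algebra) (rule measurable_sets[OF p A])
  have b: "?b \<in> sets (vimage_algebra (space M) (\<lambda>\<omega> i. W i \<omega>) (Pi\<^sub>M UNIV (\<lambda>_. field_borel)))"
    by (rule in_vimage_algebra) (rule measurable_sets[OF q B])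
  have "prob (?a \<inter> ?b) = prob ?a * prob ?b"
    using indep a b unfolding indep_sequences_def indep_sets2_eq by blast
  then have "emeasure M (?a \<inter> ?b) = emeasure M ?a * emeasure M ?b"
    by (simp add: emeasure_eq_measure ennreal_mult)
  moreover have "?a = (\<lambda>\<omega>. p (\<lambda>k. V k \<omega>)) -` A \<inter> space M" by (auto simp: space_PiM)
  moreover have "?b = (\<lambda>\<omega>. q (\<lambda>i. W i \<omega>)) -` B \<inter> space M" by (auto simp: space_PiM)
  moreover have "(\<lambda>\<omega>. (p (\<lambda>k. V k \<omega>), q (\<lambda>i. W i \<omega>))) -` (A \<times> B) \<inter> space M
     = ((\<lambda>\<omega>. p (\<lambda>k. V k \<omega>)) -` A \<inter> space M) \<inter> ((\<lambda>\<omega>. q (\<lambda>i. W i \<omega>)) -` B \<inter> space M)" by auto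
  ultimately show "emeasure (distr M S (\<lambda>\<omega>. p (\<lambda>k. V k \<omega>))) A * emeasure (distr M T (\<lambda>\<omega>. q (\<lambda>i. W i \<omega>))) B =
    emeasure (distr M (S \<Otimes>\<^sub>M T) (\<lambda>\<omega>. (p (\<lambda>k. V k \<omega>), q (\<lambda>i. W i \<omega>)))) (A \<times> B)"
    by (simp add: emeasure_distr)
qed

lemma copies_pair_distr:
  assumes "i \<noteq> j"
  shows "distr M (field_borel \<Otimes>\<^sub>M field_borel) (\<lambda>\<omega>. (W i \<omega>, W j \<omega>)) =
     distr M field_borel Z \<Otimes>\<^sub>M distr M field_borel Z"
proof -
  have "indep_vars (\<lambda>_. field_borel) W UNIV" using copies by (simp add: iid_copies_def)
  from indep_var_restrict[OF this, of "{i}" "{j}"] assms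
  have "indep_var (PiM {i} (\<lambda>_. field_borel)) (\<lambda>\<omega>. restrict (\<lambda>i. W i \<omega>) {i})
     (PiM {j} (\<lambda>_. field_borel)) (\<lambda>\<omega>. restrict (\<lambda>i. W i \<omega>) {j})" by simp
  from indep_var_compose[OF this, of "\<lambda>f. f i" field_borel "\<lambda>f. f j" field_borel]
  have "indep_var field_borel (W i) field_borel (W j)"
    by (simp add: comp_def)
  then show ?thesis unfolding indep_var_distribution_eq W_distr by simp
qed

lemma gap_pair_distr:
  assumes "i < j"
  shows "distr M (borel \<Otimes>\<^sub>M borel) (\<lambda>\<omega>. (arrival i \<omega>, \<Sum>k\<in>{i<..j}. V k \<omega>)) =
     erlang_measure i \<Otimes>\<^sub>M erlang_measure (j - i - 1)"
proof -
  from indep_var_restrict[OF V_indep, of "{..i}" "{i<..j}"]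
  have "indep_var (PiM {..i} (\<lambda>_. borel)) (\<lambda>\<omega>. restrict (\<lambda>k. V k \<omega>) {..i})
     (PiM {i<..j} (\<lambda>_. borel)) (\<lambda>\<omega>. restrict (\<lambda>k. V k \<omega>) {i<..j})" by (simp add: disjoint_iff)
  from indep_var_compose[OF this, of "\<lambda>f. \<Sum>k\<le>i. f k" borel "\<lambda>f. \<Sum>k\<in>{i<..j}. f k" borel]
  have "indep_var borel (arrival i) borel (\<lambda>\<omega>. \<Sum>k\<in>{i<..j}. V k \<omega>)"
    by (simp add: comp_def arrival_def[abs_def])
  then have "distr M borel (arrival i) \<Otimes>\<^sub>M distr M borel (\<lambda>\<omega>. \<Sum>k\<in>{i<..j}. V k \<omega>)
    = distr M (borel \<Otimes>\<^sub>M borel) (\<lambda>\<omega>. (arrival i \<omega>, \<Sum>k\<in>{i<..j}. V k \<omega>))"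
    unfolding indep_var_distribution_eq by simp
  moreover have "distr M borel (\<lambda>\<omega>. \<Sum>k\<in>{i<..j}. V k \<omega>) = erlang_measure (j - i - 1)"
    using V_sum_distr[of "{i<..j}"] assms by simp
  ultimately show ?thesis by (simp add: arrival_distr)
qed

text \<open>
  Mark \<open>i\<close> exceeds the arrival time \<open>i\<close> at scale \<open>c\<close>. For \<open>g\<close> a weighted maximum over sites, the
  union over \<open>i\<close> says that the max-stable field is large at one of the sites.
\<close>

definition exceed :: "((real^'n \<Rightarrow> real) \<Rightarrow> ennreal) \<Rightarrow> real \<Rightarrow> nat \<Rightarrow> 'a set" where
  "exceed g c i = {\<omega>\<in>space M. ennreal (c * arrival i \<omega>) < g (W i \<omega>)}"

lemma exceed_sets [measurable]:
  assumes [measurable]: "g \<in> borel_measurable field_borel"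
  shows "exceed g c i \<in> events"
  unfolding exceed_def by measurable

lemma law_prob: "prob_space (distr M field_borel Z)"
  using Z_measurable by (rule prob_space_distr)

lemma erlang_prob: "prob_space (erlang_measure k)"
  using prob_space_distr[OF arrival_measurable, of k] by (simp add: arrival_distr)

abbreviation "law \<equiv> distr M field_borel Z"

lemma exceed_emeasure:
  assumes g [measurable]: "g \<in> borel_measurable field_borel"
  shows "emeasure M (exceed g c i) = (\<integral>\<^sup>+v. exceed_prob law g c v \<partial>erlang_measure i)"
proof -
  interpret Q: prob_space law by (rule law_prob)
  let ?k = "\<lambda>z::real \<times> (real^'n \<Rightarrow> real). indicator {z. ennreal (c * fst z) < g (snd z)} z :: ennreal"
  have joint: "distr M (borel \<Otimes>\<^sub>M field_borel) (\<lambda>\<omega>. (arrival i \<omega>, W i \<omega>)) = erlang_measure i \<Otimes>\<^sub>M law"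
    using sequences_joint_distr[of "\<lambda>f. \<Sum>k\<le>i. f k" borel "\<lambda>w. w i" field_borel]
    by (simp add: arrival_distr[unfolded arrival_def[abs_def]] arrival_def W_distr)
  have "emeasure M (exceed g c i) = (\<integral>\<^sup>+\<omega>. indicator (exceed g c i) \<omega> \<partial>M)"
    using exceed_sets[OF g] by simp
  also have "\<dots> = (\<integral>\<^sup>+\<omega>. ?k (arrival i \<omega>, W i \<omega>) \<partial>M)"
    by (intro nn_integral_cong) (auto simp: exceed_def indicator_def)
  also have "\<dots> = (\<integral>\<^sup>+z. ?k z \<partial>distr M (borel \<Otimes>\<^sub>M field_borel) (\<lambda>\<omega>. (arrival i \<omega>, W i \<omega>)))"
    by (subst nn_integral_distr) measurable
  also have "\<dots> = (\<integral>\<^sup>+v. \<integral>\<^sup>+w. ?k (v, w) \<partial>law \<partial>erlang_measure i)"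
    unfolding joint by (rule Q.nn_integral_fst[symmetric]) measurable
  also have "\<dots> = (\<integral>\<^sup>+v. exceed_prob law g c v \<partial>erlang_measure i)"
  proof (intro nn_integral_cong)
    fix v
    have "(\<integral>\<^sup>+w. ?k (v, w) \<partial>law) = (\<integral>\<^sup>+w. indicator {w\<in>space law. ennreal (c * v) < g w} w \<partial>law)"
      by (intro nn_integral_cong) (auto simp: indicator_def)
    also have "\<dots> = exceed_prob law g c v" unfolding exceed_prob_def
      by (rule nn_integral_indicator) measurable
    finally show "(\<integral>\<^sup>+w. ?k (v, w) \<partial>law) = exceed_prob law g c v" .
  qed
  finally show ?thesis .
qed

text \<open>
  The arrival time \<open>j\<close> is at least the gap between the arrivals \<open>i\<close> and \<open>j\<close>. That gap is independent
  of the arrival \<open>i\<close> and distributed like the arrival \<open>j - i - 1\<close>, so replacing one by the other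
  decouples the two events.
\<close>

lemma exceed_pair_le:
  assumes g [measurable]: "g \<in> borel_measurable field_borel" and ij: "i < j" and c: "0 < c"
  shows "emeasure M (exceed g c i \<inter> exceed g c j) \<le>
    emeasure M (exceed g c i) * emeasure M (exceed g c (j - i - 1))"
proof -
  interpret Q: prob_space law by (rule law_prob)
  interpret QQ: prob_space "law \<Otimes>\<^sub>M law" by (intro prob_space_pair law_prob)
  interpret E2: prob_space "erlang_measure (j - i - 1)" by (rule erlang_prob)
  let ?gap = "\<lambda>\<omega>. \<Sum>k\<in>{i<..j}. V k \<omega>"
  let ?K = "exceed_prob law g c"
  note K [measurable] = exceed_prob_measurable[OF law_prob, of g c, simplified]
  define k :: "real \<Rightarrow> (real^'n \<Rightarrow> real) \<Rightarrow> ennreal"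
    where "k v w = indicator {w. ennreal (c * v) < g w} w" for v w
  have k0: "(\<lambda>z. k (fst z) (snd z)) \<in> borel_measurable (borel \<Otimes>\<^sub>M field_borel)"
    unfolding k_def by measurable
  have k1: "(\<lambda>x. k (p x) (q x)) \<in> borel_measurable N"
    if "p \<in> borel_measurable N" "q \<in> measurable N field_borel" for p q and N :: "'z measure"
    using measurable_compose[OF measurable_Pair[OF that] k0] by simp
  let ?E = "{\<omega>\<in>space M. ennreal (c * arrival i \<omega>) < g (W i \<omega>) \<and> ennreal (c * ?gap \<omega>) < g (W j \<omega>)}"
  have kK: "(\<integral>\<^sup>+w. k v w \<partial>law) = ?K v" for v
  proof -
    have "(\<integral>\<^sup>+w. k v w \<partial>law) = (\<integral>\<^sup>+w. indicator {w\<in>space law. ennreal (c * v) < g w} w \<partial>law)"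
      by (intro nn_integral_cong) (auto simp: indicator_def k_def)
    also have "\<dots> = ?K v" unfolding exceed_prob_def
      by (rule nn_integral_indicator) measurable
    finally show ?thesis .
  qed
  have gapV: "(\<Sum>k\<in>{..i}. V k \<omega>) + ?gap \<omega> = arrival j \<omega>" for \<omega>
  proof -
    have "{..j} = {..i} \<union> {i<..j}" using ij by auto
    then show ?thesis unfolding arrival_def by (simp add: sum.union_disjoint disjoint_iff)
  qed
  let ?F = "\<lambda>z. k (fst (fst z)) (fst (snd z)) * k (snd (fst z)) (snd (snd z))"
  let ?J = "(borel \<Otimes>\<^sub>M borel) \<Otimes>\<^sub>M (field_borel \<Otimes>\<^sub>M field_borel)"
  let ?T = "\<lambda>\<omega>. ((arrival i \<omega>, ?gap \<omega>), (W i \<omega>, W j \<omega>))"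
  have F: "?F \<in> borel_measurable ?J"
    by (intro borel_measurable_times_ennreal k1 measurable_compose[OF measurable_fst] measurable_compose[OF measurable_snd]
        measurable_fst measurable_snd)
  have T: "?T \<in> measurable M ?J"
    by (intro measurable_Pair arrival_measurable W_measurable borel_measurable_sum V_measurable)
  have "distr M ?J ?T = distr M (borel \<Otimes>\<^sub>M borel) (\<lambda>\<omega>. (arrival i \<omega>, ?gap \<omega>)) \<Otimes>\<^sub>M
      distr M (field_borel \<Otimes>\<^sub>M field_borel) (\<lambda>\<omega>. (W i \<omega>, W j \<omega>))"
    unfolding arrival_def
    by (rule sequences_joint_distr[of "\<lambda>f. (\<Sum>k\<le>i. f k, \<Sum>k\<in>{i<..j}. f k)" "borel \<Otimes>\<^sub>M borel"
        "\<lambda>w. (w i, w j)" "field_borel \<Otimes>\<^sub>M field_borel"]) measurable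
  then have joint: "distr M ?J ?T
     = (erlang_measure i \<Otimes>\<^sub>M erlang_measure (j - i - 1)) \<Otimes>\<^sub>M (law \<Otimes>\<^sub>M law)"
    using ij by (simp only: gap_pair_distr[OF ij] copies_pair_distr[OF less_imp_neq[OF ij]])
  have "emeasure M (exceed g c i \<inter> exceed g c j) \<le> emeasure M ?E"
  proof (rule emeasure_mono_AE)
    show "AE \<omega> in M. \<omega> \<in> exceed g c i \<inter> exceed g c j \<longrightarrow> \<omega> \<in> ?E"
      using arrival_pos[of i]
    proof eventually_elim
      case (elim \<omega>)
      have "c * ?gap \<omega> \<le> c * arrival j \<omega>"
        using elim c gapV[of \<omega>] by (intro mult_left_mono) (auto simp: arrival_def)
      then have "ennreal (c * ?gap \<omega>) \<le> ennreal (c * arrival j \<omega>)" by (rule ennreal_leI)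
      then show ?case by (auto simp: exceed_def)
    qed
  qed measurable
  also have "emeasure M ?E = (\<integral>\<^sup>+\<omega>. indicator ?E \<omega> \<partial>M)" by (rule nn_integral_indicator[symmetric]) measurable
  also have "\<dots> = (\<integral>\<^sup>+\<omega>. ?F (?T \<omega>) \<partial>M)"
    by (intro nn_integral_cong) (auto simp: indicator_def k_def)
  also have "\<dots> = (\<integral>\<^sup>+z. ?F z \<partial>distr M ?J ?T)"
    by (rule nn_integral_distr[symmetric, OF T]) (simp only: measurable_distr_eq1 F)
  also have "\<dots> = (\<integral>\<^sup>+x. \<integral>\<^sup>+y. ?F (x, y) \<partial>(law \<Otimes>\<^sub>M law)
      \<partial>(erlang_measure i \<Otimes>\<^sub>M erlang_measure (j - i - 1)))"
    unfolding joint
    by (rule QQ.nn_integral_fst[symmetric])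
       (rule measurable_cong_sets[THEN equalityD1, THEN subsetD, OF _ refl F], simp cong: sets_pair_measure_cong)
  also have "\<dots> = (\<integral>\<^sup>+x. ?K (fst x) * ?K (snd x) \<partial>(erlang_measure i \<Otimes>\<^sub>M erlang_measure (j - i - 1)))"
  proof (rule nn_integral_cong)
    fix x :: "real \<times> real"
    have "(\<integral>\<^sup>+y. k (fst x) (fst y) * k (snd x) (snd y) \<partial>(law \<Otimes>\<^sub>M law))
      = (\<integral>\<^sup>+w. k (fst x) w \<partial>law) * (\<integral>\<^sup>+w. k (snd x) w \<partial>law)"
      by (rule nn_integral_pair_mult[OF Q.sigma_finite_measure_axioms]) (auto intro!: k1)
    then show "(\<integral>\<^sup>+y. ?F (x, y) \<partial>(law \<Otimes>\<^sub>M law)) = ?K (fst x) * ?K (snd x)"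
      by (simp only: kK fst_conv snd_conv)
  qed
  also have "\<dots> = (\<integral>\<^sup>+v. ?K v \<partial>erlang_measure i) * (\<integral>\<^sup>+v. ?K v \<partial>erlang_measure (j - i - 1))"
    by (rule nn_integral_pair_mult[OF E2.sigma_finite_measure_axioms]) (use K in \<open>simp_all cong: measurable_cong_sets\<close>)
  finally show ?thesis by (simp only: exceed_emeasure[OF g])
qed

lemma exceed_suminf:
  assumes g: "g \<in> borel_measurable field_borel" and c: "0 < c"
  shows "(\<Sum>i. emeasure M (exceed g c i)) = (\<integral>\<^sup>+\<omega>. g (Z \<omega>) \<partial>M) / ennreal c"
proof -
  have "(\<Sum>i. emeasure M (exceed g c i)) = (\<integral>\<^sup>+w. g w \<partial>law) / ennreal c"
    using suminf_exceed[OF law_prob _ c, of g] g by (simp add: exceed_emeasure)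
  then show ?thesis using g Z_measurable by (simp add: nn_integral_distr)
qed

lemma exceed_union_le:
  assumes g: "g \<in> borel_measurable field_borel" and c: "0 < c"
  shows "emeasure M (\<Union>i. exceed g c i) \<le> (\<integral>\<^sup>+\<omega>. g (Z \<omega>) \<partial>M) / ennreal c"
  unfolding exceed_suminf[OF assms, symmetric]
  by (rule emeasure_subadditive_countably) (use g in auto)

text \<open>
  The sum over pairs in the Bonferroni inequality is bounded by the square of the first-order term,
  which is negligible for large \<open>c\<close>.
\<close>

lemma exceed_union_ge:
  assumes g: "g \<in> borel_measurable field_borel" and c: "0 < c"
  shows "(\<integral>\<^sup>+\<omega>. g (Z \<omega>) \<partial>M) / ennreal c \<le>
    emeasure M (\<Union>i. exceed g c i) + ((\<integral>\<^sup>+\<omega>. g (Z \<omega>) \<partial>M) / ennreal c)\<^sup>2"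
proof -
  let ?p = "\<lambda>i. emeasure M (exceed g c i)"
  let ?m = "(\<integral>\<^sup>+\<omega>. g (Z \<omega>) \<partial>M) / ennreal c"
  have bound: "(\<Sum>j<n. \<Sum>i<j. emeasure M (exceed g c i \<inter> exceed g c j)) \<le> ?m\<^sup>2" for n
  proof -
    have "(\<Sum>j<n. \<Sum>i<j. emeasure M (exceed g c i \<inter> exceed g c j)) \<le> (\<Sum>j<n. \<Sum>i<j. ?p i * ?p (j - i - 1))"
      by (intro sum_mono exceed_pair_le) (use g c in auto)
    also have "\<dots> = (\<Sum>i<n. \<Sum>j\<in>{i<..<n}. ?p i * ?p (j - i - 1))"
      by (subst sum.Sigma, simp, simp, subst sum.Sigma, simp, simp,
          rule sum.reindex_bij_witness[of _ "\<lambda>(i,j). (j,i)" "\<lambda>(i,j). (j,i)"]) auto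
    also have "\<dots> \<le> (\<Sum>i<n. ?p i * ?m)"
    proof (intro sum_mono)
      fix i assume "i \<in> {..<n}"
      have "(\<Sum>j\<in>{i<..<n}. ?p (j - i - 1)) = (\<Sum>l<n - i - 1. ?p l)"
        by (rule sum.reindex_bij_witness[of _ "\<lambda>l. l + i + 1" "\<lambda>j. j - i - 1"]) auto
      also have "\<dots> \<le> ?m" unfolding exceed_suminf[OF assms, symmetric] by (rule sum_le_suminf) auto
      finally show "(\<Sum>j\<in>{i<..<n}. ?p i * ?p (j - i - 1)) \<le> ?p i * ?m"
        by (simp add: sum_distrib_left[symmetric] mult_left_mono)
    qed
    also have "\<dots> = (\<Sum>i<n. ?p i) * ?m" by (simp add: sum_distrib_right)
    also have "\<dots> \<le> ?m * ?m"
      by (intro mult_right_mono) (auto simp: exceed_suminf[OF assms, symmetric] intro!: sum_le_suminf)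
    finally show ?thesis by (simp add: power2_eq_square)
  qed
  have "(\<Sum>i<n. ?p i) \<le> emeasure M (\<Union>i. exceed g c i) + ?m\<^sup>2" for n
  proof -
    have "(\<Sum>i<n. ?p i) \<le> emeasure M (\<Union>i<n. exceed g c i)
        + (\<Sum>j<n. \<Sum>i<j. emeasure M (exceed g c i \<inter> exceed g c j))"
      by (rule bonferroni_lower) (use g in auto)
    also have "\<dots> \<le> emeasure M (\<Union>i. exceed g c i) + ?m\<^sup>2"
      by (intro add_mono bound emeasure_mono) (use g in auto)
    finally show ?thesis .
  qed
  then show ?thesis
    unfolding exceed_suminf[OF assms, symmetric] suminf_eq_SUP by (intro SUP_least) auto
qed

text \<open>
  The mean of \<open>g\<close> is the limit of \<open>c\<close> times the probability of an exceedance as \<open>c \<rightarrow> \<infinity>\<close>. It suffices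
  to compare at one scale \<open>c\<close> at which the quadratic error is below the given tolerance.
\<close>

lemma mean_le_of_exceed:
  assumes g: "g \<in> borel_measurable field_borel" and g': "g' \<in> borel_measurable field_borel"
    and fin: "(\<integral>\<^sup>+\<omega>. g (Z \<omega>) \<partial>M) < \<infinity>"
    and le: "\<And>c. 0 < c \<Longrightarrow> emeasure M (\<Union>i. exceed g c i) \<le> emeasure M (\<Union>i. exceed g' c i)"
  shows "(\<integral>\<^sup>+\<omega>. g (Z \<omega>) \<partial>M) \<le> (\<integral>\<^sup>+\<omega>. g' (Z \<omega>) \<partial>M)"
proof (rule ennreal_le_epsilon)
  fix e :: real assume e: "0 < e"
  obtain m where m: "(\<integral>\<^sup>+\<omega>. g (Z \<omega>) \<partial>M) = ennreal m" "0 \<le> m" using fin by (auto simp: less_top_ennreal)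
  \<comment> \<open>The quadratic error at scale \<open>c\<close> is \<open>m\<^sup>2 / c\<close>.\<close>
  define c where "c = m\<^sup>2 / e + 1"
  have c: "0 < c" using e by (auto simp: c_def add_nonneg_pos)
  let ?m' = "\<integral>\<^sup>+\<omega>. g' (Z \<omega>) \<partial>M"
  have "ennreal m / ennreal c \<le> ?m' / ennreal c + (ennreal m / ennreal c)\<^sup>2"
    using order_trans[OF exceed_union_ge[OF g c] add_right_mono[OF order_trans[OF le[OF c] exceed_union_le[OF g' c]]]]
    by (simp add: m)
  then have "ennreal c * (ennreal m / ennreal c) \<le> ennreal c * (?m' / ennreal c + (ennreal m / ennreal c)\<^sup>2)"
    by (rule mult_left_mono) simp
  moreover have "ennreal c * (ennreal m / ennreal c) = ennreal m"
    using c m by (simp add: divide_ennreal ennreal_mult[symmetric])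
  moreover have "ennreal c * (?m' / ennreal c) = ?m'"
    using c by (simp add: ennreal_mult_divide_eq ennreal_times_divide mult.commute[of "ennreal c"])
  moreover have "ennreal c * (ennreal m / ennreal c)\<^sup>2 = ennreal (m\<^sup>2 / c)"
    using c m by (simp add: divide_ennreal ennreal_power ennreal_mult[symmetric] power2_eq_square field_simps)
  moreover have "m\<^sup>2 / c \<le> e" using e c by (simp add: c_def field_simps)
  then have "ennreal (m\<^sup>2 / c) \<le> ennreal e" by (rule ennreal_leI)
  ultimately have "ennreal m \<le> ?m' + ennreal (m\<^sup>2 / c)" by (simp add: distrib_left)
  also have "\<dots> \<le> ?m' + ennreal e" by (intro add_left_mono) fact
  finally show "(\<integral>\<^sup>+\<omega>. g (Z \<omega>) \<partial>M) \<le> ?m' + ennreal e" by (simp add: m)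
qed

definition wsup :: "(real^'n) set \<Rightarrow> (real^'n \<Rightarrow> real) \<Rightarrow> (real^'n \<Rightarrow> real) \<Rightarrow> ennreal" where
  "wsup J a f = (SUP t\<in>J. ennreal (a t * f t))"

lemma wsup_measurable: "finite J \<Longrightarrow> wsup J a \<in> borel_measurable field_borel"
  unfolding wsup_def[abs_def] by (rule borel_measurable_SUP) (auto intro: countable_finite)

lemma max_stable_measurable: "max_stable_field V W \<in> measurable M field_borel"
proof (rule measurable_PiM_single')
  fix t :: "real^'n"
  have [measurable]: "(\<lambda>\<omega>. W i \<omega> t) \<in> borel_measurable M" for i
    by (rule measurable_compose[OF W_measurable]) simp
  show "(\<lambda>\<omega>. max_stable_field V W \<omega> t) \<in> borel_measurable M"
    unfolding max_stable_field_def by measurable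
qed (auto simp: space_PiM)

lemma union_exceed_eq:
  assumes a: "\<And>t. t \<in> J \<Longrightarrow> 0 < a t" and J: "finite J" and c: "0 < c"
  shows "emeasure M (\<Union>i. exceed (wsup J a) c i) =
    emeasure (distr M field_borel (max_stable_field V W)) {f\<in>space field_borel. \<exists>t\<in>J. ennreal (c / a t) < f t}"
proof -
  note meas [measurable] = max_stable_measurable
  have [measurable]: "{f\<in>space field_borel. \<exists>t\<in>J. ennreal (c / a t) < f t} \<in> sets field_borel"
    using J by measurable
  have "emeasure M (\<Union>i. exceed (wsup J a) c i) =
    emeasure M (max_stable_field V W -` {f\<in>space field_borel. \<exists>t\<in>J. ennreal (c / a t) < f t} \<inter> space M)"
  proof (rule emeasure_eq_AE)
    have "AE \<omega> in M. \<forall>i. 0 < arrival i \<omega>" using arrival_pos by (simp add: AE_all_countable)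
    then show "AE \<omega> in M. \<omega> \<in> (\<Union>i. exceed (wsup J a) c i) \<longleftrightarrow>
       \<omega> \<in> max_stable_field V W -` {f\<in>space field_borel. \<exists>t\<in>J. ennreal (c / a t) < f t} \<inter> space M"
    proof (eventually_elim)
      case (elim \<omega>)
      have "ennreal (c * arrival i \<omega>) < ennreal (a t * W i \<omega> t) \<longleftrightarrow>
        ennreal (c / a t) < ennreal (W i \<omega> t / (\<Sum>k\<le>i. V k \<omega>))" if "t \<in> J" for i t
        using elim[rule_format, of i] a[OF that] c unfolding arrival_def[symmetric]
        by (simp add: ennreal_less_iff field_simps)
      then show ?case
        by (auto simp: exceed_def wsup_def max_stable_field_def less_SUP_iff space_PiM)
    qed
  qed (use wsup_measurable[OF J] in auto)
  then show ?thesis by (simp add: emeasure_distr)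
qed

end

section \<open>Shift invariance of homogeneous functionals\<close>

text \<open>
  Scaling alone would allow the values 0 and \<open>\<infinity>\<close> at the zero path; the value has to be 0 for the
  normalisation by a positive coordinate to exhaust the functional.
\<close>

definition homogeneous :: "((real^'n \<Rightarrow> real) \<Rightarrow> ennreal) \<Rightarrow> bool" where
  "homogeneous G \<longleftrightarrow> G (\<lambda>_. 0) = 0 \<and>
     (\<forall>f\<in>cadlag_space. \<forall>c>0. G (\<lambda>t. c * f t) = ennreal c * G f)"

text \<open>
  The left derivative of \<open>u \<mapsto> max (u * r) s\<close> at \<open>u = 1\<close>. The left one is used because it leads to
  strict inequalities, hence to the generator of open half-lines.
\<close>

lemma max_left_difference_quotient:
  fixes r s :: real
  assumes "0 \<le> r"
  defines "D \<equiv> \<lambda>n. (real n + 2) * (max r s - max ((1 - 1 / (real n + 2)) * r) s)"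
  shows "0 \<le> D n" and "D n \<le> r" and "D \<longlonglongrightarrow> (if s < r then r else 0)"
proof -
  have u: "(1 - 1 / (real n + 2)) * r = r - r / (real n + 2)" for n by (simp add: algebra_simps)
  have q: "0 \<le> r / (real n + 2)" for n using assms by simp
  have D: "D n = (real n + 2) * (max r s - max (r - r / (real n + 2)) s)" for n
    by (simp add: D_def u)
  show "0 \<le> D n" unfolding D using q[of n] by (intro mult_nonneg_nonneg) auto
  have "max r s - max (r - r / (real n + 2)) s \<le> r / (real n + 2)" using q[of n] by (auto simp: max_def)
  then have "D n \<le> (real n + 2) * (r / (real n + 2))" unfolding D by (intro mult_left_mono) auto
  then show "D n \<le> r" by simp
  show "D \<longlonglongrightarrow> (if s < r then r else 0)"
  proof (cases "s < r")
    case True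
    have "(\<lambda>n. r - r * inverse (real (Suc (Suc n)))) \<longlonglongrightarrow> r - r * 0"
      by (intro tendsto_intros LIMSEQ_Suc[OF LIMSEQ_inverse_real_of_nat])
    then have "(\<lambda>n. r - r / (real n + 2)) \<longlonglongrightarrow> r" by (simp add: divide_inverse add.commute)
    then have "\<forall>\<^sub>F n in sequentially. s < r - r / (real n + 2)" using True by (intro order_tendstoD) auto
    then have "\<forall>\<^sub>F n in sequentially. D n = r"
    proof eventually_elim
      case (elim n)
      then show ?case using q[of n] True by (simp add: D max_def)
    qed
    then show ?thesis using True by (simp add: tendsto_eventually)
  next
    case False
    then have "D = (\<lambda>_. 0)" using q by (auto simp: fun_eq_iff D max_def intro: order_trans[of _ r])
    then show ?thesis using False by simp
  qed
qed

lemma ennreal_less_ennreal_iff: "0 < y \<Longrightarrow> ennreal x < ennreal y \<longleftrightarrow> x < y"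
  by (cases "0 \<le> x") (auto simp: ennreal_less_iff ennreal_neg)

locale stationary_construction = spectral_construction M Z V W
  for M :: "'a measure" and Z :: "'a \<Rightarrow> real^'n \<Rightarrow> real" and V W +
  assumes stationary: "stationary_field M (max_stable_field V W)"
    and paths: "\<And>\<omega>. \<omega> \<in> space M \<Longrightarrow> Z \<omega> \<in> cadlag_space"
    and mean: "\<And>t. (\<integral>\<^sup>+\<omega>. ennreal (Z \<omega> t) \<partial>M) = 1"
begin

lemma Z_eval [measurable]: "(\<lambda>\<omega>. Z \<omega> t) \<in> borel_measurable M"
  by (rule measurable_compose[OF Z_measurable]) simp

lemma Z_path_measurable: "Z \<in> measurable M path_space"
  by (rule measurable_path_spaceI) (auto simp: paths)

lemma wsup_mean_finite:
  assumes J: "finite J" and a: "\<And>t. t \<in> J \<Longrightarrow> 0 < a t"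
  shows "(\<integral>\<^sup>+\<omega>. wsup J a (Z \<omega>) \<partial>M) < \<infinity>"
proof -
  have "(\<integral>\<^sup>+\<omega>. wsup J a (Z \<omega>) \<partial>M) \<le> (\<integral>\<^sup>+\<omega>. (\<Sum>t\<in>J. ennreal (a t) * ennreal (Z \<omega> t)) \<partial>M)"
  proof (intro nn_integral_mono)
    fix \<omega> assume "\<omega> \<in> space M"
    show "wsup J a (Z \<omega>) \<le> (\<Sum>t\<in>J. ennreal (a t) * ennreal (Z \<omega> t))"
      unfolding wsup_def
    proof (rule SUP_least)
      fix t assume t: "t \<in> J"
      then have "ennreal (a t * Z \<omega> t) = ennreal (a t) * ennreal (Z \<omega> t)"
        using a[OF t] paths[OF \<open>\<omega> \<in> space M\<close>, THEN path_nonneg, of t] by (simp add: ennreal_mult)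
      also have "\<dots> \<le> (\<Sum>t\<in>J. ennreal (a t) * ennreal (Z \<omega> t))"
        using t J by (intro member_le_sum) auto
      finally show "ennreal (a t * Z \<omega> t) \<le> (\<Sum>t\<in>J. ennreal (a t) * ennreal (Z \<omega> t))" .
    qed
  qed
  also have "\<dots> = (\<Sum>t\<in>J. ennreal (a t))" 
    by (subst nn_integral_sum) (auto simp: nn_integral_cmult mean)
  also have "\<dots> < \<infinity>" by (simp add: J)
  finally show ?thesis .
qed

lemma wsup_mean_shift:
  assumes J: "finite J" and a: "\<And>t. t \<in> J \<Longrightarrow> 0 < a t"
  shows "(\<integral>\<^sup>+\<omega>. wsup ((\<lambda>t. t + h) ` J) (\<lambda>t. a (t - h)) (Z \<omega>) \<partial>M) = (\<integral>\<^sup>+\<omega>. wsup J a (Z \<omega>) \<partial>M)"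
proof -
  let ?J = "(\<lambda>t. t + h) ` J" and ?a = "\<lambda>t. a (t - h)"
  have a': "\<And>t. t \<in> ?J \<Longrightarrow> 0 < ?a t" using a by auto
  have J': "finite ?J" using J by auto
  note X = max_stable_measurable
  have X': "(\<lambda>\<omega> t. max_stable_field V W \<omega> (t + h)) \<in> measurable M field_borel"
    by (rule measurable_PiM_single') (auto intro: measurable_compose[OF X] simp: space_PiM)
  have eq: "emeasure M (\<Union>i. exceed (wsup ?J ?a) c i) = emeasure M (\<Union>i. exceed (wsup J a) c i)" if c: "0 < c" for c
  proof -
    let ?S = "{f\<in>space field_borel. \<exists>t\<in>J. ennreal (c / a t) < f t} :: (real^'n \<Rightarrow> ennreal) set"
    let ?S' = "{f\<in>space field_borel. \<exists>t\<in>?J. ennreal (c / ?a t) < f t} :: (real^'n \<Rightarrow> ennreal) set"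
    have level: "{f\<in>space field_borel. \<exists>t\<in>I. b t < f t} \<in> sets field_borel" if "finite I"
      for I :: "(real^'n) set" and b :: "real^'n \<Rightarrow> ennreal"
      using that by measurable
    have S: "?S \<in> sets field_borel" by (rule level[OF J])
    have S': "?S' \<in> sets field_borel" by (rule level[OF J'])
    have "emeasure M (\<Union>i. exceed (wsup ?J ?a) c i) = emeasure (distr M field_borel (max_stable_field V W)) ?S'"
      by (rule union_exceed_eq) (use a' J' c in auto)
    also have "\<dots> = emeasure M (max_stable_field V W -` ?S' \<inter> space M)"
      by (rule emeasure_distr[OF X S'])
    also have "max_stable_field V W -` ?S' = (\<lambda>\<omega> t. max_stable_field V W \<omega> (t + h)) -` ?S"
      by (auto simp: space_PiM)
    also have "emeasure M (\<dots> \<inter> space M) = emeasure (distr M field_borel (\<lambda>\<omega> t. max_stable_field V W \<omega> (t + h))) ?S"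
      by (rule emeasure_distr[OF X' S, symmetric])
    also have "\<dots> = emeasure (distr M field_borel (max_stable_field V W)) ?S"
      using stationary unfolding stationary_field_def by metis
    also have "\<dots> = emeasure M (\<Union>i. exceed (wsup J a) c i)"
      by (rule union_exceed_eq[symmetric]) (use a J c in auto)
    finally show ?thesis .
  qed
  show ?thesis
    using eq by (intro antisym mean_le_of_exceed wsup_measurable J J' wsup_mean_finite a a') auto
qed

definition dominance :: "real^'n \<Rightarrow> (real^'n) set \<Rightarrow> (real^'n \<Rightarrow> real) \<Rightarrow> ennreal" where
  "dominance t0 J a = (\<integral>\<^sup>+\<omega>. ennreal (Z \<omega> t0) * indicator {\<omega>. \<forall>t\<in>J. a t * Z \<omega> t < Z \<omega> t0} \<omega> \<partial>M)"

text \<open>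
  Differentiating the mean of a weighted maximum in the weight of one site \<open>t0\<close> isolates the event
  that this site dominates all others, weighted by the value there.
\<close>

lemma dominance_limit:
  assumes J: "finite J" "t0 \<notin> J" and a: "\<And>t. t \<in> J \<Longrightarrow> 0 < a t"
  shows "(\<lambda>n. ennreal (real n + 2) * ((\<integral>\<^sup>+\<omega>. wsup (insert t0 J) (a(t0 := 1)) (Z \<omega>) \<partial>M)
     - (\<integral>\<^sup>+\<omega>. wsup (insert t0 J) (a(t0 := 1 - 1 / (real n + 2))) (Z \<omega>) \<partial>M))) \<longlonglongrightarrow> dominance t0 J a"
proof -
  let ?u = "\<lambda>n. 1 - 1 / (real n + 2)"
  have u: "0 < ?u n" "?u n \<le> 1" for n by (auto simp: field_simps)
  let ?f = "\<lambda>n \<omega>. ennreal (real n + 2) * (wsup (insert t0 J) (a(t0 := 1)) (Z \<omega>) - wsup (insert t0 J) (a(t0 := ?u n)) (Z \<omega>))"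
  have meas [measurable]: "(\<lambda>\<omega>. wsup (insert t0 J) b (Z \<omega>)) \<in> borel_measurable M" for b
    by (rule measurable_compose[OF Z_measurable wsup_measurable]) (use J in auto)
  have fin: "(\<integral>\<^sup>+\<omega>. wsup (insert t0 J) (a(t0 := v)) (Z \<omega>) \<partial>M) < \<infinity>" if "0 < v" for v
    by (rule wsup_mean_finite) (use J a that in \<open>auto split: if_splits\<close>)
  have mono: "wsup (insert t0 J) (a(t0 := ?u n)) (Z \<omega>) \<le> wsup (insert t0 J) (a(t0 := 1)) (Z \<omega>)"
    if "\<omega> \<in> space M" for n \<omega>
  proof -
    have "?u n * Z \<omega> t0 \<le> 1 * Z \<omega> t0"
      using u(2) path_nonneg[OF paths[OF that]] by (intro mult_right_mono) auto
    then show ?thesis unfolding wsup_def by (intro SUP_mono) (auto intro!: ennreal_leI)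
  qed
  have int: "(\<integral>\<^sup>+\<omega>. ?f n \<omega> \<partial>M) = ennreal (real n + 2) * ((\<integral>\<^sup>+\<omega>. wsup (insert t0 J) (a(t0 := 1)) (Z \<omega>) \<partial>M)
     - (\<integral>\<^sup>+\<omega>. wsup (insert t0 J) (a(t0 := ?u n)) (Z \<omega>) \<partial>M))" for n
    by (subst nn_integral_cmult, simp, subst nn_integral_diff)
       (use mono fin[OF u(1), of n] in \<open>auto intro!: AE_I2\<close>)
  have pt: "?f n \<omega> \<le> ennreal (Z \<omega> t0) \<and>
     (\<lambda>n. ?f n \<omega>) \<longlonglongrightarrow> ennreal (Z \<omega> t0) * indicator {\<omega>. \<forall>t\<in>J. a t * Z \<omega> t < Z \<omega> t0} \<omega>"
    if \<omega>: "\<omega> \<in> space M" for n \<omega>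
  proof -
    have Z0: "0 \<le> Z \<omega> t" for t using path_nonneg[OF paths[OF \<omega>]] .
    define r where "r = Z \<omega> t0"
    have "wsup J a (Z \<omega>) \<le> (\<Sum>t\<in>J. ennreal (a t * Z \<omega> t))"
      unfolding wsup_def by (intro SUP_least member_le_sum) (use J in auto)
    also have "\<dots> < \<infinity>" using J by simp
    finally obtain s where s: "0 \<le> s" "wsup J a (Z \<omega>) = ennreal s" by (auto simp: less_top_ennreal)
    have split: "wsup (insert t0 J) (a(t0 := v)) (Z \<omega>) = ennreal (max (v * r) s)" for v
    proof -
      have "wsup (insert t0 J) (a(t0 := v)) (Z \<omega>) = max (ennreal (v * r)) (wsup J a (Z \<omega>))"
        using J(2) by (auto simp: wsup_def r_def sup_max intro!: arg_cong2[where f=max] SUP_cong)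
      also have "\<dots> = ennreal (max (v * r) s)" using s by (auto simp: max_def ennreal_le_iff2)
      finally show ?thesis .
    qed
    have f: "?f n \<omega> = ennreal ((real n + 2) * (max r s - max (?u n * r) s))" for n
      unfolding split using s
      by (subst ennreal_minus) (auto simp: ennreal_mult' max_def)
    have less: "(\<forall>t\<in>J. a t * Z \<omega> t < r) \<longleftrightarrow> s < r" if "0 < r"
    proof -
      have "s < r \<longleftrightarrow> wsup J a (Z \<omega>) < ennreal r" using s that by (simp add: ennreal_less_iff)
      also have "\<dots> \<longleftrightarrow> (\<forall>t\<in>J. ennreal (a t * Z \<omega> t) < ennreal r)"
      proof (cases "J = {}")
        case False
        have "wsup J a (Z \<omega>) = Max ((\<lambda>t. ennreal (a t * Z \<omega> t)) ` J)"
          unfolding wsup_def using J False by (simp add: Max_Sup)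
        then show ?thesis using J False by simp
      qed (use that in \<open>simp add: wsup_def bot_ennreal\<close>)
      finally show ?thesis using that by (simp add: ennreal_less_ennreal_iff)
    qed
    have lim: "(\<lambda>n. ?f n \<omega>) \<longlonglongrightarrow> ennreal (if s < r then r else 0)"
      unfolding f using max_left_difference_quotient(3)[of r s] Z0[of t0] by (intro tendsto_ennrealI) (simp add: r_def)
    have "ennreal (if s < r then r else 0) = ennreal (Z \<omega> t0) * indicator {\<omega>. \<forall>t\<in>J. a t * Z \<omega> t < Z \<omega> t0} \<omega>"
    proof (cases "0 < r")
      case True then show ?thesis using less by (auto simp: r_def indicator_def)
    next
      case False then show ?thesis using s Z0[of t0] by (auto simp: r_def)
    qed
    with lim have "(\<lambda>n. ?f n \<omega>) \<longlonglongrightarrow> ennreal (Z \<omega> t0) * indicator {\<omega>. \<forall>t\<in>J. a t * Z \<omega> t < Z \<omega> t0} \<omega>" by simp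
    moreover have "?f n \<omega> \<le> ennreal r" for n
      unfolding f using max_left_difference_quotient(2)[of r n s] Z0[of t0] by (intro ennreal_leI) (simp add: r_def)
    ultimately show ?thesis by (simp add: r_def)
  qed
  have "(\<lambda>n. \<integral>\<^sup>+\<omega>. ?f n \<omega> \<partial>M) \<longlonglongrightarrow> dominance t0 J a"
    unfolding dominance_def
  proof (rule nn_integral_dominated_convergence[where w="\<lambda>\<omega>. ennreal (Z \<omega> t0)"])
    have [measurable]: "Measurable.pred M (\<lambda>\<omega>. \<forall>t\<in>J. a t * Z \<omega> t < Z \<omega> t0)"
      using J(1) by measurable
    show "(\<lambda>\<omega>. ennreal (Z \<omega> t0) * indicator {\<omega>. \<forall>t\<in>J. a t * Z \<omega> t < Z \<omega> t0} \<omega>) \<in> borel_measurable M"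
      by measurable
    show "AE \<omega> in M. (\<lambda>n. ?f n \<omega>) \<longlonglongrightarrow> ennreal (Z \<omega> t0) * indicator {\<omega>. \<forall>t\<in>J. a t * Z \<omega> t < Z \<omega> t0} \<omega>"
      using pt by (intro AE_I2) blast
    show "AE \<omega> in M. ?f n \<omega> \<le> ennreal (Z \<omega> t0)" for n
      using pt by (intro AE_I2) blast
  qed (auto simp: mean)
  then show ?thesis unfolding int .
qed

lemma dominance_shift:
  assumes J: "finite J" "t0 \<notin> J" and a: "\<And>t. t \<in> J \<Longrightarrow> 0 < a t"
  shows "dominance (t0 + h) ((\<lambda>t. t + h) ` J) (\<lambda>t. a (t - h)) = dominance t0 J a"
proof (rule LIMSEQ_unique)
  let ?J = "(\<lambda>t. t + h) ` J" and ?a = "\<lambda>t. a (t - h)"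
  show "(\<lambda>n. ennreal (real n + 2) * ((\<integral>\<^sup>+\<omega>. wsup (insert (t0 + h) ?J) (?a(t0 + h := 1)) (Z \<omega>) \<partial>M)
     - (\<integral>\<^sup>+\<omega>. wsup (insert (t0 + h) ?J) (?a(t0 + h := 1 - 1 / (real n + 2))) (Z \<omega>) \<partial>M))) \<longlonglongrightarrow> dominance (t0 + h) ?J ?a"
    by (rule dominance_limit) (use J a in auto)
  have eq: "(\<integral>\<^sup>+\<omega>. wsup (insert (t0 + h) ?J) (?a(t0 + h := v)) (Z \<omega>) \<partial>M)
      = (\<integral>\<^sup>+\<omega>. wsup (insert t0 J) (a(t0 := v)) (Z \<omega>) \<partial>M)" if "0 < v" for v
  proof -
    have "(\<lambda>t. (a(t0 := v)) (t - h)) = ?a(t0 + h := v)" by (auto simp: fun_eq_iff)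
    moreover have "(\<lambda>t. t + h) ` insert t0 J = insert (t0 + h) ?J" by simp
    moreover have "(\<integral>\<^sup>+\<omega>. wsup ((\<lambda>t. t + h) ` insert t0 J) (\<lambda>t. (a(t0 := v)) (t - h)) (Z \<omega>) \<partial>M)
      = (\<integral>\<^sup>+\<omega>. wsup (insert t0 J) (a(t0 := v)) (Z \<omega>) \<partial>M)"
      by (rule wsup_mean_shift) (use J a that in auto)
    ultimately show ?thesis by simp
  qed
  have u: "0 < 1 - 1 / (real n + 2)" for n by (simp add: field_simps)
  show "(\<lambda>n. ennreal (real n + 2) * ((\<integral>\<^sup>+\<omega>. wsup (insert (t0 + h) ?J) (?a(t0 + h := 1)) (Z \<omega>) \<partial>M)
     - (\<integral>\<^sup>+\<omega>. wsup (insert (t0 + h) ?J) (?a(t0 + h := 1 - 1 / (real n + 2))) (Z \<omega>) \<partial>M))) \<longlonglongrightarrow> dominance t0 J a"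
    unfolding eq[OF u] eq[OF zero_less_one] by (rule dominance_limit) (use J a in auto)
qed

definition normalised :: "real^'n \<Rightarrow> 'a \<Rightarrow> real^'n \<Rightarrow> real" where
  "normalised t0 \<omega> = (\<lambda>t. inverse (Z \<omega> t0) * Z \<omega> t)"

lemma normalised_measurable [measurable]: "normalised t0 \<in> measurable M path_space"
proof (rule measurable_path_spaceI)
  show "normalised t0 \<omega> \<in> cadlag_space" if "\<omega> \<in> space M" for \<omega>
    unfolding normalised_def using paths[OF that] path_nonneg by (intro scale_cadlag) auto
  show "(\<lambda>\<omega>. normalised t0 \<omega> t) \<in> borel_measurable M" for t
    unfolding normalised_def by measurable
qed

text \<open>
  The law of \<open>Z / Z (t0 + h)\<close>, shifted back by \<open>h\<close>, under the probability measure with density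
  \<open>Z (t0 + h)\<close>. Division by zero yields the zero path on a set of weight zero.
\<close>

definition tilted :: "real^'n \<Rightarrow> real^'n \<Rightarrow> (real^'n \<Rightarrow> real) measure" where
  "tilted h t0 = distr (density M (\<lambda>\<omega>. ennreal (Z \<omega> (t0 + h)))) path_space
     (\<lambda>\<omega>. backshift (- h) (normalised (t0 + h) \<omega>))"

definition orthants :: "(real^'n \<Rightarrow> real) set set" where
  "orthants = {{f\<in>cadlag_space. \<forall>t\<in>J. f t < b t} | J b. finite J}"

lemma sets_path_space_orthants: "sets (path_space :: (real^'n \<Rightarrow> real) measure) = sigma_sets cadlag_space orthants"
proof (rule antisym)
  let ?S = "sigma cadlag_space (orthants :: (real^'n \<Rightarrow> real) set set)"
  have sub: "orthants \<subseteq> Pow cadlag_space" by (auto simp: orthants_def)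
  have spS: "space ?S = cadlag_space" by (simp add: space_measure_of_conv)
  have stS: "sets ?S = sigma_sets cadlag_space orthants" by (rule sets_measure_of[OF sub])
  have m: "(\<lambda>f. f) \<in> measurable ?S path_space"
  proof (rule measurable_path_spaceI)
    show "(\<lambda>f. f t) \<in> borel_measurable ?S" for t :: "real^'n"
    proof (rule borel_measurableI_less)
      fix y :: real
      have "{f \<in> cadlag_space. f t < y} = {f\<in>cadlag_space. \<forall>s\<in>{t}. f s < (\<lambda>_. y) s}" by simp
      then have "{f \<in> cadlag_space. f t < y} \<in> orthants"
        unfolding orthants_def by (intro CollectI exI[of _ "{t}"] exI[of _ "\<lambda>_. y"]) simp
      then show "{f \<in> space ?S. f t < y} \<in> sets ?S" unfolding spS stS by (rule sigma_sets.Basic)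
    qed
  qed (simp add: spS)
  show "sets path_space \<subseteq> sigma_sets cadlag_space (orthants :: (real^'n \<Rightarrow> real) set set)"
  proof
    fix A :: "(real^'n \<Rightarrow> real) set" assume A: "A \<in> sets path_space"
    have "A \<inter> cadlag_space \<in> sigma_sets cadlag_space orthants"
      using measurable_sets[OF m A] by (simp only: spS stS vimage_ident)
    moreover have "A \<subseteq> cadlag_space" using sets.sets_into_space[OF A] by simp
    ultimately show "A \<in> sigma_sets cadlag_space orthants" by (simp add: Int_absorb2)
  qed
  have "orthants \<subseteq> sets path_space"
  proof
    fix S :: "(real^'n \<Rightarrow> real) set" assume "S \<in> orthants"
    then obtain J b where S: "S = {f\<in>space path_space. \<forall>t\<in>J. f t < b t}" and J: "finite J" by (auto simp: orthants_def)
    note [measurable] = eval_measurable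
    show "S \<in> sets path_space" unfolding S using J by measurable
  qed
  then show "sigma_sets cadlag_space orthants \<subseteq> sets (path_space :: (real^'n \<Rightarrow> real) measure)"
    using sets.sigma_sets_subset[of orthants "path_space :: (real^'n \<Rightarrow> real) measure"] by simp
qed

text \<open>
  A normalised path lies below \<open>b\<close> at the sites \<open>J\<close> iff the value at \<open>t0\<close> dominates the other values
  with weights \<open>1 / b\<close>. At \<open>t0\<close> itself the normalised path equals 1, and negative or
  zero bounds are impossible, which explains the exceptional cases.
\<close>

lemma tilted_orthant:
  assumes J: "finite J"
  shows "emeasure (tilted h t0) {f\<in>cadlag_space. \<forall>t\<in>J. f t < b t} =
    (if (\<exists>t\<in>J. b t \<le> 0) \<or> (t0 \<in> J \<and> b t0 \<le> 1) then 0
     else dominance (t0 + h) ((\<lambda>t. t + h) ` (J - {t0})) (\<lambda>t. inverse (b (t - h))))"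
proof -
  let ?S = "{f\<in>cadlag_space. \<forall>t\<in>J. f t < b t}"
  have S: "?S \<in> sets path_space"
    unfolding sets_path_space_orthants using J by (intro sigma_sets.Basic) (auto simp: orthants_def)
  have T: "(\<lambda>\<omega>. backshift (- h) (normalised (t0 + h) \<omega>)) \<in> measurable M path_space"
    by (rule measurable_compose[OF normalised_measurable backshift_measurable])
  have "emeasure (tilted h t0) ?S = emeasure (density M (\<lambda>\<omega>. ennreal (Z \<omega> (t0 + h))))
     ((\<lambda>\<omega>. backshift (- h) (normalised (t0 + h) \<omega>)) -` ?S \<inter> space M)"
    unfolding tilted_def using T S by (subst emeasure_distr) auto
  also have "\<dots> = (\<integral>\<^sup>+\<omega>. ennreal (Z \<omega> (t0 + h)) * indicator ((\<lambda>\<omega>. backshift (- h) (normalised (t0 + h) \<omega>)) -` ?S \<inter> space M) \<omega> \<partial>M)"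
    by (rule emeasure_density) (use measurable_sets[OF T S] in auto)
  also have "\<dots> = (\<integral>\<^sup>+\<omega>. ennreal (Z \<omega> (t0 + h)) * indicator {\<omega>. \<forall>t\<in>J. Z \<omega> (t + h) < b t * Z \<omega> (t0 + h)} \<omega> \<partial>M)"
  proof (rule nn_integral_cong)
    fix \<omega> assume \<omega>: "\<omega> \<in> space M"
    have "0 < Z \<omega> (t0 + h) \<or> Z \<omega> (t0 + h) = 0" using path_nonneg[OF paths[OF \<omega>], of "t0 + h"] by linarith
    then show "ennreal (Z \<omega> (t0 + h)) * indicator ((\<lambda>\<omega>. backshift (- h) (normalised (t0 + h) \<omega>)) -` ?S \<inter> space M) \<omega>
      = ennreal (Z \<omega> (t0 + h)) * indicator {\<omega>. \<forall>t\<in>J. Z \<omega> (t + h) < b t * Z \<omega> (t0 + h)} \<omega>"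
      using \<omega> measurable_space[OF T \<omega>]
      by (auto simp: indicator_def backshift_def normalised_def field_simps)
  qed
  also have "\<dots> = (if (\<exists>t\<in>J. b t \<le> 0) \<or> (t0 \<in> J \<and> b t0 \<le> 1) then 0
     else dominance (t0 + h) ((\<lambda>t. t + h) ` (J - {t0})) (\<lambda>t. inverse (b (t - h))))"
  proof (cases "(\<exists>t\<in>J. b t \<le> 0) \<or> (t0 \<in> J \<and> b t0 \<le> 1)")
    case True
    have "(\<integral>\<^sup>+\<omega>. ennreal (Z \<omega> (t0 + h)) * indicator {\<omega>. \<forall>t\<in>J. Z \<omega> (t + h) < b t * Z \<omega> (t0 + h)} \<omega> \<partial>M) = (\<integral>\<^sup>+\<omega>. 0 \<partial>M)"
    proof (rule nn_integral_cong)
      fix \<omega> assume \<omega>: "\<omega> \<in> space M"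
      have Z0: "0 \<le> Z \<omega> t" for t using path_nonneg[OF paths[OF \<omega>]] .
      have "\<not> (\<forall>t\<in>J. Z \<omega> (t + h) < b t * Z \<omega> (t0 + h))"
        using True
      proof
        assume "\<exists>t\<in>J. b t \<le> 0"
        then obtain t where t: "t \<in> J" "b t \<le> 0" by blast
        have "b t * Z \<omega> (t0 + h) \<le> Z \<omega> (t + h)"
          using mult_nonpos_nonneg[OF t(2) Z0[of "t0 + h"]] Z0[of "t + h"] by linarith
        with t show ?thesis by (auto simp: not_less)
      next
        assume t: "t0 \<in> J \<and> b t0 \<le> 1"
        then have "b t0 * Z \<omega> (t0 + h) \<le> 1 * Z \<omega> (t0 + h)" using Z0 by (intro mult_right_mono) auto
        with t show ?thesis by (force simp: not_less)
      qed
      then show "ennreal (Z \<omega> (t0 + h)) * indicator {\<omega>. \<forall>t\<in>J. Z \<omega> (t + h) < b t * Z \<omega> (t0 + h)} \<omega> = 0"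
        by (simp add: indicator_def)
    qed
    with True show ?thesis by simp
  next
    case False
    have "(\<integral>\<^sup>+\<omega>. ennreal (Z \<omega> (t0 + h)) * indicator {\<omega>. \<forall>t\<in>J. Z \<omega> (t + h) < b t * Z \<omega> (t0 + h)} \<omega> \<partial>M)
      = dominance (t0 + h) ((\<lambda>t. t + h) ` (J - {t0})) (\<lambda>t. inverse (b (t - h)))"
      unfolding dominance_def
    proof (rule nn_integral_cong)
      fix \<omega> assume \<omega>: "\<omega> \<in> space M"
      have Z0: "0 \<le> Z \<omega> t" for t using path_nonneg[OF paths[OF \<omega>]] .
      have "(\<forall>t\<in>J. Z \<omega> (t + h) < b t * Z \<omega> (t0 + h)) \<longleftrightarrow>
        (\<forall>t\<in>(\<lambda>t. t + h) ` (J - {t0}). inverse (b (t - h)) * Z \<omega> t < Z \<omega> (t0 + h))" if "0 < Z \<omega> (t0 + h)"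
      proof -
        have "Z \<omega> (t + h) < b t * Z \<omega> (t0 + h) \<longleftrightarrow> inverse (b t) * Z \<omega> (t + h) < Z \<omega> (t0 + h)" if "t \<in> J" for t
          using False that by (auto simp: field_simps)
        moreover have "t0 \<in> J \<Longrightarrow> Z \<omega> (t0 + h) < b t0 * Z \<omega> (t0 + h)"
          using False that by simp
        ultimately show ?thesis by auto
      qed
      moreover have "0 < Z \<omega> (t0 + h) \<or> Z \<omega> (t0 + h) = 0" using Z0[of "t0 + h"] by linarith
      ultimately show "ennreal (Z \<omega> (t0 + h)) * indicator {\<omega>. \<forall>t\<in>J. Z \<omega> (t + h) < b t * Z \<omega> (t0 + h)} \<omega>
        = ennreal (Z \<omega> (t0 + h)) * indicator {\<omega>. \<forall>t\<in>(\<lambda>t. t + h) ` (J - {t0}). inverse (b (t - h)) * Z \<omega> t < Z \<omega> (t0 + h)} \<omega>"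
        by (auto simp: indicator_def)
    qed
    then show ?thesis unfolding if_not_P[OF False] .
  qed
  finally show ?thesis .
qed

lemma tilted_shift: "tilted h t0 = tilted 0 t0"
proof (rule measure_eqI_generator_eq[where E=orthants and \<Omega>=cadlag_space and A="\<lambda>_. cadlag_space"])
  show "Int_stable (orthants :: (real^'n \<Rightarrow> real) set set)"
  proof (rule Int_stableI)
    fix S S' :: "(real^'n \<Rightarrow> real) set" assume "S \<in> orthants" "S' \<in> orthants"
    then obtain J b J' b' where S: "S = {f\<in>cadlag_space. \<forall>t\<in>J. f t < b t}" "finite J"
      and S': "S' = {f\<in>cadlag_space. \<forall>t\<in>J'. f t < b' t}" "finite J'" by (auto simp: orthants_def)
    let ?b = "\<lambda>t. if t \<in> J then if t \<in> J' then min (b t) (b' t) else b t else b' t"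
    have "S \<inter> S' = {f\<in>cadlag_space. \<forall>t\<in>J \<union> J'. f t < ?b t}" using S S' by auto
    then show "S \<inter> S' \<in> orthants"
      using S(2) S'(2) unfolding orthants_def by (intro CollectI exI[of _ "J \<union> J'"] exI[of _ ?b]) simp
  qed
  show "emeasure (tilted h t0) S = emeasure (tilted 0 t0) S" if "S \<in> orthants" for S
  proof -
    from that obtain J b where S: "S = {f\<in>cadlag_space. \<forall>t\<in>J. f t < b t}" and J: "finite J" by (auto simp: orthants_def)
    show ?thesis
      unfolding S tilted_orthant[OF J]
      using dominance_shift[of "J - {t0}" t0 "\<lambda>t. inverse (b t)" h] J by (auto simp: not_le)
  qed
  show "range (\<lambda>_. cadlag_space) \<subseteq> (orthants :: (real^'n \<Rightarrow> real) set set)"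
  proof -
    have "cadlag_space = {f\<in>cadlag_space. \<forall>t\<in>{}. f t < (\<lambda>_. 0::real) (t::real^'n)}" by simp
    then show ?thesis unfolding orthants_def by (auto intro!: exI[of _ "{}"])
  qed
  have "emeasure (tilted h t0) cadlag_space = dominance (t0 + h) {} (\<lambda>t. inverse ((\<lambda>_. 0) (t - h)))"
    using tilted_orthant[of "{}" h t0 "\<lambda>_. 0"] by simp
  also have "\<dots> = 1" by (simp add: dominance_def mean)
  finally show "emeasure (tilted h t0) cadlag_space \<noteq> \<infinity>" by simp
qed (auto simp: tilted_def sets_path_space_orthants orthants_def)

text \<open>
  By homogeneity \<open>G\<close> factors into the value at a site and its value on the normalised path.
\<close>

lemma positive_part_shift:
  assumes G: "G \<in> borel_measurable path_space" and hom: "homogeneous G"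
  shows "(\<integral>\<^sup>+\<omega>. G (backshift (- h) (Z \<omega>)) * indicator {\<omega>. 0 < Z \<omega> (t0 + h)} \<omega> \<partial>M) = integral\<^sup>N (tilted h t0) G"
proof -
  have T: "(\<lambda>\<omega>. backshift (- h) (normalised (t0 + h) \<omega>)) \<in> measurable M path_space"
    by (rule measurable_compose[OF normalised_measurable backshift_measurable])
  have "integral\<^sup>N (tilted h t0) G =
     (\<integral>\<^sup>+\<omega>. ennreal (Z \<omega> (t0 + h)) * G (backshift (- h) (normalised (t0 + h) \<omega>)) \<partial>M)"
    unfolding tilted_def using T G measurable_compose[OF T G]
    by (subst nn_integral_distr, simp, simp, subst nn_integral_density, auto)
  also have "\<dots> = (\<integral>\<^sup>+\<omega>. G (backshift (- h) (Z \<omega>)) * indicator {\<omega>. 0 < Z \<omega> (t0 + h)} \<omega> \<partial>M)"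
  proof (rule nn_integral_cong)
    fix \<omega> assume \<omega>: "\<omega> \<in> space M"
    show "ennreal (Z \<omega> (t0 + h)) * G (backshift (- h) (normalised (t0 + h) \<omega>))
       = G (backshift (- h) (Z \<omega>)) * indicator {\<omega>. 0 < Z \<omega> (t0 + h)} \<omega>"
    proof (cases "0 < Z \<omega> (t0 + h)")
      case True
      have eq: "backshift (- h) (Z \<omega>) = (\<lambda>t. Z \<omega> (t0 + h) * backshift (- h) (normalised (t0 + h) \<omega>) t)"
        using True by (auto simp: backshift_def normalised_def)
      have "G (backshift (- h) (Z \<omega>)) = ennreal (Z \<omega> (t0 + h)) * G (backshift (- h) (normalised (t0 + h) \<omega>))"
        unfolding eq using hom True measurable_space[OF T \<omega>] unfolding homogeneous_def by auto
      with True show ?thesis by simp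
    next
      case False
      with path_nonneg[OF paths[OF \<omega>], of "t0 + h"] have "Z \<omega> (t0 + h) = 0" by linarith
      then show ?thesis by simp
    qed
  qed
  finally show ?thesis by simp
qed

lemma backshift_0 [simp]: "backshift 0 f = f" by (simp add: backshift_def)

text \<open>
  A nonzero cadlag path is positive at some dyadic point. Splitting \<open>G\<close> according to the first
  such point \<open>q k\<close> gives homogeneous functionals that live where the path is positive at \<open>q k\<close>, and for
  these the law of the path normalised at \<open>q k\<close> decides.
\<close>

proposition shift_invariance:
  assumes G: "G \<in> borel_measurable path_space" and hom: "homogeneous G"
  shows "(\<integral>\<^sup>+\<omega>. G (backshift h (Z \<omega>)) \<partial>M) = (\<integral>\<^sup>+\<omega>. G (Z \<omega>) \<partial>M)"
proof -
  define q :: "nat \<Rightarrow> real^'n" where "q = from_nat_into dyadics"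
  have q: "range q = dyadics"
    unfolding q_def using countable_dyadics dyadic_above_in_dyadics by (intro range_from_nat_into) auto
  let ?A = "\<lambda>k. {f\<in>space path_space. 0 < f (q k) \<and> (\<forall>j\<in>{..<k}. f (q j) = 0)}"
  define Gk where "Gk k f = G f * indicator (?A k) f" for k f
  note [measurable] = eval_measurable
  have A: "?A k \<in> sets path_space" for k by measurable
  have Gk: "Gk k \<in> borel_measurable path_space" for k
    unfolding Gk_def using G A by (intro borel_measurable_times_ennreal borel_measurable_indicator) auto
  have Gk_hom: "homogeneous (Gk k)" for k
    unfolding homogeneous_def
  proof (intro conjI ballI allI impI)
    show "Gk k (\<lambda>_. 0) = 0" using hom by (simp add: Gk_def homogeneous_def)
    fix f :: "real^'n \<Rightarrow> real" and c :: real assume f: "f \<in> cadlag_space" and c: "0 < c"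
    have "indicator (?A k) (\<lambda>t. c * f t) = (indicator (?A k) f :: ennreal)"
      using f c scale_cadlag[OF f, of c] by (auto simp: indicator_def zero_less_mult_iff)
    then show "Gk k (\<lambda>t. c * f t) = ennreal c * Gk k f"
      using hom f c by (simp add: Gk_def homogeneous_def mult.assoc)
  qed
  have sum: "G f = (\<Sum>k. Gk k f)" if f: "f \<in> cadlag_space" for f
  proof (cases "\<exists>t. 0 < f t")
    case True
    then obtain p where p: "p \<in> dyadics" "0 < f p" using path_pos_dyadic[OF f] by blast
    then obtain k where "p = q k" using q by (metis rangeE)
    with p have "0 < f (q k)" by simp
    then obtain k0 where k0: "0 < f (q k0)" and least: "\<And>j. j < k0 \<Longrightarrow> \<not> 0 < f (q j)"
      using exists_least_iff[of "\<lambda>k. 0 < f (q k)"] by blast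
    have z: "f (q j) = 0" if "j < k0" for j
      using least[OF that] path_nonneg[OF f, of "q j"] by linarith
    have "Gk k f = 0" if "k \<noteq> k0" for k
    proof (cases "k < k0")
      case True
      then have "f \<notin> ?A k" using z[OF True] by simp
      then show ?thesis by (simp only: Gk_def indicator_simps mult_zero_right not_False_eq_True)
    next
      case False
      with that have "k0 \<in> {..<k}" by simp
      then have "f \<notin> ?A k" using k0 by force
      then show ?thesis by (simp only: Gk_def indicator_simps mult_zero_right not_False_eq_True)
    qed
    then have "(\<Sum>k. Gk k f) = (\<Sum>k\<in>{k0}. Gk k f)"
      by (intro suminf_finite) auto
    also have "\<dots> = Gk k0 f" by simp
    also have "\<dots> = G f"
    proof -
      have "f \<in> ?A k0" using z k0 f by simp
      then show ?thesis by (simp only: Gk_def indicator_simps mult_1_right)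
    qed
    finally show ?thesis by simp
  next
    case False
    then have "f t = 0" for t using path_nonneg[OF f, of t] by (simp add: not_less antisym)
    then have "f = (\<lambda>_. 0)" by auto
    then show ?thesis using hom by (simp add: Gk_def homogeneous_def)
  qed
  have pos: "Gk k f * indicator {f. 0 < f (q k)} f = Gk k f" for k f
    by (auto simp: Gk_def indicator_def)
  have expand: "(\<integral>\<^sup>+\<omega>. G (backshift (- h) (Z \<omega>)) \<partial>M) = (\<Sum>k. integral\<^sup>N (tilted h (q k)) (Gk k))" for h
  proof -
    have T: "(\<lambda>\<omega>. backshift (- h) (Z \<omega>)) \<in> measurable M path_space"
      by (rule measurable_compose[OF Z_path_measurable backshift_measurable])
    have "(\<integral>\<^sup>+\<omega>. G (backshift (- h) (Z \<omega>)) \<partial>M) = (\<integral>\<^sup>+\<omega>. (\<Sum>k. Gk k (backshift (- h) (Z \<omega>))) \<partial>M)"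
      by (intro nn_integral_cong sum backshift_cadlag paths)
    also have "\<dots> = (\<Sum>k. \<integral>\<^sup>+\<omega>. Gk k (backshift (- h) (Z \<omega>)) \<partial>M)"
      by (intro nn_integral_suminf measurable_compose[OF T Gk])
    also have "\<dots> = (\<Sum>k. \<integral>\<^sup>+\<omega>. Gk k (backshift (- h) (Z \<omega>)) * indicator {\<omega>. 0 < Z \<omega> (q k + h)} \<omega> \<partial>M)"
      by (intro suminf_cong nn_integral_cong) (subst pos[symmetric], auto simp: indicator_def backshift_def)
    also have "\<dots> = (\<Sum>k. integral\<^sup>N (tilted h (q k)) (Gk k))"
      by (simp add: positive_part_shift[OF Gk Gk_hom])
    finally show ?thesis .
  qed
  have "(\<integral>\<^sup>+\<omega>. G (backshift h (Z \<omega>)) \<partial>M) = (\<Sum>k. integral\<^sup>N (tilted (- h) (q k)) (Gk k))"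
    using expand[of "- h"] by simp
  also have "\<dots> = (\<Sum>k. integral\<^sup>N (tilted 0 (q k)) (Gk k))" by (subst tilted_shift) simp
  also have "\<dots> = (\<integral>\<^sup>+\<omega>. G (Z \<omega>) \<partial>M)" using expand[of 0] by simp
  finally show ?thesis .
qed

end

section \<open>Grid measures and their cells\<close>

lemma grid_zero [simp]: "grid 0 = UNIV" by (simp add: grid_def)

lemma grid_add: "s \<in> grid \<delta> \<Longrightarrow> t \<in> grid \<delta> \<Longrightarrow> s + t \<in> grid \<delta>"
  unfolding grid_def by (auto split: if_splits) (metis distrib_left of_int_add)

lemma grid_uminus: "t \<in> grid \<delta> \<Longrightarrow> - t \<in> grid \<delta>"
  unfolding grid_def by (auto split: if_splits) (metis mult_minus_right of_int_minus)

lemma grid_diff: "s \<in> grid \<delta> \<Longrightarrow> t \<in> grid \<delta> \<Longrightarrow> s - t \<in> grid \<delta>"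
  using grid_add[OF _ grid_uminus, of s \<delta> t] by simp

lemma grid_0 [simp]: "0 \<in> grid \<delta>"
  unfolding grid_def by (auto intro: exI[of _ 0])

lemma grid_eq_range:
  "\<delta> \<noteq> 0 \<Longrightarrow> grid \<delta> = range (\<lambda>k::'n \<Rightarrow> int. (\<chi> i. \<delta> * of_int (k i)) :: real^'n)"
proof (rule set_eqI)
  fix t :: "real^'n" assume "\<delta> \<noteq> 0"
  then have "t \<in> grid \<delta> \<longleftrightarrow> (\<exists>k::'n \<Rightarrow> int. \<forall>i. t $ i = \<delta> * of_int (k i))"
    by (simp add: grid_def choice_iff)
  also have "\<dots> \<longleftrightarrow> t \<in> range (\<lambda>k::'n \<Rightarrow> int. (\<chi> i. \<delta> * of_int (k i)) :: real^'n)"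
    by (auto simp: vec_eq_iff image_def)
  finally show "t \<in> grid \<delta> \<longleftrightarrow> t \<in> range (\<lambda>k::'n \<Rightarrow> int. (\<chi> i. \<delta> * of_int (k i)) :: real^'n)" .
qed

lemma countable_grid: "\<delta> \<noteq> 0 \<Longrightarrow> countable (grid \<delta> :: (real^'n) set)"
  by (subst grid_eq_range) auto

lemma grid_borel [measurable]: "grid \<delta> \<in> sets borel"
proof (cases "\<delta> = 0")
  case False
  then show ?thesis by (rule sets.countable[OF _ countable_grid, rotated]) auto
qed simp

text \<open>
  The grid measure transported to the Borel sets of the whole space, so that spacing zero and
  positive spacing are treated by the same arguments.
\<close>

definition grid_lebesgue :: "real \<Rightarrow> (real^'n) measure" where
  "grid_lebesgue \<delta> = distr (grid_measure \<delta>) borel (\<lambda>t. t)"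

lemma sets_grid_lebesgue [measurable_cong, simp]: "sets (grid_lebesgue \<delta>) = sets borel"
  and space_grid_lebesgue [simp]: "space (grid_lebesgue \<delta>) = UNIV"
  by (auto simp: grid_lebesgue_def)

lemma grid_lebesgue_0: "grid_lebesgue 0 = lborel"
  by (simp add: grid_lebesgue_def grid_measure_def distr_id2)

lemma id_measurable_grid: "(\<lambda>t. t) \<in> measurable (grid_measure \<delta>) borel"
  by (auto simp: grid_measure_def measurable_def space_scale_measure)

lemma nn_integral_grid_lebesgue:
  assumes [measurable]: "g \<in> borel_measurable borel"
  shows "(\<integral>\<^sup>+t. g t \<partial>grid_lebesgue \<delta>) = (\<integral>\<^sup>+t. g t \<partial>grid_measure \<delta>)"
  unfolding grid_lebesgue_def by (subst nn_integral_distr[OF id_measurable_grid]) auto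

lemma nn_integral_grid_lebesgue_pos:
  fixes g :: "real^'n \<Rightarrow> ennreal"
  assumes \<delta>: "\<delta> \<noteq> 0" and [measurable]: "g \<in> borel_measurable borel"
  shows "(\<integral>\<^sup>+t. g t \<partial>grid_lebesgue \<delta>) = ennreal (\<delta> ^ CARD('n)) * (\<integral>\<^sup>+t. g t \<partial>count_space (grid \<delta>))"
  unfolding nn_integral_grid_lebesgue[OF assms(2)] using \<delta>
  by (simp add: grid_measure_def nn_integral_scale_measure)

lemma nn_integral_grid_restrict:
  assumes [measurable]: "g \<in> borel_measurable borel" "A \<in> sets borel"
  shows "(\<integral>\<^sup>+t\<in>A \<inter> grid \<delta>. g t \<partial>grid_measure \<delta>) = (\<integral>\<^sup>+t. g t * indicator A t \<partial>grid_lebesgue \<delta>)"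
proof -
  have sp: "t \<in> space (grid_measure \<delta>) \<Longrightarrow> t \<in> grid \<delta>" for t :: "real^'n"
    by (simp add: grid_measure_def space_scale_measure split: if_splits)
  have "(\<integral>\<^sup>+t. g t * indicator A t \<partial>grid_lebesgue \<delta>) = (\<integral>\<^sup>+t. g t * indicator A t \<partial>grid_measure \<delta>)"
    by (rule nn_integral_grid_lebesgue) measurable
  also have "\<dots> = (\<integral>\<^sup>+t\<in>A \<inter> grid \<delta>. g t \<partial>grid_measure \<delta>)"
    by (intro nn_integral_cong) (use sp in \<open>auto simp: indicator_def\<close>)
  finally show ?thesis by simp
qed

lemma AE_grid_lebesgue: "AE t in grid_lebesgue \<delta>. t \<in> grid \<delta>"
  unfolding grid_lebesgue_def
proof (subst AE_distr_iff[OF id_measurable_grid])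
  show "AE t in grid_measure \<delta>. t \<in> grid \<delta>"
    by (rule AE_I2) (simp add: grid_measure_def space_scale_measure split: if_splits)
qed simp

lemma nn_integral_grid_shift:
  fixes g :: "real^'n \<Rightarrow> ennreal"
  assumes h: "h \<in> grid \<delta>" and g [measurable]: "g \<in> borel_measurable borel"
  shows "(\<integral>\<^sup>+t. g (t + h) \<partial>grid_lebesgue \<delta>) = (\<integral>\<^sup>+t. g t \<partial>grid_lebesgue \<delta>)"
proof (cases "\<delta> = 0")
  case True
  have "(\<integral>\<^sup>+t. g t \<partial>distr lborel borel ((+) h)) = (\<integral>\<^sup>+t. g (h + t) \<partial>lborel)"
    by (rule nn_integral_distr) auto
  then show ?thesis using True by (simp add: grid_lebesgue_0 lborel_distr_plus add.commute)
next
  case False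
  have "bij_betw (\<lambda>t. t + h) (grid \<delta>) (grid \<delta>)"
    by (rule bij_betw_byWitness[of _ "\<lambda>t. t - h"]) (use h grid_add grid_diff in auto)
  from nn_integral_bij_count_space[OF this, of g] show ?thesis
    using False by (simp add: nn_integral_grid_lebesgue_pos)
qed

lemma cell_borel [measurable]: "cell L c \<in> sets borel"
proof -
  have "cell L c = {t \<in> space borel. \<forall>i. c $ i \<le> t $ i \<and> t $ i < c $ i + L}" by (auto simp: cell_def)
  moreover have [measurable]: "(\<lambda>t::real^'n. t $ i) \<in> borel_measurable borel" for i
    by (intro borel_measurable_continuous_onI continuous_intros)
  ultimately show ?thesis by simp
qed

lemma cell_shift: "t + h \<in> cell L c \<longleftrightarrow> t \<in> cell L (c - h)"
  by (auto simp: cell_def algebra_simps)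

definition cell_of :: "real \<Rightarrow> real^'n \<Rightarrow> real^'n" where
  "cell_of L t = (\<chi> i. L * of_int \<lfloor>t $ i / L\<rfloor>)"

lemma cell_of_grid: "0 < L \<Longrightarrow> cell_of L t \<in> grid L"
  by (auto simp: grid_def cell_of_def)

lemma in_cell_iff: 
  assumes L: "0 < L" and c: "c \<in> grid L"
  shows "t \<in> cell L c \<longleftrightarrow> c = cell_of L t"
proof -
  have "(c $ i \<le> t $ i \<and> t $ i < c $ i + L) \<longleftrightarrow> c $ i = L * of_int \<lfloor>t $ i / L\<rfloor>" for i
  proof -
    from c L obtain k where k: "c $ i = L * of_int k" by (auto simp: grid_def split: if_splits)
    have "(c $ i \<le> t $ i \<and> t $ i < c $ i + L) \<longleftrightarrow> (of_int k \<le> t $ i / L \<and> t $ i / L < of_int k + 1)"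
      using L by (simp add: k field_simps)
    also have "\<dots> \<longleftrightarrow> \<lfloor>t $ i / L\<rfloor> = k" by (auto simp: floor_eq_iff)
    finally show ?thesis using k L by auto
  qed
  then show ?thesis by (auto simp: cell_def cell_of_def vec_eq_iff)
qed

lemma sum_cell_indicator:
  assumes L: "0 < L"
  shows "(\<integral>\<^sup>+c. indicator (cell L c) t \<partial>count_space (grid L)) = (1 :: ennreal)"
proof -
  have "(\<integral>\<^sup>+c. indicator (cell L c) t \<partial>count_space (grid L)) = (\<integral>\<^sup>+c. indicator {cell_of L t} c \<partial>count_space (grid L))"
    by (intro nn_integral_cong) (auto simp: in_cell_iff[OF L] indicator_def)
  also have "\<dots> = 1" using cell_of_grid[OF L, of t] by (simp add: one_ennreal_def)
  finally show ?thesis .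
qed

lemma nn_integral_cells:
  fixes g :: "real^'n \<Rightarrow> ennreal"
  assumes L: "0 < L" and N: "sets N = sets borel" and g: "g \<in> borel_measurable borel"
  shows "(\<integral>\<^sup>+t. g t \<partial>N) = (\<integral>\<^sup>+c. \<integral>\<^sup>+t. g t * indicator (cell L c) t \<partial>N \<partial>count_space (grid L))"
proof -
  note [measurable_cong] = N
  have "(\<integral>\<^sup>+t. g t \<partial>N) = (\<integral>\<^sup>+t. \<integral>\<^sup>+c. g t * indicator (cell L c) t \<partial>count_space (grid L) \<partial>N)"
    by (intro nn_integral_cong) (subst nn_integral_cmult, simp, simp add: sum_cell_indicator[OF L])
  also have "\<dots> = (\<integral>\<^sup>+c. \<integral>\<^sup>+t. g t * indicator (cell L c) t \<partial>N \<partial>count_space (grid L))"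
    by (rule nn_integral_count_space_nn_integral) (use L g countable_grid[of L] in \<open>auto intro!: borel_measurable_times_ennreal simp: measurable_cong_sets[OF N refl]\<close>)
  finally show ?thesis .
qed

lemma card_grid_cell_0:
  assumes L: "0 < L"
  shows "finite (cell (real n * L) 0 \<inter> grid L :: (real^'n) set)"
    and "card (cell (real n * L) 0 \<inter> grid L :: (real^'n) set) = n ^ CARD('n)"
proof -
  let ?F = "\<lambda>k::'n \<Rightarrow> int. (\<chi> i. L * of_int (k i)) :: real^'n"
  let ?K = "PiE UNIV (\<lambda>_. {0..<int n}) :: ('n \<Rightarrow> int) set"
  have eq: "cell (real n * L) 0 \<inter> grid L = ?F ` ?K"
  proof -
    have "?F k \<in> cell (real n * L) 0 \<longleftrightarrow> k \<in> ?K" for k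
    proof -
      have "0 \<le> L * real_of_int (k i) \<and> L * real_of_int (k i) < real n * L \<longleftrightarrow> 0 \<le> k i \<and> k i < int n" for i
        using L by (simp add: zero_le_mult_iff mult.commute[of L]) (metis of_int_less_iff of_int_of_nat_eq)
      then show ?thesis by (auto simp: cell_def PiE_UNIV_domain Pi_iff)
    qed
    then show ?thesis using L by (auto simp: grid_eq_range)
  qed
  have inj: "inj_on ?F ?K" using L by (auto simp: inj_on_def vec_eq_iff fun_eq_iff)
  show "finite (cell (real n * L) 0 \<inter> grid L :: (real^'n) set)" unfolding eq by (auto intro!: finite_PiE)
  show "card (cell (real n * L) 0 \<inter> grid L :: (real^'n) set) = n ^ CARD('n)"
    unfolding eq by (subst card_image[OF inj]) (simp add: card_PiE)
qed

lemma card_grid_cell: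
  fixes c :: "real^'n"
  assumes L: "0 < L" and c: "c \<in> grid L"
  shows "finite (cell (real n * L) c \<inter> grid L)"
    and "card (cell (real n * L) c \<inter> grid L) = n ^ CARD('n)"
proof -
  have "bij_betw (\<lambda>t. t + c) (cell (real n * L) 0 \<inter> grid L) (cell (real n * L) c \<inter> grid L)"
  proof (rule bij_betw_byWitness[of _ "\<lambda>t. t - c"])
    show "(\<lambda>t. t + c) ` (cell (real n * L) 0 \<inter> grid L) \<subseteq> cell (real n * L) c \<inter> grid L"
      using c by (auto simp: cell_shift intro: grid_add)
    show "(\<lambda>t. t - c) ` (cell (real n * L) c \<inter> grid L) \<subseteq> cell (real n * L) 0 \<inter> grid L"
      using c by (auto simp: cell_def algebra_simps intro: grid_diff)
  qed auto
  from bij_betw_finite[OF this] bij_betw_same_card[OF this] card_grid_cell_0[OF L, where 'n='n, of n]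
  show "finite (cell (real n * L) c \<inter> grid L)" "card (cell (real n * L) c \<inter> grid L) = n ^ CARD('n)" by auto
qed

text \<open>
  The condition on a side length \<open>L\<close> under which shifts by the grid of spacing \<open>L\<close> preserve the grid
  of spacing \<open>\<delta>\<close> and every cell based at a point of that grid has measure \<open>L^d\<close>.
\<close>

definition coarser :: "real \<Rightarrow> real \<Rightarrow> bool" where
  "coarser \<delta> L \<longleftrightarrow> 0 < L \<and> 0 \<le> \<delta> \<and> (\<delta> = 0 \<or> (\<exists>k::nat. L = real k * \<delta>))"

lemma coarserD: "coarser \<delta> L \<Longrightarrow> 0 < L" by (simp add: coarser_def)

lemma coarser_grid: 
  assumes "coarser \<delta> L" shows "grid L \<subseteq> grid \<delta>"
proof (cases "\<delta> = 0")
  case False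
  with assms obtain k where L: "L = real k * \<delta>" and k: "0 < L" by (auto simp: coarser_def)
  show ?thesis
  proof
    fix t :: "real^'n" assume "t \<in> grid L"
    then have *: "\<exists>j::int. t $ i = L * of_int j" for i using k by (auto simp: grid_def split: if_splits)
    have "\<exists>j::int. t $ i = \<delta> * of_int j" for i
    proof -
      from * obtain j :: int where "t $ i = L * of_int j" by blast
      then have "t $ i = \<delta> * of_int (int k * j)" by (simp add: L)
      then show ?thesis by blast
    qed
    then show "t \<in> grid \<delta>" using False by (simp add: grid_def)
  qed
qed simp

lemma emeasure_cell_0:
  assumes co: "coarser \<delta> L"
  shows "emeasure (grid_lebesgue \<delta>) (cell L 0 :: (real^'n) set) = ennreal (L ^ CARD('n))"
proof (cases "\<delta> = 0")
  case True
  let ?u = "vec L :: real^'n"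
  have L: "0 < L" using co by (rule coarserD)
  have prod: "(\<Prod>b\<in>Basis. (?u - 0) \<bullet> b) = L ^ CARD('n)"
  proof -
    have "(\<Prod>b\<in>(Basis :: (real^'n) set). (?u - 0) \<bullet> b) = (\<Prod>b\<in>(Basis :: (real^'n) set). L)"
      by (intro prod.cong) (auto simp: Basis_vec_def inner_axis)
    then show ?thesis by simp
  qed
  have B: "b \<in> Basis \<Longrightarrow> 0 \<bullet> b \<le> ?u \<bullet> b" for b using L by (auto simp: Basis_vec_def inner_axis)
  have "ennreal (L ^ CARD('n)) = emeasure lborel (box 0 ?u)"
    using emeasure_lborel_box[OF B] prod by simp
  also have "\<dots> \<le> emeasure lborel (cell L (0::real^'n))"
    by (intro emeasure_mono) (auto simp: cell_def mem_box_cart less_imp_le)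
  finally have 1: "ennreal (L ^ CARD('n)) \<le> emeasure lborel (cell L (0::real^'n))" .
  have "emeasure lborel (cell L (0::real^'n)) \<le> emeasure lborel (cbox 0 ?u)"
    by (intro emeasure_mono) (auto simp: cell_def mem_box_cart less_imp_le)
  also have "\<dots> = ennreal (L ^ CARD('n))"
    using emeasure_lborel_cbox[OF B] prod by simp
  finally show ?thesis using 1 True by (simp add: grid_lebesgue_0)
next
  case False
  with co obtain k where L: "L = real k * \<delta>" and \<delta>: "0 < \<delta>" by (auto simp: coarser_def)
  have "emeasure (grid_lebesgue \<delta>) (cell L 0 :: (real^'n) set) = (\<integral>\<^sup>+t. indicator (cell L (0::real^'n)) t \<partial>grid_lebesgue \<delta>)"
    by simp
  also have "\<dots> = ennreal (\<delta> ^ CARD('n)) * (\<integral>\<^sup>+t. indicator (cell L (0::real^'n)) t \<partial>count_space (grid \<delta>))"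
    using \<delta> by (intro nn_integral_grid_lebesgue_pos) auto
  also have "(\<integral>\<^sup>+t. indicator (cell L (0::real^'n)) t \<partial>count_space (grid \<delta>)) = 
     (\<integral>\<^sup>+t. indicator (cell L (0::real^'n) \<inter> grid \<delta>) t \<partial>count_space (grid \<delta>))"
    by (intro nn_integral_cong) (auto simp: indicator_def)
  also have "\<dots> = of_nat (k ^ CARD('n))"
    using card_grid_cell_0[OF \<delta>, of k, where 'n='n] by (simp add: L)
  also have "ennreal (\<delta> ^ CARD('n)) * of_nat (k ^ CARD('n)) = ennreal (L ^ CARD('n))"
    using \<delta> by (simp add: L ennreal_of_nat_eq_real_of_nat ennreal_mult[symmetric] power_mult_distrib mult.commute)
  finally show ?thesis .
qed

lemma emeasure_cell:
  fixes c :: "real^'n"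
  assumes co: "coarser \<delta> L" and c: "c \<in> grid \<delta>"
  shows "emeasure (grid_lebesgue \<delta>) (cell L c) = ennreal (L ^ CARD('n))"
proof -
  have "emeasure (grid_lebesgue \<delta>) (cell L c) = (\<integral>\<^sup>+t. indicator (cell L c) t \<partial>grid_lebesgue \<delta>)" by simp
  also have "\<dots> = (\<integral>\<^sup>+t. indicator (cell L c) (t + c) \<partial>grid_lebesgue \<delta>)"
    by (rule nn_integral_grid_shift[symmetric, OF c]) simp
  also have "\<dots> = (\<integral>\<^sup>+t. indicator (cell L (0::real^'n)) t \<partial>grid_lebesgue \<delta>)"
    by (rule nn_integral_cong) (auto simp: indicator_def cell_shift)
  finally show ?thesis by (simp add: emeasure_cell_0[OF co])
qed

lemma coarser_exists: "0 \<le> \<delta> \<Longrightarrow> \<exists>L. coarser \<delta> L"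
  by (rule exI[of _ "if \<delta> = 0 then 1 else \<delta>"]) (auto simp: coarser_def intro: exI[of _ 1])

lemma sigma_finite_grid_lebesgue:
  assumes "0 \<le> \<delta>" shows "sigma_finite_measure (grid_lebesgue \<delta> :: (real^'n) measure)"
proof -
  obtain L where co: "coarser \<delta> L" using coarser_exists[OF assms] by blast
  note L = coarserD[OF co]
  show ?thesis
  proof (unfold_locales, intro exI conjI)
    show "countable (cell L ` grid L :: (real^'n) set set)" using L countable_grid[of L] by auto
    show "cell L ` grid L \<subseteq> sets (grid_lebesgue \<delta> :: (real^'n) measure)" by auto
    show "\<Union> (cell L ` grid L) = space (grid_lebesgue \<delta> :: (real^'n) measure)"
      using in_cell_iff[OF L cell_of_grid[OF L]] cell_of_grid[OF L] by auto
    show "\<forall>a\<in>cell L ` grid L. emeasure (grid_lebesgue \<delta> :: (real^'n) measure) a \<noteq> \<infinity>"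
      using emeasure_cell[OF co, where 'n='n] coarser_grid[OF co, where 'a='n] by (auto simp: subset_iff)
  qed
qed

text \<open>
  The integral is folded onto the cell at the origin.
\<close>

lemma nn_integral_cells_shift:
  fixes g :: "real^'n \<Rightarrow> ennreal"
  assumes co: "coarser \<delta> L" and g [measurable]: "g \<in> borel_measurable borel"
  shows "(\<integral>\<^sup>+t. g t \<partial>grid_lebesgue \<delta>) =
    (\<integral>\<^sup>+t. (\<integral>\<^sup>+c. g (t + c) \<partial>count_space (grid L)) * indicator (cell L 0) t \<partial>grid_lebesgue \<delta>)"
proof -
  note L = coarserD[OF co]
  have "(\<integral>\<^sup>+t. g t \<partial>grid_lebesgue \<delta>) =
     (\<integral>\<^sup>+c. \<integral>\<^sup>+t. g t * indicator (cell L c) t \<partial>grid_lebesgue \<delta> \<partial>count_space (grid L))"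
    by (rule nn_integral_cells[OF L]) auto
  also have "\<dots> = (\<integral>\<^sup>+c. \<integral>\<^sup>+t. g (t + c) * indicator (cell L 0) t \<partial>grid_lebesgue \<delta> \<partial>count_space (grid L))"
  proof (rule nn_integral_cong)
    fix c :: "real^'n" assume "c \<in> space (count_space (grid L))"
    then have c: "c \<in> grid \<delta>" using coarser_grid[OF co] by auto
    have "(\<integral>\<^sup>+t. g t * indicator (cell L c) t \<partial>grid_lebesgue \<delta>) = (\<integral>\<^sup>+t. g (t + c) * indicator (cell L c) (t + c) \<partial>grid_lebesgue \<delta>)"
      by (rule nn_integral_grid_shift[OF c, symmetric]) auto
    also have "\<dots> = (\<integral>\<^sup>+t. g (t + c) * indicator (cell L 0) t \<partial>grid_lebesgue \<delta>)"
      by (intro nn_integral_cong) (auto simp: indicator_def cell_shift)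
    finally show "(\<integral>\<^sup>+t. g t * indicator (cell L c) t \<partial>grid_lebesgue \<delta>) = (\<integral>\<^sup>+t. g (t + c) * indicator (cell L 0) t \<partial>grid_lebesgue \<delta>)" .
  qed
  also have "\<dots> = (\<integral>\<^sup>+t. \<integral>\<^sup>+c. g (t + c) * indicator (cell L 0) t \<partial>count_space (grid L) \<partial>grid_lebesgue \<delta>)"
    by (rule nn_integral_count_space_nn_integral[symmetric]) (use L countable_grid[of L] in auto)
  also have "\<dots> = (\<integral>\<^sup>+t. (\<integral>\<^sup>+c. g (t + c) \<partial>count_space (grid L)) * indicator (cell L 0) t \<partial>grid_lebesgue \<delta>)"
    by (simp add: nn_integral_multc)
  finally show ?thesis .
qed

section \<open>Functionals of a path\<close>

lemma ennreal_divide_scale: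
  "0 < c \<Longrightarrow> (ennreal c * a) / (ennreal c * b) = a / b"
proof -
  assume c: "0 < c"
  have "inverse (ennreal c * b) = inverse (ennreal c) * inverse b"
    using c by (intro ennreal_inverse_mult') auto
  moreover have "ennreal c * inverse (ennreal c) = 1"
    using c by (simp add: inverse_ennreal ennreal_mult[symmetric])
  ultimately show ?thesis
    unfolding divide_ennreal_def by (metis (no_types, opaque_lifting) mult.assoc mult.commute mult_1)
qed

lemma ennreal_divide_self_le: "(a::ennreal) / a \<le> 1"
  by (cases "a = 0 \<or> a = \<infinity>") (auto simp: ennreal_divide_self less_top)

definition mass :: "real \<Rightarrow> (real^'n) set \<Rightarrow> (real^'n \<Rightarrow> real) \<Rightarrow> ennreal" where
  "mass \<delta> A f = (\<integral>\<^sup>+t. ennreal (f t) * indicator A t \<partial>grid_lebesgue \<delta>)"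

text \<open>
  The integral over all levels of the indicator that the sojourn above the level exceeds \<open>x\<close>. Unlike
  the sojourn at a fixed level, it is homogeneous of degree one in the path. Its mean over
  the cube, divided by the volume, is the average in the definition of the Berman function.
\<close>

definition excess :: "real \<Rightarrow> real \<Rightarrow> (real^'n) set \<Rightarrow> (real^'n \<Rightarrow> real) \<Rightarrow> ennreal" where
  "excess \<delta> x A f = (\<integral>\<^sup>+s\<in>{0..}. indicator {s. ennreal x < sojourn \<delta> A f s} s \<partial>lborel)"

definition sup_sum :: "real \<Rightarrow> (real^'n) set \<Rightarrow> (real^'n \<Rightarrow> real) \<Rightarrow> ennreal" where
  "sup_sum L A f = (\<integral>\<^sup>+c. cell_sup L c f * indicator A c \<partial>count_space (grid L))"

lemma S_int_eq_mass: "f \<in> cadlag_space \<Longrightarrow> S_int \<delta> f = mass \<delta> UNIV f"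
  using nn_integral_grid_restrict[of "\<lambda>t. ennreal (f t)" UNIV \<delta>] path_measurable[of f]
  by (simp add: S_int_def mass_def)

lemma sojourn_eq:
  assumes f: "f \<in> cadlag_space" and A: "A \<in> sets borel"
  shows "sojourn \<delta> A f s = (\<integral>\<^sup>+t. indicator {t. s < f t} t * indicator A t \<partial>grid_lebesgue \<delta>)"
  unfolding sojourn_def
proof (rule nn_integral_grid_restrict[OF _ A])
  note [measurable] = path_measurable[OF f]
  show "indicator {u. s < f u} \<in> borel_measurable borel" by measurable
qed

lemma mass_measurable:
  fixes A :: "(real^'n) set"
  assumes "0 \<le> \<delta>" and [measurable]: "A \<in> sets borel"
  shows "mass \<delta> A \<in> borel_measurable path_space"
  unfolding mass_def[abs_def]
proof (rule sigma_finite_measure.borel_measurable_nn_integral[OF sigma_finite_grid_lebesgue[OF assms(1)]])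
  have [measurable]: "(\<lambda>p. fst p (snd p)) \<in> borel_measurable (path_space \<Otimes>\<^sub>M (grid_lebesgue \<delta> :: (real^'n) measure))"
    using eval_pair_measurable by (simp add: case_prod_beta' cong: measurable_cong_sets sets_pair_measure_cong)
  show "(\<lambda>(f, t). ennreal (f t) * indicator A t) \<in> borel_measurable (path_space \<Otimes>\<^sub>M grid_lebesgue \<delta>)"
    by (simp add: case_prod_beta')
qed

lemma sojourn_pair_measurable:
  fixes A :: "(real^'n) set"
  assumes \<delta>: "0 \<le> \<delta>" and A [measurable]: "A \<in> sets borel"
  shows "(\<lambda>p. sojourn \<delta> A (fst p) (snd p)) \<in> borel_measurable (path_space \<Otimes>\<^sub>M borel)"
proof -
  let ?P = "(path_space \<Otimes>\<^sub>M borel) \<Otimes>\<^sub>M (grid_lebesgue \<delta> :: (real^'n) measure)"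
  have [measurable]: "(\<lambda>q. fst (fst q) (snd q)) \<in> borel_measurable ?P"
    by (rule eval_measurable_compose) measurable
  have "(\<lambda>p. \<integral>\<^sup>+t. indicator {q. snd (fst q) < fst (fst q) (snd q)} (p, t) * indicator A t \<partial>grid_lebesgue \<delta>)
     \<in> borel_measurable (path_space \<Otimes>\<^sub>M borel)"
  proof (rule sigma_finite_measure.borel_measurable_nn_integral[OF sigma_finite_grid_lebesgue[OF \<delta>]])
    have "(\<lambda>q. indicator {q. snd (fst q) < fst (fst q) (snd q)} q * indicator A (snd q) :: ennreal) \<in> borel_measurable ?P"
      by measurable
    then show "(\<lambda>(p, t). indicator {q. snd (fst q) < fst (fst q) (snd q)} (p, t) * indicator A t :: ennreal) \<in> borel_measurable ?P"
      by (simp add: case_prod_beta')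
  qed
  also have "?this \<longleftrightarrow> ?thesis"
  proof (rule measurable_cong)
    fix p :: "(real^'n \<Rightarrow> real) \<times> real" assume "p \<in> space (path_space \<Otimes>\<^sub>M borel)"
    then have p: "fst p \<in> cadlag_space" by (auto simp: space_pair_measure)
    show "(\<integral>\<^sup>+t. indicator {q. snd (fst q) < fst (fst q) (snd q)} (p, t) * indicator A t \<partial>grid_lebesgue \<delta>)
      = sojourn \<delta> A (fst p) (snd p)"
      unfolding sojourn_eq[OF p A] by (intro nn_integral_cong) (auto simp: indicator_def)
  qed
  finally show ?thesis .
qed

lemma sojourn_measurable:
  assumes "0 \<le> \<delta>" "A \<in> sets borel" "f \<in> cadlag_space"
  shows "sojourn \<delta> A f \<in> borel_measurable borel"
proof -
  have "(\<lambda>s. (f, s)) \<in> measurable borel (path_space \<Otimes>\<^sub>M borel)"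
    using assms(3) by (intro measurable_Pair) auto
  from measurable_compose[OF this sojourn_pair_measurable[OF assms(1,2)]] show ?thesis by simp
qed

lemma excess_measurable:
  assumes "0 \<le> \<delta>" "A \<in> sets borel"
  shows "excess \<delta> x A \<in> borel_measurable path_space"
proof -
  note [measurable] = sojourn_pair_measurable[OF assms]
  have "(\<lambda>f. \<integral>\<^sup>+s. indicator {p. ennreal x < sojourn \<delta> A (fst p) (snd p)} (f, s) * indicator {0..} s \<partial>lborel)
     \<in> borel_measurable path_space"
  proof (rule lborel.borel_measurable_nn_integral)
    have "(\<lambda>p. indicator {p. ennreal x < sojourn \<delta> A (fst p) (snd p)} p * indicator {0..} (snd p) :: ennreal)
      \<in> borel_measurable (path_space \<Otimes>\<^sub>M lborel)" by measurable
    then show "(\<lambda>(f, s). indicator {p. ennreal x < sojourn \<delta> A (fst p) (snd p)} (f, s) * indicator {0..} s :: ennreal)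
      \<in> borel_measurable (path_space \<Otimes>\<^sub>M lborel)" by (simp add: case_prod_beta')
  qed
  then show ?thesis unfolding excess_def[abs_def] by (simp add: indicator_def)
qed

lemma sup_sum_measurable:
  fixes A :: "(real^'n) set"
  assumes "0 < L" shows "sup_sum L A \<in> borel_measurable path_space"
  unfolding sup_sum_def[abs_def]
proof (rule sigma_finite_measure.borel_measurable_nn_integral)
  have cnt: "countable (grid L :: (real^'n) set)" using assms by (intro countable_grid) auto
  show "sigma_finite_measure (count_space (grid L :: (real^'n) set))"
    by (rule sigma_finite_measure_count_space_countable[OF cnt])
  show "(\<lambda>(f, c). cell_sup L c f * indicator A c) \<in> borel_measurable (path_space \<Otimes>\<^sub>M count_space (grid L))"
    using cnt measurable_compose[OF measurable_pair_swap'
        measurable_pair_measure_countable1[OF cnt, of "\<lambda>(c, f). cell_sup L c f * indicator A c" path_space borel]]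
    by (auto simp: case_prod_beta')
qed

lemma mass_scale:
  "0 < c \<Longrightarrow> f \<in> cadlag_space \<Longrightarrow> A \<in> sets borel \<Longrightarrow> mass \<delta> A (\<lambda>t. c * f t) = ennreal c * mass \<delta> A f"
  unfolding mass_def using path_measurable[of f]
  by (subst nn_integral_cmult[symmetric]) (auto simp: ennreal_mult' mult.assoc)

lemma cell_sup_scale: "0 < c \<Longrightarrow> cell_sup L a (\<lambda>t. c * f t) = ennreal c * cell_sup L a f"
  unfolding cell_sup_def by (simp add: ennreal_mult' SUP_mult_left_ennreal)

lemma sup_sum_scale: "0 < c \<Longrightarrow> sup_sum L A (\<lambda>t. c * f t) = ennreal c * sup_sum L A f"
  unfolding sup_sum_def by (simp add: cell_sup_scale nn_integral_cmult mult.assoc)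

lemma sojourn_scale: "0 < c \<Longrightarrow> sojourn \<delta> A (\<lambda>t. c * f t) s = sojourn \<delta> A f (s / c)"
  unfolding sojourn_def by (intro nn_integral_cong) (auto simp: indicator_def field_simps)

lemma excess_scale:
  assumes c: "0 < c" and "0 \<le> \<delta>" "A \<in> sets borel" "f \<in> cadlag_space"
  shows "excess \<delta> x A (\<lambda>t. c * f t) = ennreal c * excess \<delta> x A f"
proof -
  note [measurable] = sojourn_measurable[OF assms(2-4)]
  have "excess \<delta> x A (\<lambda>t. c * f t) =
     (\<integral>\<^sup>+s. indicator {s. ennreal x < sojourn \<delta> A f (s / c)} s * indicator {0..} s \<partial>lborel)"
    using c by (simp add: excess_def sojourn_scale)
  also have "\<dots> = ennreal \<bar>c\<bar> * (\<integral>\<^sup>+s. indicator {s. ennreal x < sojourn \<delta> A f (s / c)} (0 + c * s) * indicator {0..} (0 + c * s) \<partial>lborel)"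
    by (rule nn_integral_real_affine) (use c in auto)
  also have "(\<integral>\<^sup>+s. indicator {s. ennreal x < sojourn \<delta> A f (s / c)} (0 + c * s) * indicator {0..} (0 + c * s) \<partial>lborel) = excess \<delta> x A f"
    unfolding excess_def using c by (intro nn_integral_cong) (auto simp: indicator_def zero_le_mult_iff)
  finally show ?thesis using c by simp
qed

lemma mass_zero [simp]: "mass \<delta> A (\<lambda>_. 0) = 0" by (simp add: mass_def)

lemma cell_sup_zero [simp]: "cell_sup L c (\<lambda>_. 0) = 0"
  by (simp add: cell_sup_def SUP_constant bot_ennreal)

lemma mass_shift:
  assumes h: "h \<in> grid \<delta>" and f: "f \<in> cadlag_space" and [measurable]: "A \<in> sets borel"
  shows "mass \<delta> A (backshift h f) = mass \<delta> {t. t + h \<in> A} f"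
proof -
  note [measurable] = path_measurable[OF f]
  have "(\<integral>\<^sup>+t. ennreal (f (t - h)) * indicator A t \<partial>grid_lebesgue \<delta>) =
    (\<integral>\<^sup>+t. ennreal (f (t + h - h)) * indicator A (t + h) \<partial>grid_lebesgue \<delta>)"
    by (rule nn_integral_grid_shift[OF h, symmetric]) measurable
  then show ?thesis unfolding mass_def backshift_def by (simp add: indicator_def)
qed

lemma sojourn_shift:
  assumes h: "h \<in> grid \<delta>" and f: "f \<in> cadlag_space" and A [measurable]: "A \<in> sets borel"
  shows "sojourn \<delta> A (backshift h f) s = sojourn \<delta> {t. t + h \<in> A} f s"
proof -
  note [measurable] = path_measurable[OF f]
  have Ah: "{t. t + h \<in> A} \<in> sets borel" by measurable
  have "(\<integral>\<^sup>+t. indicator {t. s < f (t - h)} t * indicator A t \<partial>grid_lebesgue \<delta>) =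
    (\<integral>\<^sup>+t. indicator {t. s < f (t - h)} (t + h) * indicator A (t + h) \<partial>grid_lebesgue \<delta> :: ennreal)"
    by (rule nn_integral_grid_shift[OF h, symmetric]) measurable
  then show ?thesis unfolding sojourn_eq[OF backshift_cadlag[OF f] A] sojourn_eq[OF f Ah]
    by (simp add: backshift_def indicator_def)
qed

lemma excess_shift:
  assumes "h \<in> grid \<delta>" "f \<in> cadlag_space" "A \<in> sets borel"
  shows "excess \<delta> x A (backshift h f) = excess \<delta> x {t. t + h \<in> A} f"
  unfolding excess_def sojourn_shift[OF assms] ..

lemma cell_sup_shift: "cell_sup L c (backshift h f) = cell_sup L (c - h) f"
proof -
  have "cell L (c - h) = (\<lambda>t. t - h) ` cell L c"
    by (auto simp: cell_shift[symmetric] image_iff intro!: bexI[of _ "_ + h"])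
  then show ?thesis by (simp add: cell_sup_def backshift_def image_image)
qed

lemma nn_integral_grid_reindex:
  fixes g :: "real^'n \<Rightarrow> ennreal"
  assumes h: "h \<in> grid L"
  shows "(\<integral>\<^sup>+c. g (c + h) \<partial>count_space (grid L)) = (\<integral>\<^sup>+c. g c \<partial>count_space (grid L))"
proof -
  have "bij_betw (\<lambda>t. t + h) (grid L) (grid L)"
    by (rule bij_betw_byWitness[of _ "\<lambda>t. t - h"]) (use h grid_add grid_diff in auto)
  from nn_integral_bij_count_space[OF this, of g] show ?thesis .
qed

lemma nn_integral_grid_reflect:
  fixes g :: "real^'n \<Rightarrow> ennreal"
  shows "(\<integral>\<^sup>+c. g (- c) \<partial>count_space (grid L)) = (\<integral>\<^sup>+c. g c \<partial>count_space (grid L))"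
proof -
  have "bij_betw uminus (grid L) (grid L :: (real^'n) set)"
    by (rule bij_betw_byWitness[of _ uminus]) (use grid_uminus in auto)
  from nn_integral_bij_count_space[OF this, of g] show ?thesis .
qed

lemma sup_sum_shift:
  assumes h: "h \<in> grid L"
  shows "sup_sum L A (backshift h f) = sup_sum L {t. t + h \<in> A} f"
proof -
  have "sup_sum L A (backshift h f) = (\<integral>\<^sup>+c. cell_sup L (c - h) f * indicator A c \<partial>count_space (grid L))"
    by (simp add: sup_sum_def cell_sup_shift)
  also have "\<dots> = (\<integral>\<^sup>+c. cell_sup L (c + h - h) f * indicator A (c + h) \<partial>count_space (grid L))"
    by (rule nn_integral_grid_reindex[OF h, symmetric])
  finally show ?thesis by (simp add: sup_sum_def indicator_def)
qed

lemma mass_UNIV_cells: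
  assumes L: "0 < L" and f: "f \<in> cadlag_space"
  shows "mass \<delta> UNIV f = (\<integral>\<^sup>+c. mass \<delta> (cell L c) f \<partial>count_space (grid L))"
  unfolding mass_def using path_measurable[OF f] nn_integral_cells[OF L, of "grid_lebesgue \<delta>" "\<lambda>t. ennreal (f t)"] by simp

lemma mass_mono: "A \<subseteq> B \<Longrightarrow> mass \<delta> A f \<le> mass \<delta> B f"
  unfolding mass_def by (intro nn_integral_mono) (auto simp: indicator_def)

lemma mass_cell_le:
  assumes co: "coarser \<delta> L" and c: "c \<in> grid \<delta>"
  shows "mass \<delta> (cell L c) f \<le> ennreal (L ^ CARD('n)) * cell_sup L c (f :: real^'n \<Rightarrow> real)"
proof -
  have "mass \<delta> (cell L c) f \<le> (\<integral>\<^sup>+t. cell_sup L c f * indicator (cell L c) t \<partial>grid_lebesgue \<delta>)"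
    unfolding mass_def by (intro nn_integral_mono) (auto simp: indicator_def cell_sup_def intro: SUP_upper)
  also have "\<dots> = cell_sup L c f * ennreal (L ^ CARD('n))"
    using emeasure_cell[OF co c] by (simp add: nn_integral_cmult)
  finally show ?thesis by (simp add: mult.commute)
qed

lemma mass_le_sup_sum:
  fixes f :: "real^'n \<Rightarrow> real"
  assumes co: "coarser \<delta> L" and f: "f \<in> cadlag_space"
  shows "mass \<delta> UNIV f \<le> ennreal (L ^ CARD('n)) * sup_sum L UNIV f"
proof -
  have "mass \<delta> UNIV f \<le> (\<integral>\<^sup>+c. ennreal (L ^ CARD('n)) * cell_sup L c f \<partial>count_space (grid L))"
    unfolding mass_UNIV_cells[OF coarserD[OF co] f]
    using coarser_grid[OF co, where 'a='n] by (intro nn_integral_mono mass_cell_le[OF co]) auto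
  then show ?thesis by (simp add: sup_sum_def nn_integral_cmult)
qed

lemma sojourn_mono: "A \<subseteq> B \<Longrightarrow> sojourn \<delta> A f s \<le> sojourn \<delta> B f s"
  unfolding sojourn_def by (intro nn_integral_mono) (auto simp: indicator_def)

lemma excess_mono: "A \<subseteq> B \<Longrightarrow> excess \<delta> x A f \<le> excess \<delta> x B f"
  unfolding excess_def
  by (intro nn_integral_mono) (auto simp: indicator_def dest: order_less_le_trans[OF _ sojourn_mono])

text \<open>
  A level that is exceeded on a set of positive measure lies below the supremum.
\<close>

lemma excess_le:
  assumes "\<And>t. t \<in> A \<Longrightarrow> ennreal (f t) \<le> K"
  shows "excess \<delta> x A f \<le> K"
proof (cases K rule: ennreal_cases)
  case (real r)
  have "excess \<delta> x A f \<le> (\<integral>\<^sup>+s. indicator {0..r} s \<partial>lborel)"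
    unfolding excess_def
  proof (intro nn_integral_mono)
    fix s :: real
    show "indicator {s. ennreal x < sojourn \<delta> A f s} s * indicator {0..} s \<le> (indicator {0..r} s :: ennreal)"
    proof (cases "0 \<le> s \<and> ennreal x < sojourn \<delta> A f s")
      case True
      then have "sojourn \<delta> A f s \<noteq> 0" by auto
      then have "\<exists>t\<in>A. s < f t" unfolding sojourn_def
        by (rule contrapos_np) (auto simp: indicator_def intro!: nn_integral_zero' AE_I2)
      then obtain t where "t \<in> A" "s < f t" by blast
      then have "f t \<le> r" using assms[of t] real True by (simp add: ennreal_le_iff2)
      with \<open>s < f t\<close> True show ?thesis by simp
    qed (auto simp: indicator_def)
  qed
  also have "\<dots> = ennreal r" using real by simp
  finally show ?thesis using real by simp
qed simp

lemma sup_sum_finite_sum: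
  assumes "finite (A \<inter> grid L)"
  shows "sup_sum L A f = (\<Sum>c\<in>A \<inter> grid L. cell_sup L c f)"
proof -
  have "sup_sum L A f = (\<integral>\<^sup>+c\<in>A \<inter> grid L. cell_sup L c f \<partial>count_space (grid L))"
    unfolding sup_sum_def by (intro nn_integral_cong) (auto simp: indicator_def)
  also have "\<dots> = (\<integral>\<^sup>+c. cell_sup L c f \<partial>count_space (A \<inter> grid L))"
    by (subst nn_integral_restrict_space[symmetric]) (auto simp: restrict_count_space Int_ac)
  finally show ?thesis using assms by (simp add: nn_integral_count_space_finite)
qed

lemma excess_incseq:
  fixes A :: "nat \<Rightarrow> (real^'n) set"
  assumes \<delta>: "0 \<le> \<delta>" and f: "f \<in> cadlag_space" and A: "\<And>m. A m \<in> sets borel" and inc: "incseq A" and un: "(\<Union>m. A m) = UNIV"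
  shows "(\<lambda>m. excess \<delta> x (A m) f) \<longlonglongrightarrow> excess \<delta> x UNIV f" and "incseq (\<lambda>m. excess \<delta> x (A m) f)"
proof -
  note [measurable] = path_measurable[OF f] A
  note [measurable] = sojourn_measurable[OF \<delta> A f] sojourn_measurable[OF \<delta> _ f, of UNIV]
  have U: "(UNIV :: (real^'n) set) \<in> sets borel" by simp
  have ind: "(\<lambda>m. indicator (A m) t :: ennreal) \<longlonglongrightarrow> indicator UNIV t" for t
    using LIMSEQ_indicator_incseq[OF inc, of t] un by simp
  have soj: "(\<lambda>m. sojourn \<delta> (A m) f s) \<longlonglongrightarrow> sojourn \<delta> UNIV f s" for s
    unfolding sojourn_eq[OF f A] sojourn_eq[OF f U]
  proof (rule nn_integral_LIMSEQ)
    show "incseq (\<lambda>m t. indicator {t. s < f t} t * indicator (A m) t :: ennreal)"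
      using inc by (auto simp: incseq_def le_fun_def indicator_def)
    show "(\<lambda>m. indicator {t. s < f t} t * indicator (A m) t :: ennreal)
      \<longlonglongrightarrow> indicator {t. s < f t} t * indicator UNIV t" for t
      by (intro tendsto_mult_ennreal tendsto_const ind) (auto simp: indicator_def)
  qed measurable
  show "(\<lambda>m. excess \<delta> x (A m) f) \<longlonglongrightarrow> excess \<delta> x UNIV f"
    unfolding excess_def
  proof (rule nn_integral_LIMSEQ)
    show "incseq (\<lambda>m s. indicator {s. ennreal x < sojourn \<delta> (A m) f s} s * indicator {0..} s :: ennreal)"
      unfolding incseq_def le_fun_def
    proof (intro allI impI mult_right_mono)
      fix m n :: nat and s :: real assume "m \<le> n"
      then have "A m \<subseteq> A n" using inc by (simp add: incseq_def)
      then have "sojourn \<delta> (A m) f s \<le> sojourn \<delta> (A n) f s" by (rule sojourn_mono)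
      then show "indicator {s. ennreal x < sojourn \<delta> (A m) f s} s
          \<le> (indicator {s. ennreal x < sojourn \<delta> (A n) f s} s :: ennreal)"
        by (auto simp: indicator_def dest: order_less_le_trans)
    qed simp
    show "(\<lambda>m. indicator {s. ennreal x < sojourn \<delta> (A m) f s} s * indicator {0..} s :: ennreal)
      \<longlonglongrightarrow> indicator {s. ennreal x < sojourn \<delta> UNIV f s} s * indicator {0..} s" for s
    proof (cases "ennreal x < sojourn \<delta> UNIV f s")
      case True
      from order_tendstoD(1)[OF soj True] have "\<forall>\<^sub>F m in sequentially. ennreal x < sojourn \<delta> (A m) f s" .
      then show ?thesis by (rule tendsto_eventually[OF eventually_mono]) (use True in auto)
    next
      case False
      then have "\<not> ennreal x < sojourn \<delta> (A m) f s" for m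
        using sojourn_mono[of "A m" UNIV \<delta> f s] by auto
      with False show ?thesis by simp
    qed
  qed measurable
  show "incseq (\<lambda>m. excess \<delta> x (A m) f)"
    using inc by (auto simp: incseq_def intro!: excess_mono)
qed

section \<open>Mass transport between blocks\<close>

lemma homogeneousI:
  assumes "G (\<lambda>_. 0) = 0"
    and "\<And>f c. f \<in> cadlag_space \<Longrightarrow> 0 < c \<Longrightarrow> G (\<lambda>t. c * f t) = ennreal c * G f"
  shows "homogeneous G"
  using assms by (simp add: homogeneous_def)

lemma mass_ratio_scale:
  assumes "f \<in> cadlag_space" "0 < c" "A \<in> sets borel" "B \<in> sets borel"
  shows "mass \<delta> A (\<lambda>t. c * f t) / mass \<eta> B (\<lambda>t. c * f t) = mass \<delta> A f / mass \<eta> B f"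
  using assms by (simp add: mass_scale ennreal_divide_scale)

locale invariant_law = prob_space \<mu> for \<mu> :: "(real^'n \<Rightarrow> real) measure" +
  assumes sets_law [measurable_cong]: "sets \<mu> = sets path_space"
    and shift: "\<And>G h. G \<in> borel_measurable path_space \<Longrightarrow> homogeneous G \<Longrightarrow>
        (\<integral>\<^sup>+f. G (backshift h f) \<partial>\<mu>) = (\<integral>\<^sup>+f. G f \<partial>\<mu>)"
    and sup_finite: "\<And>L. 0 < L \<Longrightarrow> (\<integral>\<^sup>+f. cell_sup L 0 f \<partial>\<mu>) < \<infinity>"
begin

lemma space_law [simp]: "space \<mu> = cadlag_space"
  using sets_eq_imp_space_eq[OF sets_law] by simp

lemma measurable_law: "borel_measurable \<mu> = borel_measurable path_space"
  by (rule measurable_cong_sets[OF sets_law refl])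

end

text \<open>
  From here on the space is partitioned into the cells of side \<open>L\<close>, indexed by the grid of spacing \<open>L\<close>.
\<close>

locale blocks = invariant_law \<mu> for \<mu> :: "(real^'n \<Rightarrow> real) measure" +
  fixes \<delta> L x :: real
  assumes coarser: "coarser \<delta> L"
begin

lemma L_pos: "0 < L" using coarser by (rule coarserD)
lemma \<delta>_nonneg: "0 \<le> \<delta>" using coarser by (simp add: coarser_def)
lemma block_grid: "(c :: real^'n) \<in> grid L \<Longrightarrow> c \<in> grid \<delta>" using coarser_grid[OF coarser] by blast
lemma in_cell_of: "t \<in> cell L (cell_of L t)"
  using in_cell_iff[OF L_pos cell_of_grid[OF L_pos], of t t] by simp

lemma countable_blocks: "countable (grid L :: (real^'n) set)" using L_pos by (intro countable_grid) auto

lemma mass_meas [measurable]: "(A :: (real^'n) set) \<in> sets borel \<Longrightarrow> mass \<delta> A \<in> borel_measurable path_space"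
  using \<delta>_nonneg by (rule mass_measurable)
lemma excess_meas [measurable]: "(A :: (real^'n) set) \<in> sets borel \<Longrightarrow> excess \<delta> x A \<in> borel_measurable path_space"
  using \<delta>_nonneg by (rule excess_measurable)
lemma sup_sum_meas [measurable]: "sup_sum L (A :: (real^'n) set) \<in> borel_measurable path_space"
  using L_pos by (rule sup_sum_measurable)

abbreviation total_mass :: "(real^'n \<Rightarrow> real) \<Rightarrow> ennreal" where
  "total_mass \<equiv> mass \<delta> UNIV"
abbreviation share :: "(real^'n) set \<Rightarrow> (real^'n \<Rightarrow> real) \<Rightarrow> ennreal" where
  "share A f \<equiv> mass \<delta> A f / total_mass f"
abbreviation "mean_sup \<equiv> \<integral>\<^sup>+f. cell_sup L 0 f \<partial>\<mu>"

lemma share_le_1: "share A f \<le> 1"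
  using divide_right_mono_ennreal[OF mass_mono[of A UNIV \<delta> f], of "total_mass f"] ennreal_divide_self_le
  by (rule order_trans) simp

lemma share_shift:
  assumes "c \<in> grid L" "f \<in> cadlag_space" "A \<in> sets borel"
  shows "share A (backshift c f) = share {t. t + c \<in> A} f"
  using assms block_grid by (simp add: mass_shift)

lemma cell_shift_set: "{t. t + h \<in> cell L c} = cell L (c - h)"
  by (auto simp: cell_shift)

lemma sum_share_cells:
  assumes f: "f \<in> cadlag_space"
  shows "(\<integral>\<^sup>+c. share (cell L c) f \<partial>count_space (grid L)) = total_mass f / total_mass f"
  unfolding mass_UNIV_cells[OF L_pos f, of \<delta>]
  by (rule nn_integral_divide) simp

lemma share_sum_le:
  assumes f: "f \<in> cadlag_space" and B: "finite B" "B \<subseteq> grid L"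
  shows "(\<Sum>c\<in>B. share (cell L c) f) \<le> 1"
proof -
  have "(\<Sum>c\<in>B. share (cell L c) f) = (\<integral>\<^sup>+c. share (cell L c) f \<partial>count_space B)"
    using B by (simp add: nn_integral_count_space_finite)
  also have "\<dots> \<le> (\<integral>\<^sup>+c. share (cell L c) f \<partial>count_space (grid L))"
    using B(2) by (simp add: nn_integral_count_space_indicator)
      (intro nn_integral_mono, auto simp: indicator_def)
  also have "\<dots> \<le> 1" unfolding sum_share_cells[OF f] by (rule ennreal_divide_self_le)
  finally show ?thesis .
qed

text \<open>
  Mass transport. Let every cell \<open>e\<close> receive from every cell \<open>c\<close> the supremum over \<open>c\<close> times the share of
  \<open>e\<close> in the total mass. By shift invariance the mean received by the cell at the origin equals the
  mean sent by it, and as the shares sum to at most one, that is at most the mean of its supremum.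
\<close>

lemma sup_share_le: "(\<integral>\<^sup>+f. share (cell L 0) f * sup_sum L UNIV f \<partial>\<mu>) \<le> mean_sup"
proof -
  have G: "homogeneous (\<lambda>f. share (cell L 0) f * cell_sup L c f)" for c
    by (rule homogeneousI) (simp_all add: mass_ratio_scale cell_sup_scale mult_ac)
  have meas: "(\<lambda>f. share A f * cell_sup L c f) \<in> borel_measurable \<mu>" if "A \<in> sets borel" for A c
    unfolding measurable_law using that by measurable
  have "(\<integral>\<^sup>+f. share (cell L 0) f * sup_sum L UNIV f \<partial>\<mu>) =
    (\<integral>\<^sup>+f. \<integral>\<^sup>+c. share (cell L 0) f * cell_sup L c f \<partial>count_space (grid L) \<partial>\<mu>)"
    by (simp add: sup_sum_def nn_integral_cmult)
  also have "\<dots> = (\<integral>\<^sup>+c. \<integral>\<^sup>+f. share (cell L 0) f * cell_sup L c f \<partial>\<mu> \<partial>count_space (grid L))"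
    by (rule nn_integral_count_space_nn_integral[OF countable_blocks meas]) simp
  also have "\<dots> = (\<integral>\<^sup>+c. \<integral>\<^sup>+f. share (cell L (- c)) f * cell_sup L 0 f \<partial>\<mu> \<partial>count_space (grid L))"
  proof (rule nn_integral_cong)
    fix c :: "real^'n" assume "c \<in> space (count_space (grid L))"
    then have c: "c \<in> grid L" by simp
    have "(\<integral>\<^sup>+f. share (cell L 0) f * cell_sup L c f \<partial>\<mu>)
      = (\<integral>\<^sup>+f. share (cell L 0) (backshift c f) * cell_sup L c (backshift c f) \<partial>\<mu>)"
      by (rule shift[symmetric, OF meas[unfolded measurable_law] G]) simp
    also have "\<dots> = (\<integral>\<^sup>+f. share (cell L (- c)) f * cell_sup L 0 f \<partial>\<mu>)"
      by (rule nn_integral_cong) (simp add: share_shift[OF c] cell_sup_shift cell_shift_set)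
    finally show "(\<integral>\<^sup>+f. share (cell L 0) f * cell_sup L c f \<partial>\<mu>)
      = (\<integral>\<^sup>+f. share (cell L (- c)) f * cell_sup L 0 f \<partial>\<mu>)" .
  qed
  also have "\<dots> = (\<integral>\<^sup>+c. \<integral>\<^sup>+f. share (cell L c) f * cell_sup L 0 f \<partial>\<mu> \<partial>count_space (grid L))"
    by (rule nn_integral_grid_reflect)
  also have "\<dots> = (\<integral>\<^sup>+f. \<integral>\<^sup>+c. share (cell L c) f * cell_sup L 0 f \<partial>count_space (grid L) \<partial>\<mu>)"
    by (rule nn_integral_count_space_nn_integral[OF countable_blocks meas, symmetric]) simp
  also have "\<dots> \<le> mean_sup"
  proof (rule nn_integral_mono)
    fix f assume "f \<in> space \<mu>"
    then have f: "f \<in> cadlag_space" by simp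
    have "(\<integral>\<^sup>+c. share (cell L c) f * cell_sup L 0 f \<partial>count_space (grid L)) = (total_mass f / total_mass f) * cell_sup L 0 f"
      by (simp add: nn_integral_multc sum_share_cells[OF f])
    also have "\<dots> \<le> 1 * cell_sup L 0 f" by (intro mult_right_mono ennreal_divide_self_le) simp
    finally show "(\<integral>\<^sup>+c. share (cell L c) f * cell_sup L 0 f \<partial>count_space (grid L)) \<le> cell_sup L 0 f" by simp
  qed
  finally show ?thesis .
qed

text \<open>
  By mass transport the share of any cell times the sum of the suprema has finite mean. If
  the total mass is positive and finite, some cell has a positive share.
\<close>

lemma AE_sup_sum_finite: "AE f in \<mu>. 0 < total_mass f \<and> total_mass f < \<infinity> \<longrightarrow> sup_sum L UNIV f < \<infinity>"
proof -
  have G: "homogeneous (\<lambda>f. share (cell L e) f * sup_sum L UNIV f)" for e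
    by (rule homogeneousI) (simp_all add: mass_ratio_scale sup_sum_scale mult_ac)
  have meas: "(\<lambda>f. share (cell L e) f * sup_sum L UNIV f) \<in> borel_measurable path_space" for e
    by measurable
  have "AE f in \<mu>. share (cell L e) f * sup_sum L UNIV f \<noteq> \<infinity>" if e: "e \<in> grid L" for e
  proof (rule nn_integral_PInf_AE)
    show "(\<lambda>f. share (cell L e) f * sup_sum L UNIV f) \<in> borel_measurable \<mu>" unfolding measurable_law by (rule meas)
    have "(\<integral>\<^sup>+f. share (cell L e) f * sup_sum L UNIV f \<partial>\<mu>)
      = (\<integral>\<^sup>+f. share (cell L e) (backshift e f) * sup_sum L UNIV (backshift e f) \<partial>\<mu>)"
      by (rule shift[symmetric, OF meas G])
    also have "\<dots> = (\<integral>\<^sup>+f. share (cell L 0) f * sup_sum L UNIV f \<partial>\<mu>)"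
      by (rule nn_integral_cong) (simp add: share_shift[OF e] sup_sum_shift[OF e] cell_shift_set)
    also have "\<dots> < \<infinity>" using sup_share_le sup_finite[OF L_pos] by (rule order_le_less_trans)
    finally show "(\<integral>\<^sup>+f. share (cell L e) f * sup_sum L UNIV f \<partial>\<mu>) \<noteq> \<infinity>" by simp
  qed
  then have "AE f in \<mu>. \<forall>e\<in>grid L. share (cell L e) f * sup_sum L UNIV f \<noteq> \<infinity>"
    by (simp add: AE_ball_countable[OF countable_blocks])
  then show ?thesis
  proof (rule AE_mp, intro AE_I2 impI)
    fix f assume "f \<in> space \<mu>" and fin: "\<forall>e\<in>grid L. share (cell L e) f * sup_sum L UNIV f \<noteq> \<infinity>"
      and S: "0 < total_mass f \<and> total_mass f < \<infinity>"
    then have f: "f \<in> cadlag_space" by simp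
    have "\<exists>e\<in>grid L. mass \<delta> (cell L e) f \<noteq> 0"
    proof (rule ccontr)
      assume "\<not> ?thesis"
      then have "total_mass f = 0"
        unfolding mass_UNIV_cells[OF L_pos f, of \<delta>] by (intro nn_integral_zero' AE_I2) auto
      with S show False by simp
    qed
    then obtain e where e: "e \<in> grid L" "mass \<delta> (cell L e) f \<noteq> 0" by blast
    then have "share (cell L e) f \<noteq> 0" using S by (auto simp: divide_ennreal_def)
    with fin e(1) show "sup_sum L UNIV f < \<infinity>" by (auto simp: ennreal_mult_eq_top_iff less_top)
  qed
qed

definition window :: "nat \<Rightarrow> (real^'n) set" where
  "window n = cell (real n * L) 0"

definition centred :: "nat \<Rightarrow> (real^'n) set" where
  "centred m = cell (real (2 * m) * L) (- vec (real m * L))"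

text \<open>
  The cells of \<open>window n\<close> at distance at least \<open>m\<close> cells from its boundary; seen from such a cell, the
  window contains \<open>centred m\<close>.
\<close>

definition inner_blocks :: "nat \<Rightarrow> nat \<Rightarrow> (real^'n) set" where
  "inner_blocks n m = cell (real (n - 2 * m) * L) (vec (real m * L)) \<inter> grid L"

lemma window_borel [measurable]: "window n \<in> sets borel" "centred m \<in> sets borel"
  by (simp_all add: window_def centred_def)

lemma vec_grid: "vec (real m * L) \<in> grid L"
  unfolding grid_def using L_pos by (auto intro!: exI[of _ "int m"])

lemma inner_blocks_card: "finite (inner_blocks n m)" "card (inner_blocks n m) = (n - 2 * m) ^ CARD('n)"
  unfolding inner_blocks_def using card_grid_cell[OF L_pos vec_grid] by auto

lemma window_card: "finite (window n \<inter> grid L)" "card (window n \<inter> grid L) = n ^ CARD('n)"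
  unfolding window_def using card_grid_cell_0[OF L_pos] by auto

lemma inner_blocks_grid: "c \<in> inner_blocks n m \<Longrightarrow> c \<in> grid L" by (simp add: inner_blocks_def)

lemma inner_blocks_centred:
  assumes "2 * m \<le> n" "c \<in> inner_blocks n m" "t \<in> centred m"
  shows "t + c \<in> window n"
proof -
  have n: "real (n - 2 * m) = real n - 2 * real m" using assms(1) by (simp add: of_nat_diff)
  show ?thesis
    unfolding window_def cell_def
  proof (intro CollectI allI)
    fix i
    have "real m * L \<le> c $ i" "c $ i < real m * L + real (n - 2 * m) * L"
      using assms(2) by (simp_all add: inner_blocks_def cell_def)
    moreover have "- (real m * L) \<le> t $ i" "t $ i < - (real m * L) + 2 * real m * L"
      using assms(3) by (simp_all add: centred_def cell_def)
    ultimately show "0 $ i \<le> (t + c) $ i \<and> (t + c) $ i < 0 $ i + real n * L"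
      unfolding n by (simp add: algebra_simps)
  qed
qed

lemma inner_blocks_subset: "2 * m \<le> n \<Longrightarrow> inner_blocks n m \<subseteq> window n \<inter> grid L"
proof
  fix c assume n: "2 * m \<le> n" and c: "c \<in> inner_blocks n m"
  have n': "real (n - 2 * m) = real n - 2 * real m" using n by (simp add: of_nat_diff)
  have "0 \<le> c $ i \<and> c $ i < real n * L" for i
  proof -
    have "real m * L \<le> c $ i" "c $ i < real m * L + real (n - 2 * m) * L"
      using c by (simp_all add: inner_blocks_def cell_def)
    moreover have "0 \<le> real m * L" using L_pos by simp
    ultimately show ?thesis unfolding n' by (simp add: algebra_simps)
  qed
  then show "c \<in> window n \<inter> grid L" using inner_blocks_grid[OF c] by (simp add: window_def cell_def)
qed

lemma centred_incseq: "incseq centred"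
proof (rule incseq_SucI, rule subsetI)
  fix m t assume t: "t \<in> centred m"
  have "- (real (Suc m) * L) \<le> t $ i \<and> t $ i < - (real (Suc m) * L) + real (2 * Suc m) * L" for i
  proof -
    have "- (real m * L) \<le> t $ i" "t $ i < - (real m * L) + real (2 * m) * L"
      using t by (simp_all add: centred_def cell_def)
    then show ?thesis using L_pos by (simp add: algebra_simps)
  qed
  then show "t \<in> centred (Suc m)" by (simp add: centred_def cell_def)
qed

lemma centred_UN: "(\<Union>m. centred m) = UNIV"
proof -
  have "\<exists>m. t \<in> centred m" for t
  proof -
    obtain m :: nat where m: "norm t / L < real m" using reals_Archimedean2 by blast
    have "- (real m * L) \<le> t $ i \<and> t $ i < - (real m * L) + real (2 * m) * L" for i
    proof -
      have "norm t < real m * L" using m L_pos by (simp add: field_simps)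
      moreover have "\<bar>t $ i\<bar> \<le> norm t" by (rule component_le_norm_cart)
      ultimately have "\<bar>t $ i\<bar> < real m * L" by (rule order_le_less_trans[rotated])
      then show ?thesis by (simp add: algebra_simps abs_less_iff)
    qed
    then show ?thesis by (auto simp: centred_def cell_def)
  qed
  then show ?thesis by auto
qed

abbreviation "core m \<equiv> \<integral>\<^sup>+f. share (cell L 0) f * excess \<delta> x (centred m) f \<partial>\<mu>"
abbreviation "block_rate \<equiv> \<integral>\<^sup>+f. share (cell L 0) f * excess \<delta> x UNIV f \<partial>\<mu>"
abbreviation "windowed n \<equiv> \<integral>\<^sup>+f. excess \<delta> x (window n) f \<partial>\<mu>"

lemma share_excess_homogeneous:
  "A \<in> sets borel \<Longrightarrow> B \<in> sets borel \<Longrightarrow> homogeneous (\<lambda>f. share A f * excess \<delta> x B f)"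
  by (rule homogeneousI) (simp_all add: mass_ratio_scale excess_scale \<delta>_nonneg mult_ac)

lemma share_excess_shift:
  assumes c: "c \<in> grid L" and [measurable]: "B \<in> sets borel"
  shows "(\<integral>\<^sup>+f. share (cell L c) f * excess \<delta> x B f \<partial>\<mu>)
    = (\<integral>\<^sup>+f. share (cell L 0) f * excess \<delta> x {t. t + c \<in> B} f \<partial>\<mu>)"
proof -
  have "(\<integral>\<^sup>+f. share (cell L c) f * excess \<delta> x B f \<partial>\<mu>)
    = (\<integral>\<^sup>+f. share (cell L c) (backshift c f) * excess \<delta> x B (backshift c f) \<partial>\<mu>)"
    by (rule shift[symmetric]) (auto intro: share_excess_homogeneous)
  also have "\<dots> = (\<integral>\<^sup>+f. share (cell L 0) f * excess \<delta> x {t. t + c \<in> B} f \<partial>\<mu>)"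
    using block_grid[OF c]
    by (intro nn_integral_cong) (simp add: share_shift[OF c] excess_shift cell_shift_set)
  finally show ?thesis .
qed

text \<open>
  Only the inner cells are kept in the decomposition of the excess according to the shares of the cells.
\<close>

lemma windowed_lower:
  assumes n: "2 * m \<le> n"
  shows "of_nat ((n - 2 * m) ^ CARD('n)) * core m \<le> windowed n"
proof -
  have "of_nat ((n - 2 * m) ^ CARD('n)) * core m = (\<Sum>c\<in>inner_blocks n m. core m)"
    by (simp add: inner_blocks_card)
  also have "\<dots> \<le> (\<Sum>c\<in>inner_blocks n m. \<integral>\<^sup>+f. share (cell L c) f * excess \<delta> x (window n) f \<partial>\<mu>)"
  proof (rule sum_mono)
    fix c assume c: "c \<in> inner_blocks n m"
    have "core m \<le> (\<integral>\<^sup>+f. share (cell L 0) f * excess \<delta> x {t. t + c \<in> window n} f \<partial>\<mu>)"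
      using inner_blocks_centred[OF n c] by (intro nn_integral_mono mult_left_mono excess_mono) auto
    then show "core m \<le> (\<integral>\<^sup>+f. share (cell L c) f * excess \<delta> x (window n) f \<partial>\<mu>)"
      by (simp only: share_excess_shift[OF inner_blocks_grid[OF c] window_borel(1)])
  qed
  also have "\<dots> = (\<integral>\<^sup>+f. (\<Sum>c\<in>inner_blocks n m. share (cell L c) f * excess \<delta> x (window n) f) \<partial>\<mu>)"
    by (rule nn_integral_sum[symmetric]) measurable
  also have "\<dots> \<le> windowed n"
  proof (rule nn_integral_mono)
    fix f assume "f \<in> space \<mu>"
    then have f: "f \<in> cadlag_space" by simp
    have "(\<Sum>c\<in>inner_blocks n m. share (cell L c) f * excess \<delta> x (window n) f)
      = (\<Sum>c\<in>inner_blocks n m. share (cell L c) f) * excess \<delta> x (window n) f" by (simp add: sum_distrib_right)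
    also have "\<dots> \<le> 1 * excess \<delta> x (window n) f"
      using inner_blocks_card inner_blocks_grid by (intro mult_right_mono share_sum_le f) auto
    finally show "(\<Sum>c\<in>inner_blocks n m. share (cell L c) f * excess \<delta> x (window n) f) \<le> excess \<delta> x (window n) f" by simp
  qed
  finally show ?thesis .
qed

lemma excess_le_sup_sum: "excess \<delta> x UNIV f \<le> sup_sum L UNIV (f :: real^'n \<Rightarrow> real)"
proof (rule excess_le)
  fix t :: "real^'n"
  let ?c = "cell_of L t"
  have c: "?c \<in> grid L" using L_pos by (rule cell_of_grid)
  then have "ennreal (f t) \<le> cell_sup L ?c f"
    unfolding cell_sup_def by (intro SUP_upper in_cell_of)
  also have "\<dots> = (\<integral>\<^sup>+c. cell_sup L ?c f * indicator {?c} c \<partial>count_space (grid L))"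
    using c by (simp add: nn_integral_cmult one_ennreal_def[symmetric])
  also have "\<dots> \<le> sup_sum L UNIV f"
    unfolding sup_sum_def by (intro nn_integral_mono) (auto simp: indicator_def)
  finally show "ennreal (f t) \<le> sup_sum L UNIV f" .
qed

lemma block_rate_le: "block_rate \<le> mean_sup"
  by (rule order_trans[OF nn_integral_mono sup_share_le]) (intro mult_left_mono excess_le_sup_sum, simp)

lemma mean_sup_finite: "mean_sup < \<infinity>" using L_pos by (rule sup_finite)

text \<open>
  The excess over the windows increases to the excess over the whole space; the dominating
  function is the one from \<open>sup_share_le\<close>.
\<close>

lemma core_tendsto: "core \<longlonglongrightarrow> block_rate"
proof (rule nn_integral_dominated_convergence)
  show "(\<lambda>f. share (cell L 0) f * excess \<delta> x (centred m) f) \<in> borel_measurable \<mu>" for m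
    unfolding measurable_law by measurable
  show "(\<lambda>f. share (cell L 0) f * excess \<delta> x UNIV f) \<in> borel_measurable \<mu>"
    unfolding measurable_law by measurable
  show "(\<lambda>f. share (cell L 0) f * sup_sum L UNIV f) \<in> borel_measurable \<mu>"
    unfolding measurable_law by measurable
  show "(\<integral>\<^sup>+f. share (cell L 0) f * sup_sum L UNIV f \<partial>\<mu>) < \<infinity>"
    using sup_share_le mean_sup_finite by (rule order_le_less_trans)
  show "AE f in \<mu>. share (cell L 0) f * excess \<delta> x (centred m) f \<le> share (cell L 0) f * sup_sum L UNIV f" for m
    by (intro AE_I2 mult_left_mono order_trans[OF excess_mono excess_le_sup_sum]) auto
  show "AE f in \<mu>. (\<lambda>m. share (cell L 0) f * excess \<delta> x (centred m) f) \<longlonglongrightarrow> share (cell L 0) f * excess \<delta> x UNIV f"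
  proof (rule AE_mp[OF AE_sup_sum_finite], rule AE_I2, rule impI)
    fix f assume "f \<in> space \<mu>" and fin: "0 < total_mass f \<and> total_mass f < \<infinity> \<longrightarrow> sup_sum L UNIV f < \<infinity>"
    then have f: "f \<in> cadlag_space" by simp
    have lim: "(\<lambda>m. excess \<delta> x (centred m) f) \<longlonglongrightarrow> excess \<delta> x UNIV f"
      by (rule excess_incseq[OF \<delta>_nonneg f]) (auto simp: centred_incseq centred_UN)
    show "(\<lambda>m. share (cell L 0) f * excess \<delta> x (centred m) f) \<longlonglongrightarrow> share (cell L 0) f * excess \<delta> x UNIV f"
    proof (cases "share (cell L 0) f = 0")
      case False
      have "total_mass f \<noteq> \<infinity>" using False by (auto simp: divide_ennreal_def)
      moreover have "total_mass f \<noteq> 0" using False mass_mono[of "cell L 0" UNIV \<delta> f] by (auto simp: divide_ennreal_def)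
      ultimately have "sup_sum L UNIV f < \<infinity>" using fin by (auto simp: less_top zero_less_iff_neq_zero)
      then have "excess \<delta> x UNIV f \<noteq> \<top>" using excess_le_sup_sum[of f] by (auto simp: top_unique)
      moreover have "share (cell L 0) f \<noteq> \<top>"
        using share_le_1[of "cell L 0" f] by (auto simp: top_unique)
      ultimately show ?thesis using False by (intro tendsto_mult_ennreal tendsto_const lim) auto
    next
      case True
      then show ?thesis by (simp only: mult_zero_left tendsto_const)
    qed
  qed
qed

text \<open>
  The part of the excess over the window \<open>B\<close> charged to the cell \<open>c\<close> of \<open>B\<close> that is not covered by the
  shares of the cells of \<open>B\<close>: the share of the mass outside \<open>B\<close> if the total mass is finite, and the
  entire excess otherwise. In the second case the supremum over \<open>c\<close> is charged fully only if it
  is more than the fraction \<open>\<epsilon>\<close> of the sum of all suprema in \<open>B\<close>. The functional decreases in \<open>B\<close>.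
\<close>

definition overflow :: "real \<Rightarrow> real^'n \<Rightarrow> (real^'n) set \<Rightarrow> (real^'n \<Rightarrow> real) \<Rightarrow> ennreal" where
  "overflow \<epsilon> c B f = cell_sup L c f * (share (- B) f + indicator {f. total_mass f = \<infinity>} f *
      (ennreal \<epsilon> + indicator {f. ennreal \<epsilon> * sup_sum L B f < cell_sup L c f} f))"

lemma overflow_meas [measurable]:
  assumes [measurable]: "B \<in> sets borel"
  shows "overflow \<epsilon> c B \<in> borel_measurable path_space"
  unfolding overflow_def[abs_def] by measurable

lemma overflow_homogeneous:
  assumes B: "B \<in> sets borel"
  shows "homogeneous (overflow \<epsilon> c B)"
proof (rule homogeneousI)
  fix f :: "real^'n \<Rightarrow> real" and a :: real assume f: "f \<in> cadlag_space" and a: "0 < a"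
  have t: "total_mass (\<lambda>t. a * f t) = \<top> \<longleftrightarrow> total_mass f = \<top>"
    using a f by (auto simp: mass_scale ennreal_mult_eq_top_iff)
  have "ennreal \<epsilon> * (ennreal a * u) < ennreal a * v \<longleftrightarrow> ennreal \<epsilon> * u < v" for u v
  proof -
    have "ennreal \<epsilon> * (ennreal a * u) = ennreal a * (ennreal \<epsilon> * u)" by (simp add: mult_ac)
    moreover have "ennreal a * p < ennreal a * q \<longleftrightarrow> p < q" for p q
      using a ennreal_mult_strict_left_mono[of p q "ennreal a"] mult_left_mono[of q p "ennreal a"]
      by (cases "p < q") (auto simp: not_less)
    ultimately show ?thesis by simp
  qed
  then show "overflow \<epsilon> c B (\<lambda>t. a * f t) = ennreal a * overflow \<epsilon> c B f"
    using f a B by (simp add: overflow_def indicator_def t mass_ratio_scale cell_sup_scale sup_sum_scale mult.assoc)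
qed (simp add: overflow_def)

lemma overflow_shift:
  assumes c: "c \<in> grid L" and B [measurable]: "B \<in> sets borel"
  shows "(\<integral>\<^sup>+f. overflow \<epsilon> c B f \<partial>\<mu>) = (\<integral>\<^sup>+f. overflow \<epsilon> 0 {t. t + c \<in> B} f \<partial>\<mu>)"
proof -
  have "(\<integral>\<^sup>+f. overflow \<epsilon> c B f \<partial>\<mu>) = (\<integral>\<^sup>+f. overflow \<epsilon> c B (backshift c f) \<partial>\<mu>)"
    by (rule shift[symmetric]) (auto intro: overflow_homogeneous)
  also have "\<dots> = (\<integral>\<^sup>+f. overflow \<epsilon> 0 {t. t + c \<in> B} f \<partial>\<mu>)"
  proof (rule nn_integral_cong)
    fix f assume "f \<in> space \<mu>"
    then have f: "f \<in> cadlag_space" by simp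
    have "{t. t + c \<in> - B} = - {t. t + c \<in> B}" by auto
    then show "overflow \<epsilon> c B (backshift c f) = overflow \<epsilon> 0 {t. t + c \<in> B} f"
      using f block_grid[OF c]
      by (simp add: overflow_def indicator_def share_shift[OF c f] mass_shift sup_sum_shift[OF c] cell_sup_shift)
  qed
  finally show ?thesis .
qed

lemma sup_sum_mono: "A \<subseteq> B \<Longrightarrow> sup_sum L A f \<le> sup_sum L B f"
  unfolding sup_sum_def by (intro nn_integral_mono) (auto simp: indicator_def)

lemma overflow_antimono:
  assumes "B \<subseteq> B'" shows "overflow \<epsilon> c B' f \<le> overflow \<epsilon> c B f"
proof -
  have "ennreal \<epsilon> * sup_sum L B f \<le> ennreal \<epsilon> * sup_sum L B' f"
    using assms by (intro mult_left_mono sup_sum_mono) auto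
  then have "indicator {f. ennreal \<epsilon> * sup_sum L B' f < cell_sup L c f} f
     \<le> (indicator {f. ennreal \<epsilon> * sup_sum L B f < cell_sup L c f} f :: ennreal)"
    by (auto simp: indicator_def dest: order_le_less_trans)
  moreover have "share (- B') f \<le> share (- B) f"
    using assms by (intro divide_right_mono_ennreal mass_mono) auto
  ultimately show ?thesis
    unfolding overflow_def by (intro mult_left_mono add_mono) auto
qed

lemma overflow_le:
  assumes "\<epsilon> \<le> 1"
  shows "overflow \<epsilon> c B f \<le> 3 * cell_sup L c f"
proof -
  have "share (- B) f + indicator {f. total_mass f = \<infinity>} f *
      (ennreal \<epsilon> + indicator {f. ennreal \<epsilon> * sup_sum L B f < cell_sup L c f} f) \<le> 1 + 1 * (1 + 1)"
    using assms by (intro add_mono mult_mono share_le_1) (auto simp: indicator_def ennreal_le_1)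
  also have "\<dots> = 3" by simp
  finally show ?thesis unfolding overflow_def by (subst mult.commute) (rule mult_right_mono, auto)
qed

text \<open>
  If the total mass is finite, the excess is split according to the mass in the cells of the window and
  outside, and the outer part is bounded by the sum of the suprema over the cells. If it is infinite,
  every supremum over a cell is either at most the fraction \<open>\<epsilon>\<close> of the sum of all of them or is
  charged fully.
\<close>

lemma excess_window_le:
  assumes f: "f \<in> cadlag_space" and pos: "0 < total_mass f"
  shows "excess \<delta> x (window n) f \<le> (\<Sum>c\<in>window n \<inter> grid L. share (cell L c) f * excess \<delta> x UNIV f)
      + (\<Sum>c\<in>window n \<inter> grid L. overflow \<epsilon> c (window n) f)"
proof -
  let ?B = "window n \<inter> grid L"
  have fin: "finite ?B" by (rule window_card)
  have cellB: "cell_of L t \<in> ?B" if t: "t \<in> window n" for t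
  proof -
    have c: "cell_of L t \<in> grid L" using L_pos by (rule cell_of_grid)
    have "0 \<le> cell_of L t $ i \<and> cell_of L t $ i < real n * L" for i
    proof -
      have ti: "0 \<le> t $ i" "t $ i < real n * L" using t by (simp_all add: window_def cell_def)
      have "t \<in> cell L (cell_of L t)" by (rule in_cell_of)
      then have "cell_of L t $ i \<le> t $ i" by (simp add: cell_def)
      moreover have "0 \<le> cell_of L t $ i" using ti L_pos by (simp add: cell_of_def)
      ultimately show ?thesis using ti by simp
    qed
    then show ?thesis using c by (simp add: window_def cell_def)
  qed
  have le_sup: "ennreal (f t) \<le> cell_sup L (cell_of L t) f" for t
    unfolding cell_sup_def by (intro SUP_upper in_cell_of)
  have exc: "excess \<delta> x (window n) f \<le> R" if "\<And>c. c \<in> ?B \<Longrightarrow> cell_sup L c f \<le> R" for R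
    by (rule excess_le) (rule order_trans[OF le_sup that[OF cellB]])
  have total_le: "total_mass f \<le> (\<Sum>c\<in>?B. mass \<delta> (cell L c) f) + mass \<delta> (- window n) f"
  proof -
    note [measurable] = path_measurable[OF f]
    have "total_mass f \<le> (\<integral>\<^sup>+t. (\<Sum>c\<in>?B. ennreal (f t) * indicator (cell L c) t) + ennreal (f t) * indicator (- window n) t \<partial>grid_lebesgue \<delta>)"
      unfolding mass_def
    proof (rule nn_integral_mono)
      fix t
      show "ennreal (f t) * indicator UNIV t \<le> (\<Sum>c\<in>?B. ennreal (f t) * indicator (cell L c) t) + ennreal (f t) * indicator (- window n) t"
      proof (cases "t \<in> window n")
        case True
        have "t \<in> cell L (cell_of L t)" by (rule in_cell_of)
        then have "ennreal (f t) * indicator UNIV t = ennreal (f t) * indicator (cell L (cell_of L t)) t" by simp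
        also have "\<dots> \<le> (\<Sum>c\<in>?B. ennreal (f t) * indicator (cell L c) t)"
          by (rule member_le_sum[OF cellB[OF True]]) (use fin in auto)
        finally show ?thesis by (rule order_trans) simp
      qed simp
    qed
    also have "\<dots> = (\<Sum>c\<in>?B. mass \<delta> (cell L c) f) + mass \<delta> (- window n) f"
      unfolding mass_def by (subst nn_integral_add, measurable, subst nn_integral_sum, measurable)
    finally show ?thesis .
  qed
  show ?thesis
  proof (cases "total_mass f = \<infinity>")
    case False
    have "total_mass f / total_mass f = 1" using False pos by (intro ennreal_divide_self) (auto simp: less_top)
    then have "excess \<delta> x (window n) f = (total_mass f / total_mass f) * excess \<delta> x (window n) f" by simp
    also have "\<dots> \<le> (((\<Sum>c\<in>?B. mass \<delta> (cell L c) f) + mass \<delta> (- window n) f) / total_mass f) * excess \<delta> x (window n) f"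
      by (intro mult_right_mono divide_right_mono_ennreal total_le) simp
    also have "\<dots> = (\<Sum>c\<in>?B. share (cell L c) f * excess \<delta> x (window n) f) + share (- window n) f * excess \<delta> x (window n) f"
      by (simp add: divide_ennreal_def distrib_right sum_distrib_right)
    also have "\<dots> \<le> (\<Sum>c\<in>?B. share (cell L c) f * excess \<delta> x UNIV f) + share (- window n) f * (\<Sum>c\<in>?B. cell_sup L c f)"
      by (intro add_mono sum_mono mult_left_mono excess_mono exc) (auto intro: member_le_sum fin)
    also have "share (- window n) f * (\<Sum>c\<in>?B. cell_sup L c f) = (\<Sum>c\<in>?B. overflow \<epsilon> c (window n) f)"
      using False by (simp add: overflow_def sum_distrib_right mult.commute[of "share (- window n) f"])
    finally show ?thesis .
  next
    case True
    have "excess \<delta> x (window n) f \<le> (\<Sum>c\<in>?B. overflow \<epsilon> c (window n) f)"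
    proof (rule exc)
      fix c assume c: "c \<in> ?B"
      let ?S = "sup_sum L (window n) f"
      have ov: "cell_sup L b f * ennreal \<epsilon> \<le> overflow \<epsilon> b (window n) f" for b
        unfolding overflow_def using True by (intro mult_left_mono) (auto simp: add.assoc[symmetric] add_increasing2 add_increasing)
      show "cell_sup L c f \<le> (\<Sum>c\<in>?B. overflow \<epsilon> c (window n) f)"
      proof (cases "cell_sup L c f \<le> ennreal \<epsilon> * ?S")
        case True
        also have "ennreal \<epsilon> * ?S = (\<Sum>c\<in>?B. cell_sup L c f * ennreal \<epsilon>)"
          by (simp add: sup_sum_finite_sum fin sum_distrib_left mult.commute)
        also have "\<dots> \<le> (\<Sum>c\<in>?B. overflow \<epsilon> c (window n) f)" by (intro sum_mono ov)
        finally show ?thesis .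
      next
        case False
        have "cell_sup L c f * 1 \<le> overflow \<epsilon> c (window n) f"
          unfolding overflow_def using True False
          by (intro mult_left_mono) (auto simp: not_le add_increasing add_increasing2)
        also have "\<dots> \<le> (\<Sum>c\<in>?B. overflow \<epsilon> c (window n) f)"
          by (rule member_le_sum[OF c]) (use fin in auto)
        finally show ?thesis by simp
      qed
    qed
    then show ?thesis by (rule order_trans) simp
  qed
qed

abbreviation "spill \<epsilon> m \<equiv> \<integral>\<^sup>+f. overflow \<epsilon> 0 (centred m) f \<partial>\<mu>"

text \<open>
  Shifting each cell of the window to the origin bounds the overflow of an inner cell by that for a
  centred window, whereas the few outer cells are bounded by three times the mean supremum.
\<close>

lemma windowed_upper:
  assumes pos: "AE f in \<mu>. 0 < total_mass f" and n: "2 * m \<le> n" and \<epsilon>: "\<epsilon> \<le> 1"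
  shows "windowed n \<le> of_nat (n ^ CARD('n)) * block_rate + of_nat ((n - 2 * m) ^ CARD('n)) * spill \<epsilon> m
     + of_nat (n ^ CARD('n) - (n - 2 * m) ^ CARD('n)) * (3 * mean_sup)"
proof -
  let ?B = "window n \<inter> grid L"
  have fin: "finite ?B" by (rule window_card)
  have m1 [measurable]: "(\<lambda>f. share (cell L c) f * excess \<delta> x UNIV f) \<in> borel_measurable \<mu>" for c
    unfolding measurable_law by measurable
  have m2 [measurable]: "overflow \<epsilon> c (window n) \<in> borel_measurable \<mu>" for c
    unfolding measurable_law by measurable
  have sh: "(\<integral>\<^sup>+f. share (cell L c) f * excess \<delta> x UNIV f \<partial>\<mu>) = block_rate" if "c \<in> ?B" for c
    using that share_excess_shift[of c UNIV] by simp
  have inner: "(\<integral>\<^sup>+f. overflow \<epsilon> c (window n) f \<partial>\<mu>) \<le> spill \<epsilon> m" if c: "c \<in> inner_blocks n m" for c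
  proof -
    have "(\<integral>\<^sup>+f. overflow \<epsilon> c (window n) f \<partial>\<mu>) = (\<integral>\<^sup>+f. overflow \<epsilon> 0 {t. t + c \<in> window n} f \<partial>\<mu>)"
      by (rule overflow_shift) (use inner_blocks_grid[OF c] in auto)
    also have "\<dots> \<le> spill \<epsilon> m"
      using inner_blocks_centred[OF n c] by (intro nn_integral_mono overflow_antimono) auto
    finally show ?thesis .
  qed
  have outer: "(\<integral>\<^sup>+f. overflow \<epsilon> c (window n) f \<partial>\<mu>) \<le> 3 * mean_sup" if c: "c \<in> ?B" for c
  proof -
    have "(\<integral>\<^sup>+f. overflow \<epsilon> c (window n) f \<partial>\<mu>) = (\<integral>\<^sup>+f. overflow \<epsilon> 0 {t. t + c \<in> window n} f \<partial>\<mu>)"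
      by (rule overflow_shift) (use c in auto)
    also have "\<dots> \<le> (\<integral>\<^sup>+f. 3 * cell_sup L 0 f \<partial>\<mu>)" by (intro nn_integral_mono overflow_le \<epsilon>)
    also have "\<dots> = 3 * mean_sup" by (rule nn_integral_cmult) (simp add: measurable_law)
    finally show ?thesis .
  qed
  have "windowed n \<le> (\<integral>\<^sup>+f. (\<Sum>c\<in>?B. share (cell L c) f * excess \<delta> x UNIV f)
      + (\<Sum>c\<in>?B. overflow \<epsilon> c (window n) f) \<partial>\<mu>)"
    by (rule nn_integral_mono_AE, rule AE_mp[OF pos], rule AE_I2, rule impI, rule excess_window_le) auto
  also have "\<dots> = (\<Sum>c\<in>?B. block_rate) + (\<Sum>c\<in>?B. \<integral>\<^sup>+f. overflow \<epsilon> c (window n) f \<partial>\<mu>)"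
    by (subst nn_integral_add, measurable, subst (1 2) nn_integral_sum, measurable) (simp add: sh)
  also have "(\<Sum>c\<in>?B. block_rate) = of_nat (n ^ CARD('n)) * block_rate" by (simp add: window_card)
  also have "(\<Sum>c\<in>?B. \<integral>\<^sup>+f. overflow \<epsilon> c (window n) f \<partial>\<mu>) =
     (\<Sum>c\<in>inner_blocks n m. \<integral>\<^sup>+f. overflow \<epsilon> c (window n) f \<partial>\<mu>) + (\<Sum>c\<in>?B - inner_blocks n m. \<integral>\<^sup>+f. overflow \<epsilon> c (window n) f \<partial>\<mu>)"
    by (subst sum.subset_diff[OF inner_blocks_subset[OF n] fin]) (rule add.commute)
  also have "(\<Sum>c\<in>inner_blocks n m. \<integral>\<^sup>+f. overflow \<epsilon> c (window n) f \<partial>\<mu>) \<le> of_nat ((n - 2 * m) ^ CARD('n)) * spill \<epsilon> m"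
    using sum_mono[of "inner_blocks n m", OF inner] by (simp add: inner_blocks_card)
  also have "(\<Sum>c\<in>?B - inner_blocks n m. \<integral>\<^sup>+f. overflow \<epsilon> c (window n) f \<partial>\<mu>)
      \<le> of_nat (n ^ CARD('n) - (n - 2 * m) ^ CARD('n)) * (3 * mean_sup)"
  proof -
    have "card (?B - inner_blocks n m) = n ^ CARD('n) - (n - 2 * m) ^ CARD('n)"
      using inner_blocks_subset[OF n] inner_blocks_card[of n m] window_card[of n] by (simp add: card_Diff_subset)
    then show ?thesis using sum_mono[of "?B - inner_blocks n m", OF outer] by simp
  qed
  finally show ?thesis by (simp add: add.assoc add_left_mono)
qed

text \<open>
  If the total mass is finite, the mass outside \<open>centred m\<close> vanishes in the limit. If it is infinite,
  so is the sum of the suprema; the supremum over the cell at the origin is then eventually below the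
  fraction \<open>\<epsilon>\<close> of that sum, and only the term with the factor \<open>\<epsilon>\<close> remains.
\<close>

lemma spill_tendsto:
  assumes pos: "AE f in \<mu>. 0 < total_mass f" and \<epsilon>: "0 < \<epsilon>" "\<epsilon> \<le> 1"
  shows "(\<lambda>m. spill \<epsilon> m) \<longlonglongrightarrow> (\<integral>\<^sup>+f. cell_sup L 0 f * (indicator {f. total_mass f = \<infinity>} f * ennreal \<epsilon>) \<partial>\<mu>)"
proof (rule nn_integral_dominated_convergence[where w="\<lambda>f. 3 * cell_sup L 0 f"])
  show "overflow \<epsilon> 0 (centred m) \<in> borel_measurable \<mu>" for m unfolding measurable_law by measurable
  show "(\<lambda>f. cell_sup L 0 f * (indicator {f. total_mass f = \<infinity>} f * ennreal \<epsilon>)) \<in> borel_measurable \<mu>"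
    unfolding measurable_law by measurable
  show w: "(\<lambda>f. 3 * cell_sup L 0 f) \<in> borel_measurable \<mu>" unfolding measurable_law by measurable
  show "AE f in \<mu>. overflow \<epsilon> 0 (centred m) f \<le> 3 * cell_sup L 0 f" for m
    by (intro AE_I2 overflow_le \<epsilon>)
  have cs: "cell_sup L 0 \<in> borel_measurable \<mu>" unfolding measurable_law by measurable
  show "(\<integral>\<^sup>+f. 3 * cell_sup L 0 f \<partial>\<mu>) < \<infinity>"
    using mean_sup_finite by (simp add: nn_integral_cmult[OF cs] ennreal_mult_less_top)
  have "AE f in \<mu>. cell_sup L 0 f \<noteq> \<infinity>"
    using mean_sup_finite by (intro nn_integral_PInf_AE cs) auto
  then show "AE f in \<mu>. (\<lambda>m. overflow \<epsilon> 0 (centred m) f) \<longlonglongrightarrow> cell_sup L 0 f * (indicator {f. total_mass f = \<infinity>} f * ennreal \<epsilon>)"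
    using pos
  proof (rule AE_mp[OF AE_conjI], intro AE_I2 impI)
    fix f assume "f \<in> space \<mu>" and A: "cell_sup L 0 f \<noteq> \<infinity> \<and> 0 < total_mass f"
    then have f: "f \<in> cadlag_space" by simp
    note [measurable] = path_measurable[OF f]
    show "(\<lambda>m. overflow \<epsilon> 0 (centred m) f) \<longlonglongrightarrow> cell_sup L 0 f * (indicator {f. total_mass f = \<infinity>} f * ennreal \<epsilon>)"
    proof (cases "total_mass f = \<infinity>")
      case False
      have ind: "(\<lambda>m. indicator (- centred m) t :: ennreal) \<longlonglongrightarrow> 0" for t
      proof (rule tendsto_eventually)
        obtain m0 where m0: "t \<in> centred m0" using centred_UN by blast
        have "t \<in> centred m" if "m0 \<le> m" for m
          using incseqD[OF centred_incseq that] m0 by blast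
        then show "\<forall>\<^sub>F m in sequentially. indicator (- centred m) t = (0::ennreal)"
          unfolding eventually_sequentially by (intro exI[of _ m0]) simp
      qed
      have "(\<lambda>m. mass \<delta> (- centred m) f) \<longlonglongrightarrow> (\<integral>\<^sup>+t. 0 \<partial>(grid_lebesgue \<delta> :: (real^'n) measure))"
        unfolding mass_def
      proof (rule nn_integral_dominated_convergence[where w="\<lambda>t. ennreal (f t)"])
        show "AE t in grid_lebesgue \<delta>. (\<lambda>m. ennreal (f t) * indicator (- centred m) t) \<longlonglongrightarrow> 0"
          using tendsto_mult_ennreal[OF tendsto_const ind] by (intro AE_I2) fastforce
        show "(\<integral>\<^sup>+t. ennreal (f t) \<partial>grid_lebesgue \<delta>) < \<infinity>"
          using False by (simp add: mass_def less_top)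
      qed (auto simp: indicator_def)
      then have m0: "(\<lambda>m. mass \<delta> (- centred m) f) \<longlonglongrightarrow> 0" by simp
      have "(\<lambda>m. mass \<delta> (- centred m) f * inverse (total_mass f)) \<longlonglongrightarrow> 0 * inverse (total_mass f)"
        using A by (intro tendsto_mult_ennreal m0 tendsto_const) auto
      then have "(\<lambda>m. cell_sup L 0 f * share (- centred m) f) \<longlonglongrightarrow> cell_sup L 0 f * 0"
        using A by (intro tendsto_mult_ennreal tendsto_const) (auto simp: divide_ennreal_def)
      then show ?thesis using False by (simp add: overflow_def)
    next
      case True
      have "ennreal (L ^ CARD('n)) * sup_sum L UNIV f = \<infinity>"
        using mass_le_sup_sum[OF coarser f] True by (simp add: top_unique)
      then have top: "sup_sum L UNIV f = \<infinity>" by (simp add: ennreal_mult_eq_top_iff)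
      have "(\<lambda>m. sup_sum L (centred m) f) \<longlonglongrightarrow> sup_sum L UNIV f"
        unfolding sup_sum_def
      proof (rule nn_integral_LIMSEQ)
        show "incseq (\<lambda>m c. cell_sup L c f * indicator (centred m) c)"
          using centred_incseq by (auto simp: incseq_def le_fun_def indicator_def)
        show "(\<lambda>m. cell_sup L c f * indicator (centred m) c) \<longlonglongrightarrow> cell_sup L c f * indicator UNIV c" for c
        proof (rule tendsto_eventually)
          obtain m0 where m0: "c \<in> centred m0" using centred_UN by blast
          have "c \<in> centred m" if "m0 \<le> m" for m
            using incseqD[OF centred_incseq that] m0 by blast
          then show "\<forall>\<^sub>F m in sequentially. cell_sup L c f * indicator (centred m) c = cell_sup L c f * indicator UNIV c"
            unfolding eventually_sequentially by (intro exI[of _ m0]) simp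
        qed
      qed simp
      moreover have "cell_sup L 0 f / ennreal \<epsilon> < sup_sum L UNIV f"
        using top A \<epsilon> by (simp add: ennreal_divide_eq_top_iff less_top[symmetric])
      ultimately have "\<forall>\<^sub>F m in sequentially. cell_sup L 0 f / ennreal \<epsilon> < sup_sum L (centred m) f"
        by (rule order_tendstoD)
      then have "\<forall>\<^sub>F m in sequentially. overflow \<epsilon> 0 (centred m) f = cell_sup L 0 f * (indicator {f. total_mass f = \<infinity>} f * ennreal \<epsilon>)"
      proof eventually_elim
        case (elim m)
        have "ennreal \<epsilon> * (cell_sup L 0 f / ennreal \<epsilon>) = cell_sup L 0 f"
          using \<epsilon> by (simp add: ennreal_times_divide mult.commute[of "ennreal \<epsilon>"] mult_divide_eq_ennreal)
        moreover have "ennreal \<epsilon> * (cell_sup L 0 f / ennreal \<epsilon>) \<le> ennreal \<epsilon> * sup_sum L (centred m) f"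
          using elim by (intro mult_left_mono) auto
        ultimately have "\<not> ennreal \<epsilon> * sup_sum L (centred m) f < cell_sup L 0 f" by (simp add: not_less)
        then show ?case using True by (simp add: overflow_def)
      qed
      then show ?thesis by (rule tendsto_eventually)
    qed
  qed
qed

lemma spill_bound:
  assumes "0 < \<epsilon>"
  shows "(\<integral>\<^sup>+f. cell_sup L 0 f * (indicator {f. total_mass f = \<infinity>} f * ennreal \<epsilon>) \<partial>\<mu>) \<le> ennreal \<epsilon> * mean_sup"
proof -
  have cs: "cell_sup L 0 \<in> borel_measurable \<mu>" unfolding measurable_law by measurable
  have "(\<integral>\<^sup>+f. cell_sup L 0 f * (indicator {f. total_mass f = \<infinity>} f * ennreal \<epsilon>) \<partial>\<mu>) \<le> (\<integral>\<^sup>+f. ennreal \<epsilon> * cell_sup L 0 f \<partial>\<mu>)"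
    by (intro nn_integral_mono) (auto simp: indicator_def mult.commute)
  then show ?thesis by (simp add: nn_integral_cmult[OF cs])
qed

end

section \<open>Limits and change of normalisation\<close>

lemma tendsto_shifted_ratio_power:
  "(\<lambda>n. ((real n - c) / real n) ^ d) \<longlonglongrightarrow> 1"
proof -
  have "(\<lambda>n. 1 - c * (1 / real n)) \<longlonglongrightarrow> 1 - c * 0"
    by (intro tendsto_intros lim_1_over_n)
  moreover have "\<forall>\<^sub>F n in sequentially. 1 - c * (1 / real n) = (real n - c) / real n"
    using eventually_gt_at_top[of 0] by eventually_elim (simp add: field_simps)
  ultimately have "(\<lambda>n. (real n - c) / real n) \<longlonglongrightarrow> 1" by (simp add: tendsto_cong)
  then have "(\<lambda>n. ((real n - c) / real n) ^ d) \<longlonglongrightarrow> 1 ^ d" by (rule tendsto_power)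
  then show ?thesis by simp
qed

lemma of_nat_mult_finite: "c < \<infinity> \<Longrightarrow> of_nat k * c < (\<infinity> :: ennreal)"
  by (simp add: ennreal_mult_less_top of_nat_less_top)

lemma finite_of_mult_finite: "ennreal a * c < \<infinity> \<Longrightarrow> 0 < a \<Longrightarrow> c < \<infinity>"
  by (auto simp: ennreal_mult_less_top)

lemma enn2real_of_nat_mult: "enn2real (of_nat k * c) = real k * enn2real c"
  by (simp add: enn2real_mult)

lemma enn2real_ennreal_mult: "0 \<le> a \<Longrightarrow> enn2real (ennreal a * c) = a * enn2real c"
  by (simp add: enn2real_mult)

text \<open>
  The fraction of inner cells in a window tends to one, so boundary effects disappear.
\<close>

lemma volume_density_limit:
  fixes a \<beta> :: "nat \<Rightarrow> real" and b K :: real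
  assumes lower: "\<And>n m. 2 * m \<le> n \<Longrightarrow> (real n - 2 * real m) ^ d * \<beta> m \<le> a n"
    and \<beta>: "\<beta> \<longlonglongrightarrow> b"
    and upper: "\<And>e. 0 < e \<Longrightarrow> \<exists>m. \<forall>n\<ge>2 * m.
        a n \<le> real n ^ d * b + (real n - 2 * real m) ^ d * e + (real n ^ d - (real n - 2 * real m) ^ d) * K"
  shows "(\<lambda>n. a n / real n ^ d) \<longlonglongrightarrow> b"
proof (rule order_tendstoI)
  fix y assume "y < b"
  with \<beta> have "\<forall>\<^sub>F m in sequentially. y < \<beta> m" by (rule order_tendstoD)
  then obtain m where m: "y < \<beta> m" by (auto simp: eventually_sequentially)
  have "(\<lambda>n. ((real n - 2 * real m) / real n) ^ d * \<beta> m) \<longlonglongrightarrow> 1 * \<beta> m"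
    by (intro tendsto_intros tendsto_shifted_ratio_power)
  then have "\<forall>\<^sub>F n in sequentially. y < ((real n - 2 * real m) / real n) ^ d * \<beta> m"
    using m by (intro order_tendstoD) auto
  then show "\<forall>\<^sub>F n in sequentially. y < a n / real n ^ d"
    using eventually_ge_at_top[of "2 * m"] eventually_gt_at_top[of 0]
  proof eventually_elim
    case (elim n)
    have "((real n - 2 * real m) / real n) ^ d * \<beta> m = (real n - 2 * real m) ^ d * \<beta> m / real n ^ d"
      by (simp add: power_divide)
    also have "\<dots> \<le> a n / real n ^ d" using elim by (intro divide_right_mono lower) auto
    finally show ?case using elim by simp
  qed
next
  fix y assume y: "b < y"
  define e where "e = (y - b) / 2"
  have e: "0 < e" "b + e < y" using y by (auto simp: e_def field_simps)
  from upper[OF e(1)] obtain m where m: "\<And>n. 2 * m \<le> n \<Longrightarrow>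
    a n \<le> real n ^ d * b + (real n - 2 * real m) ^ d * e + (real n ^ d - (real n - 2 * real m) ^ d) * K" by blast
  let ?r = "\<lambda>n. ((real n - 2 * real m) / real n) ^ d"
  have "(\<lambda>n. b + ?r n * e + (1 - ?r n) * K) \<longlonglongrightarrow> b + 1 * e + (1 - 1) * K"
    by (intro tendsto_intros tendsto_shifted_ratio_power)
  then have "\<forall>\<^sub>F n in sequentially. b + ?r n * e + (1 - ?r n) * K < y"
    using e(2) by (intro order_tendstoD) auto
  then show "\<forall>\<^sub>F n in sequentially. a n / real n ^ d < y"
    using eventually_ge_at_top[of "2 * m"] eventually_gt_at_top[of 0]
  proof eventually_elim
    case (elim n)
    have n: "0 < real n ^ d" using elim by simp
    have split: "(p * b + q * e + (p - q) * K) / p = b + q / p * e + (1 - q / p) * K" if "0 < p" for p q :: real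
      using that by (simp add: field_simps)
    have "a n / real n ^ d \<le> (real n ^ d * b + (real n - 2 * real m) ^ d * e + (real n ^ d - (real n - 2 * real m) ^ d) * K) / real n ^ d"
      using elim by (intro divide_right_mono m) auto
    also have "\<dots> = b + ?r n * e + (1 - ?r n) * K"
      by (simp only: power_divide split[OF n])
    finally show ?case using elim by simp
  qed
qed

text \<open>
  The integer part of \<open>T / L\<close> and its successor both satisfy the assumption on \<open>n\<close>.
\<close>

lemma tendsto_block_count:
  fixes L :: real
  assumes L: "0 < L" and u: "u \<longlonglongrightarrow> b"
    and n: "\<And>T. 0 \<le> T \<Longrightarrow> real (n T) \<le> T / L + 1 \<and> T / L - 1 \<le> real (n T)"
  shows "((\<lambda>T. u (n T) * (real (n T) / T) ^ d) \<longlongrightarrow> b / L ^ d) at_top"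
proof -
  have top: "filterlim n sequentially at_top"
  proof (rule filterlim_at_top[THEN iffD2], rule allI)
    fix Z :: nat
    have "\<forall>\<^sub>F T in at_top. (real Z + 1) * L \<le> T" by (rule eventually_ge_at_top)
    then show "\<forall>\<^sub>F T in at_top. Z \<le> n T"
      using eventually_ge_at_top[of "0::real"]
    proof eventually_elim
      case (elim T)
      then have "real Z + 1 \<le> T / L" using L by (simp add: field_simps)
      then show ?case using n[of T] elim by linarith
    qed
  qed
  have inv: "((\<lambda>T::real. 1 / T) \<longlongrightarrow> 0) at_top"
    using tendsto_inverse_0_at_top[OF filterlim_ident] by (simp add: divide_inverse)
  have "((\<lambda>T. real (n T) / T) \<longlongrightarrow> 1 / L) at_top"
  proof (rule tendsto_sandwich[of "\<lambda>T. 1 / L - 1 / T" _ _ "\<lambda>T. 1 / L + 1 / T"])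
    show "\<forall>\<^sub>F T in at_top. 1 / L - 1 / T \<le> real (n T) / T"
      using eventually_gt_at_top[of "0::real"]
    proof eventually_elim
      case (elim T)
      have "(T / L - 1) / T \<le> real (n T) / T" using n[of T] elim by (intro divide_right_mono) auto
      moreover have "(T / L - 1) / T = 1 / L - 1 / T" using elim L by (simp add: field_simps)
      ultimately show ?case by simp
    qed
    show "\<forall>\<^sub>F T in at_top. real (n T) / T \<le> 1 / L + 1 / T"
      using eventually_gt_at_top[of "0::real"]
    proof eventually_elim
      case (elim T)
      have "real (n T) / T \<le> (T / L + 1) / T" using n[of T] elim by (intro divide_right_mono) auto
      moreover have "(T / L + 1) / T = 1 / L + 1 / T" using elim L by (simp add: field_simps)
      ultimately show ?case by simp
    qed
    show "((\<lambda>T. 1 / L - 1 / T) \<longlongrightarrow> 1 / L) at_top" using tendsto_diff[OF tendsto_const inv] by simp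
    show "((\<lambda>T. 1 / L + 1 / T) \<longlongrightarrow> 1 / L) at_top" using tendsto_add[OF tendsto_const inv] by simp
  qed
  then have "((\<lambda>T. u (n T) * (real (n T) / T) ^ d) \<longlongrightarrow> b * (1 / L) ^ d) at_top"
    by (intro tendsto_mult tendsto_power filterlim_compose[OF u top])
  then show ?thesis by (simp add: power_one_over divide_inverse power_inverse)
qed

context blocks
begin

lemma spill_finite: "\<epsilon> \<le> 1 \<Longrightarrow> spill \<epsilon> m < \<infinity>"
proof -
  assume e: "\<epsilon> \<le> 1"
  have cs: "cell_sup L 0 \<in> borel_measurable \<mu>" unfolding measurable_law by measurable
  have "spill \<epsilon> m \<le> (\<integral>\<^sup>+f. 3 * cell_sup L 0 f \<partial>\<mu>)" by (intro nn_integral_mono overflow_le e)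
  also have "\<dots> < \<infinity>" using mean_sup_finite by (simp add: nn_integral_cmult[OF cs] ennreal_mult_less_top)
  finally show ?thesis .
qed

lemma block_rate_finite: "block_rate < \<infinity>"
  using block_rate_le mean_sup_finite by (rule order_le_less_trans)

lemma windowed_finite:
  assumes pos: "AE f in \<mu>. 0 < total_mass f" shows "windowed n < \<infinity>"
proof -
  have "windowed n \<le> of_nat (n ^ CARD('n)) * block_rate + of_nat ((n - 2 * 0) ^ CARD('n)) * spill 1 0
     + of_nat (n ^ CARD('n) - (n - 2 * 0) ^ CARD('n)) * (3 * mean_sup)"
    by (rule windowed_upper[OF pos]) auto
  also have "\<dots> < \<infinity>"
  proof -
    have "3 * mean_sup < \<infinity>" using of_nat_mult_finite[OF mean_sup_finite, of 3] by simp
    then show ?thesis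
      using of_nat_mult_finite[OF block_rate_finite] of_nat_mult_finite[OF spill_finite[of 1 0]] of_nat_mult_finite
      by (simp del: of_nat_power)
  qed
  finally show ?thesis .
qed

lemma windowed_density:
  assumes pos: "AE f in \<mu>. 0 < total_mass f"
  shows "(\<lambda>n. enn2real (windowed n) / real n ^ CARD('n)) \<longlonglongrightarrow> enn2real block_rate"
proof (rule volume_density_limit)
  have core_fin: "core m < \<infinity>" for m
  proof -
    have "core m \<le> block_rate" by (intro nn_integral_mono mult_left_mono excess_mono) auto
    then show ?thesis using block_rate_finite by (rule order_le_less_trans)
  qed
  show "(real n - 2 * real m) ^ CARD('n) * enn2real (core m) \<le> enn2real (windowed n)" if "2 * m \<le> n" for n m
  proof -
    have "enn2real (of_nat ((n - 2 * m) ^ CARD('n)) * core m) \<le> enn2real (windowed n)"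
      using windowed_finite[OF pos, of n] by (intro enn2real_mono windowed_lower that) (auto simp: less_top)
    moreover have "(real n - 2 * real m) ^ CARD('n) = real ((n - 2 * m) ^ CARD('n))" using that by (simp add: of_nat_diff)
    ultimately show ?thesis by (simp only: enn2real_of_nat_mult)
  qed
  show "(\<lambda>m. enn2real (core m)) \<longlonglongrightarrow> enn2real block_rate"
    using core_tendsto block_rate_finite by (intro tendsto_enn2real) (auto simp: less_top)
  fix e :: real assume e: "0 < e"
  \<comment> \<open>The overflow of an inner cell is asymptotically at most \<open>\<epsilon>\<close> times the mean supremum.\<close>
  define \<epsilon> where "\<epsilon> = min 1 (e / (enn2real mean_sup + 1))"
  have K1: "0 < enn2real mean_sup + 1" by (simp add: add_nonneg_pos)
  then have \<epsilon>: "0 < \<epsilon>" "\<epsilon> \<le> 1" using e by (auto simp: \<epsilon>_def)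
  have "\<epsilon> * enn2real mean_sup < e"
  proof -
    have "\<epsilon> * enn2real mean_sup < \<epsilon> * (enn2real mean_sup + 1)" using \<epsilon> by simp
    also have "\<dots> \<le> (e / (enn2real mean_sup + 1)) * (enn2real mean_sup + 1)"
      using K1 by (intro mult_right_mono) (auto simp: \<epsilon>_def)
    finally show ?thesis using K1 by simp
  qed
  then have "ennreal (\<epsilon> * enn2real mean_sup) < ennreal e" using \<epsilon> by (simp add: ennreal_less_iff)
  moreover have "ennreal \<epsilon> * mean_sup = ennreal (\<epsilon> * enn2real mean_sup)"
    using \<epsilon> mean_sup_finite by (simp add: ennreal_mult ennreal_enn2real)
  ultimately have "ennreal \<epsilon> * mean_sup < ennreal e" by simp
  then have "\<forall>\<^sub>F m in sequentially. spill \<epsilon> m < ennreal e"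
    using spill_bound[OF \<epsilon>(1)] by (intro order_tendstoD[OF spill_tendsto[OF pos \<epsilon>]]) (auto intro: order_le_less_trans)
  then obtain m where m: "spill \<epsilon> m < ennreal e" by (auto simp: eventually_sequentially)
  have sp: "enn2real (spill \<epsilon> m) \<le> e"
    using m e by (metis enn2real_ennreal enn2real_mono ennreal_less_top less_imp_le)
  show "\<exists>m. \<forall>n\<ge>2 * m. enn2real (windowed n) \<le> real n ^ CARD('n) * enn2real block_rate +
      (real n - 2 * real m) ^ CARD('n) * e +
      (real n ^ CARD('n) - (real n - 2 * real m) ^ CARD('n)) * (3 * enn2real mean_sup)"
  proof (intro exI[of _ m] allI impI)
    fix n assume n: "2 * m \<le> n"
    have le: "(n - 2 * m) ^ CARD('n) \<le> n ^ CARD('n)" by (intro power_mono) auto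
    let ?A = "of_nat (n ^ CARD('n)) * block_rate" and ?B = "of_nat ((n - 2 * m) ^ CARD('n)) * spill \<epsilon> m"
      and ?C = "of_nat (n ^ CARD('n) - (n - 2 * m) ^ CARD('n)) * (3 * mean_sup)"
    have fin: "?A < \<infinity>" "?B < \<infinity>" "?C < \<infinity>"
      using of_nat_mult_finite[OF block_rate_finite] of_nat_mult_finite[OF spill_finite[OF \<epsilon>(2), of m]]
        of_nat_mult_finite[of "3 * mean_sup"] of_nat_mult_finite[OF mean_sup_finite, of 3] by (simp_all del: of_nat_power)
    have "enn2real (windowed n) \<le> enn2real (?A + ?B + ?C)"
      using windowed_upper[OF pos n \<epsilon>(2)] fin by (intro enn2real_mono) auto
    also have "\<dots> = enn2real ?A + enn2real ?B + enn2real ?C"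
      using fin by (simp add: enn2real_plus)
    also have "\<dots> = real n ^ CARD('n) * enn2real block_rate + (real n - 2 * real m) ^ CARD('n) * enn2real (spill \<epsilon> m)
       + (real n ^ CARD('n) - (real n - 2 * real m) ^ CARD('n)) * (3 * enn2real mean_sup)"
    proof -
      have r: "(real n - 2 * real m) ^ CARD('n) = real ((n - 2 * m) ^ CARD('n))" using n by (simp add: of_nat_diff)
      have r': "real n ^ CARD('n) - (real n - 2 * real m) ^ CARD('n) = real (n ^ CARD('n) - (n - 2 * m) ^ CARD('n))"
        unfolding r using le by (simp add: of_nat_diff)
      have "enn2real (3 * mean_sup) = 3 * enn2real mean_sup" by (simp add: enn2real_mult)
      then show ?thesis unfolding r' r enn2real_of_nat_mult by simp
    qed
    also have "\<dots> \<le> real n ^ CARD('n) * enn2real block_rate + (real n - 2 * real m) ^ CARD('n) * e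
       + (real n ^ CARD('n) - (real n - 2 * real m) ^ CARD('n)) * (3 * enn2real mean_sup)"
      using n sp by (intro add_mono mult_left_mono order_refl zero_le_power) auto
    finally show "enn2real (windowed n) \<le> real n ^ CARD('n) * enn2real block_rate +
      (real n - 2 * real m) ^ CARD('n) * e +
      (real n ^ CARD('n) - (real n - 2 * real m) ^ CARD('n)) * (3 * enn2real mean_sup)" .
  qed
qed

text \<open>
  The cell at the origin consists of sites \<open>t\<close>, and each can be shifted to 0 without changing the total
  mass or the excess over the whole space.
\<close>

lemma block_rate_eq:
  "block_rate = ennreal (L ^ CARD('n)) * (\<integral>\<^sup>+f. ennreal (f 0) / total_mass f * excess \<delta> x UNIV f \<partial>\<mu>)"
proof -
  let ?N = "grid_lebesgue \<delta> :: (real^'n) measure"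
  interpret N: sigma_finite_measure ?N by (rule sigma_finite_grid_lebesgue[OF \<delta>_nonneg])
  interpret P: pair_sigma_finite \<mu> ?N ..
  let ?g = "\<lambda>f t. ennreal (f t) / total_mass f * excess \<delta> x UNIV f"
  have G: "homogeneous (\<lambda>f. ?g f t)" for t
    by (rule homogeneousI) (simp_all add: mass_scale excess_scale \<delta>_nonneg ennreal_mult' ennreal_divide_scale mult_ac)
  have ev [measurable]: "(\<lambda>f. ennreal (f t)) \<in> borel_measurable path_space" for t :: "real^'n"
    using eval_measurable by measurable
  have gm: "(\<lambda>f. ?g f t) \<in> borel_measurable path_space" for t by measurable
  have inv: "(\<integral>\<^sup>+f. ?g f t \<partial>\<mu>) = (\<integral>\<^sup>+f. ?g f 0 \<partial>\<mu>)" if t: "t \<in> grid \<delta>" for t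
  proof -
    have "(\<integral>\<^sup>+f. ?g f t \<partial>\<mu>) = (\<integral>\<^sup>+f. ?g (backshift t f) t \<partial>\<mu>)"
      by (rule shift[OF gm G, symmetric])
    also have "\<dots> = (\<integral>\<^sup>+f. ?g f 0 \<partial>\<mu>)"
      using t by (intro nn_integral_cong) (simp add: mass_shift excess_shift, simp add: backshift_def)
    finally show ?thesis .
  qed
  have pm: "(\<lambda>p. ?g (fst p) (snd p) * indicator (cell L 0) (snd p)) \<in> borel_measurable (\<mu> \<Otimes>\<^sub>M ?N)"
  proof -
    have [measurable]: "(\<lambda>p. fst p) \<in> measurable (\<mu> \<Otimes>\<^sub>M ?N) path_space"
      using measurable_fst[of \<mu> ?N] by (simp add: measurable_cong_sets[OF refl sets_law])
    have [measurable]: "(\<lambda>p. fst p (snd p)) \<in> borel_measurable (\<mu> \<Otimes>\<^sub>M ?N)"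
      by (rule eval_measurable_compose) measurable
    have [measurable]: "(\<lambda>p. total_mass (fst p)) \<in> borel_measurable (\<mu> \<Otimes>\<^sub>M ?N)"
      by (rule measurable_compose[of fst _ path_space]) auto
    have [measurable]: "(\<lambda>p. excess \<delta> x UNIV (fst p)) \<in> borel_measurable (\<mu> \<Otimes>\<^sub>M ?N)"
      by (rule measurable_compose[of fst _ path_space]) auto
    show ?thesis by measurable
  qed
  have "block_rate = (\<integral>\<^sup>+f. \<integral>\<^sup>+t. ?g f t * indicator (cell L 0) t \<partial>?N \<partial>\<mu>)"
  proof (rule nn_integral_cong)
    fix f assume "f \<in> space \<mu>"
    then have f: "f \<in> cadlag_space" by simp
    note [measurable] = path_measurable[OF f]
    have "(\<integral>\<^sup>+t. ?g f t * indicator (cell L 0) t \<partial>?N)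
      = (\<integral>\<^sup>+t. (ennreal (f t) * indicator (cell L 0) t) * (inverse (total_mass f) * excess \<delta> x UNIV f) \<partial>?N)"
      by (simp add: divide_ennreal_def mult_ac)
    also have "\<dots> = mass \<delta> (cell L 0) f * (inverse (total_mass f) * excess \<delta> x UNIV f)"
      unfolding mass_def by (rule nn_integral_multc) measurable
    finally show "share (cell L 0) f * excess \<delta> x UNIV f = (\<integral>\<^sup>+t. ?g f t * indicator (cell L 0) t \<partial>?N)"
      by (simp add: divide_ennreal_def mult_ac)
  qed
  also have "\<dots> = (\<integral>\<^sup>+t. \<integral>\<^sup>+f. ?g f t * indicator (cell L 0) t \<partial>\<mu> \<partial>?N)"
    by (rule P.Fubini'[symmetric]) (use pm in \<open>simp add: case_prod_beta'\<close>)
  also have "\<dots> = (\<integral>\<^sup>+t. (\<integral>\<^sup>+f. ?g f t \<partial>\<mu>) * indicator (cell L 0) t \<partial>?N)"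
    by (intro nn_integral_cong nn_integral_multc) (simp add: measurable_law gm)
  also have "\<dots> = (\<integral>\<^sup>+t. (\<integral>\<^sup>+f. ?g f 0 \<partial>\<mu>) * indicator (cell L 0) t \<partial>?N)"
    by (rule nn_integral_cong_AE, rule AE_mp[OF AE_grid_lebesgue], rule AE_I2, rule impI, subst inv, assumption, rule refl)
  also have "\<dots> = (\<integral>\<^sup>+f. ?g f 0 \<partial>\<mu>) * emeasure ?N (cell L 0)"
    by (simp add: nn_integral_cmult)
  finally show ?thesis by (simp add: mult.commute emeasure_cell_0[OF coarser])
qed

proposition box_density_tendsto:
  assumes pos: "AE f in \<mu>. 0 < total_mass f"
  shows "((\<lambda>T. ennreal (1 / T ^ CARD('n)) * (\<integral>\<^sup>+f. excess \<delta> x (cbox 0 (vec T)) f \<partial>\<mu>))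
    \<longlongrightarrow> (\<integral>\<^sup>+f. ennreal (f 0) / total_mass f * excess \<delta> x UNIV f \<partial>\<mu>)) at_top"
    and "(\<integral>\<^sup>+f. ennreal (f 0) / total_mass f * excess \<delta> x UNIV f \<partial>\<mu>) < \<infinity>"
proof -
  let ?B = "\<integral>\<^sup>+f. ennreal (f 0) / total_mass f * excess \<delta> x UNIV f \<partial>\<mu>"
  let ?w = "\<lambda>n. enn2real (windowed n)"
  have LL: "0 < L ^ CARD('n)" using L_pos by simp
  show B: "?B < \<infinity>"
    using block_rate_finite LL unfolding block_rate_eq by (rule finite_of_mult_finite)
  have b: "enn2real block_rate / L ^ CARD('n) = enn2real ?B"
    unfolding block_rate_eq enn2real_ennreal_mult[OF less_imp_le[OF LL]]
    by (rule nonzero_mult_div_cancel_left) (use LL in \<open>rule less_imp_neq[symmetric]\<close>)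
  \<comment> \<open>\<open>window (n T)\<close> is contained in the cube of side \<open>T\<close>, which is contained in \<open>window (Suc (n T))\<close>.\<close>
  define n where "n T = nat \<lfloor>T / L\<rfloor>" for T
  have n: "real (n T) \<le> T / L" "T / L < real (n T) + 1" if "0 \<le> T" for T
    using that L_pos unfolding n_def by (auto simp: of_nat_nat)
  have low: "((\<lambda>T. ?w (n T) / real (n T) ^ CARD('n) * (real (n T) / T) ^ CARD('n)) \<longlongrightarrow> enn2real ?B) at_top"
    unfolding b[symmetric]
    by (rule tendsto_block_count[OF L_pos windowed_density[OF pos]]) (use n in force)
  have high: "((\<lambda>T. ?w (Suc (n T)) / real (Suc (n T)) ^ CARD('n) * (real (Suc (n T)) / T) ^ CARD('n)) \<longlongrightarrow> enn2real ?B) at_top"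
    unfolding b[symmetric]
    by (rule tendsto_block_count[OF L_pos windowed_density[OF pos], where n="\<lambda>T. Suc (n T)"]) (use n in force)
  have w: "ennreal (?w k) = windowed k" for k
    using windowed_finite[OF pos, of k] by (simp add: ennreal_enn2real)
  show "((\<lambda>T. ennreal (1 / T ^ CARD('n)) * (\<integral>\<^sup>+f. excess \<delta> x (cbox 0 (vec T)) f \<partial>\<mu>)) \<longlongrightarrow> ?B) at_top"
  proof (rule tendsto_sandwich)
    show "((\<lambda>T. ennreal (?w (n T) / real (n T) ^ CARD('n) * (real (n T) / T) ^ CARD('n))) \<longlongrightarrow> ?B) at_top"
      using tendsto_ennrealI[OF low] B by (simp add: ennreal_enn2real)
    show "((\<lambda>T. ennreal (?w (Suc (n T)) / real (Suc (n T)) ^ CARD('n) * (real (Suc (n T)) / T) ^ CARD('n))) \<longlongrightarrow> ?B) at_top"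
      using tendsto_ennrealI[OF high] B by (simp add: ennreal_enn2real)
    have scale: "ennreal (?w k / real k ^ CARD('n) * (real k / T) ^ CARD('n)) = ennreal (1 / T ^ CARD('n)) * windowed k"
      if "0 < T" "0 < k" for k T
    proof -
      have "?w k / real k ^ CARD('n) * (real k / T) ^ CARD('n) = 1 / T ^ CARD('n) * ?w k"
        using that by (simp add: power_divide)
      moreover have "ennreal (1 / T ^ CARD('n) * ?w k) = ennreal (1 / T ^ CARD('n)) * ennreal (?w k)"
        using that by (intro ennreal_mult) auto
      ultimately show ?thesis by (simp only: w)
    qed
    show "\<forall>\<^sub>F T in at_top. ennreal (?w (n T) / real (n T) ^ CARD('n) * (real (n T) / T) ^ CARD('n))
       \<le> ennreal (1 / T ^ CARD('n)) * (\<integral>\<^sup>+f. excess \<delta> x (cbox 0 (vec T)) f \<partial>\<mu>)"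
      using eventually_ge_at_top[of L]
    proof eventually_elim
      case (elim T)
      have T: "0 < T" using elim L_pos by simp
      have "1 \<le> T / L" using elim L_pos by simp
      then have nT: "0 < n T" using n(2)[of T] T by linarith
      have "window (n T) \<subseteq> cbox 0 (vec T)"
      proof
        fix t assume t: "t \<in> window (n T)"
        have "real (n T) * L \<le> T" using n(1)[of T] T L_pos by (simp add: field_simps)
        moreover have "0 \<le> t $ i \<and> t $ i < real (n T) * L" for i using t by (simp add: window_def cell_def)
        ultimately have "0 \<le> t $ i \<and> t $ i \<le> T" for i by (meson less_imp_le order_less_le_trans)
        then show "t \<in> cbox 0 (vec T)" by (simp add: mem_box_cart)
      qed
      then show ?case unfolding scale[OF T nT]
        by (intro mult_left_mono nn_integral_mono excess_mono) auto
    qed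
    show "\<forall>\<^sub>F T in at_top. ennreal (1 / T ^ CARD('n)) * (\<integral>\<^sup>+f. excess \<delta> x (cbox 0 (vec T)) f \<partial>\<mu>)
      \<le> ennreal (?w (Suc (n T)) / real (Suc (n T)) ^ CARD('n) * (real (Suc (n T)) / T) ^ CARD('n))"
      using eventually_gt_at_top[of "0::real"]
    proof eventually_elim
      case (elim T)
      have "cbox 0 (vec T) \<subseteq> window (Suc (n T))"
      proof
        fix t :: "real^'n" assume t: "t \<in> cbox 0 (vec T)"
        have "T < real (Suc (n T)) * L" using n(2)[of T] elim L_pos by (simp add: field_simps)
        moreover have "0 \<le> t $ i \<and> t $ i \<le> T" for i using t by (simp add: mem_box_cart)
        ultimately have "0 \<le> t $ i \<and> t $ i < real (Suc (n T)) * L" for i by (meson order_le_less_trans)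
        then show "t \<in> window (Suc (n T))" unfolding window_def cell_def by (simp del: of_nat_Suc)
      qed
      then show ?case unfolding scale[OF elim zero_less_Suc]
        by (intro mult_left_mono nn_integral_mono excess_mono) auto
    qed
  qed
qed

end

lemma backshift_backshift: "backshift a (backshift b f) = backshift (a + b) f"
  by (auto simp: backshift_def fun_eq_iff algebra_simps)

lemma mass_grid_sum:
  fixes f :: "real^'n \<Rightarrow> real"
  assumes "\<eta> \<noteq> 0" "f \<in> cadlag_space"
  shows "mass \<eta> UNIV f = ennreal (\<eta> ^ CARD('n)) * (\<integral>\<^sup>+c. ennreal (f c) \<partial>count_space (grid \<eta>))"
  unfolding mass_def using nn_integral_grid_lebesgue_pos[OF assms(1), of "\<lambda>t. ennreal (f t)"] path_measurable[OF assms(2)]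
  by simp

text \<open>
  Folding onto the cell of side \<open>\<eta>\<close> at the origin, one integrates over \<open>t\<close> the sum of the values of
  \<open>backshift t f\<close> on the grid of spacing \<open>\<eta>\<close>, divided by \<open>\<eta>^d\<close> times the same sum.
\<close>

lemma normalised_grid_integral:
  fixes f :: "real^'n \<Rightarrow> real"
  assumes co: "coarser \<delta> \<eta>" and f: "f \<in> cadlag_space"
    and fin: "\<And>r. r \<in> grid \<delta> \<Longrightarrow> 0 < mass \<eta> UNIV (backshift r f) \<and> mass \<eta> UNIV (backshift r f) < \<infinity>"
  shows "(\<integral>\<^sup>+r. ennreal (f (- r)) / mass \<eta> UNIV (backshift r f) \<partial>grid_lebesgue \<delta>) = 1"
proof -
  note \<eta> = coarserD[OF co]
  have \<eta>d: "0 < \<eta> ^ CARD('n)" using \<eta> by simp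
  let ?g = "\<lambda>r. ennreal (f (- r)) / mass \<eta> UNIV (backshift r f)"
  have "(\<lambda>r. backshift r f) \<in> measurable borel path_space"
    by (rule backshift_pair_measurable) (use f in auto)
  from measurable_compose[OF this mass_measurable[of \<eta> UNIV]] \<eta>
  have [measurable]: "(\<lambda>r. mass \<eta> UNIV (backshift r f)) \<in> borel_measurable borel" by simp
  note [measurable] = path_measurable[OF f]
  have inner: "(\<integral>\<^sup>+c. ?g (t + c) \<partial>count_space (grid \<eta>)) = ennreal (1 / \<eta> ^ CARD('n))" if t: "t \<in> grid \<delta>" for t
  proof -
    let ?S = "\<integral>\<^sup>+c. ennreal (f (c - t)) \<partial>count_space (grid \<eta>)"
    have S: "mass \<eta> UNIV (backshift t f) = ennreal (\<eta> ^ CARD('n)) * ?S"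
      using mass_grid_sum[OF _ backshift_cadlag[OF f], of \<eta> t] \<eta> by (simp add: backshift_def)
    have "(\<integral>\<^sup>+c. ?g (t + c) \<partial>count_space (grid \<eta>)) = (\<integral>\<^sup>+c. ennreal (f (- c - t)) / mass \<eta> UNIV (backshift t f) \<partial>count_space (grid \<eta>))"
    proof (rule nn_integral_cong)
      fix c :: "real^'n" assume "c \<in> space (count_space (grid \<eta>))"
      then have c: "c \<in> grid \<eta>" by simp
      have "mass \<eta> UNIV (backshift (t + c) f) = mass \<eta> UNIV (backshift c (backshift t f))"
        by (simp add: backshift_backshift add.commute)
      also have "\<dots> = mass \<eta> UNIV (backshift t f)" using mass_shift[OF c backshift_cadlag[OF f], of UNIV] by simp
      finally show "?g (t + c) = ennreal (f (- c - t)) / mass \<eta> UNIV (backshift t f)" by (simp add: add.commute)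
    qed
    also have "\<dots> = (\<integral>\<^sup>+c. ennreal (f (- c - t)) \<partial>count_space (grid \<eta>)) / mass \<eta> UNIV (backshift t f)"
      by (rule nn_integral_divide) simp
    also have "(\<integral>\<^sup>+c. ennreal (f (- c - t)) \<partial>count_space (grid \<eta>)) = ?S"
      by (rule nn_integral_grid_reflect)
    also have "?S / mass \<eta> UNIV (backshift t f) = ennreal (1 / \<eta> ^ CARD('n))"
    proof -
      have "0 < ?S" "?S < \<infinity>"
        using fin[OF t] finite_of_mult_finite[OF _ \<eta>d, of ?S] unfolding S by (auto simp: ennreal_zero_less_mult_iff)
      then have "?S / ?S = 1" by (simp add: ennreal_divide_self less_top)
      moreover have "inverse (ennreal (\<eta> ^ CARD('n)) * ?S) = inverse (ennreal (\<eta> ^ CARD('n))) * inverse ?S"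
        using \<eta>d by (intro ennreal_inverse_mult') auto
      ultimately show ?thesis unfolding S using \<eta>d
        by (simp add: divide_ennreal_def inverse_ennreal mult.left_commute divide_inverse)
    qed
    finally show ?thesis .
  qed
  have "(\<integral>\<^sup>+r. ?g r \<partial>grid_lebesgue \<delta>) =
    (\<integral>\<^sup>+t. (\<integral>\<^sup>+c. ?g (t + c) \<partial>count_space (grid \<eta>)) * indicator (cell \<eta> 0) t \<partial>grid_lebesgue \<delta>)"
    by (rule nn_integral_cells_shift[OF co]) measurable
  also have "\<dots> = (\<integral>\<^sup>+t. ennreal (1 / \<eta> ^ CARD('n)) * indicator (cell \<eta> (0 :: real^'n)) t \<partial>grid_lebesgue \<delta>)"
    by (rule nn_integral_cong_AE, rule AE_mp[OF AE_grid_lebesgue], rule AE_I2, rule impI) (simp only: inner)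
  also have "\<dots> = ennreal (1 / \<eta> ^ CARD('n)) * ennreal (\<eta> ^ CARD('n))"
    using emeasure_cell_0[OF co, where 'n='n] by (simp add: nn_integral_cmult)
  also have "\<dots> = 1" using \<eta>d \<eta> by (simp add: ennreal_mult[symmetric])
  finally show ?thesis .
qed

lemma normalised_grid_integral_measurable:
  assumes \<delta>: "0 \<le> \<delta>" and \<eta>: "0 \<le> \<eta>"
  shows "(\<lambda>f :: real^'n \<Rightarrow> real. \<integral>\<^sup>+r. ennreal (f (- r)) / mass \<eta> UNIV (backshift r f) \<partial>grid_lebesgue \<delta>)
    \<in> borel_measurable path_space"
proof (rule sigma_finite_measure.borel_measurable_nn_integral[OF sigma_finite_grid_lebesgue[OF \<delta>]])
  let ?P = "path_space \<Otimes>\<^sub>M (grid_lebesgue \<delta> :: (real^'n) measure)"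
  have [measurable]: "(\<lambda>p. fst p (- snd p)) \<in> borel_measurable ?P"
    by (rule eval_measurable_compose) measurable
  have [measurable]: "(\<lambda>p. mass \<eta> UNIV (backshift (snd p) (fst p))) \<in> borel_measurable ?P"
    by (rule measurable_compose[OF backshift_pair_measurable mass_measurable[OF \<eta>]]) measurable
  show "(\<lambda>(f, r). ennreal (f (- r)) / mass \<eta> UNIV (backshift r f)) \<in> borel_measurable ?P"
    unfolding case_prod_beta' by measurable
qed

context invariant_law
begin

text \<open>
  Finiteness of the mass on one grid controls the suprema over its cells, and these control the
  mass on every finer grid.
\<close>

lemma AE_mass_finite_transfer:
  assumes co: "coarser \<gamma> \<gamma>" and co': "coarser \<delta> \<gamma>"
  shows "AE f in \<mu>. 0 < mass \<gamma> UNIV f \<and> mass \<gamma> UNIV f < \<infinity> \<longrightarrow> mass \<delta> UNIV f < \<infinity>"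
proof -
  interpret b: blocks \<mu> \<gamma> \<gamma> 0 by unfold_locales (rule co)
  show ?thesis
  proof (rule AE_mp[OF b.AE_sup_sum_finite], rule AE_I2, rule impI, rule impI)
    fix f assume "f \<in> space \<mu>" and "0 < mass \<gamma> UNIV f \<and> mass \<gamma> UNIV f < \<infinity> \<longrightarrow> sup_sum \<gamma> UNIV f < \<infinity>"
      and "0 < mass \<gamma> UNIV f \<and> mass \<gamma> UNIV f < \<infinity>"
    then have f: "f \<in> cadlag_space" and fin: "sup_sum \<gamma> UNIV f < \<infinity>" by auto
    have "mass \<delta> UNIV f \<le> ennreal (\<gamma> ^ CARD('n)) * sup_sum \<gamma> UNIV f" by (rule mass_le_sup_sum[OF co' f])
    also have "\<dots> < \<infinity>" using fin by (simp add: ennreal_mult_less_top)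
    finally show "mass \<delta> UNIV f < \<infinity>" .
  qed
qed

text \<open>
  Mass transport between the site 0 and the site \<open>r\<close> of the grid of spacing \<open>\<delta>\<close>. The total mass for
  spacing \<open>\<eta>\<close> is not invariant under the shift by \<open>r\<close>; what remains of it is the integral in the
  third assumption.
\<close>

proposition change_of_normalisation:
  assumes co: "coarser \<delta> \<eta>"
    and pos: "AE f in \<mu>. 0 < mass \<delta> UNIV f"
    and cond: "AE f in \<mu>. mass 0 UNIV f < \<infinity> \<longrightarrow>
        (\<integral>\<^sup>+r. ennreal (f (- r)) / mass \<eta> UNIV (backshift r f) \<partial>grid_lebesgue \<delta>) = 1"
  shows "(\<integral>\<^sup>+f. ennreal (f 0) / mass \<eta> UNIV f * excess \<delta> x UNIV f \<partial>\<mu>) =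
    (\<integral>\<^sup>+f. ennreal (f 0) / mass \<delta> UNIV f * excess \<delta> x UNIV f \<partial>\<mu>)"
proof -
  have \<eta>: "0 < \<eta>" using co by (rule coarserD)
  have \<delta>: "0 \<le> \<delta>" using co by (simp add: coarser_def)
  have co\<eta>: "coarser \<eta> \<eta>" using \<eta> by (auto simp: coarser_def intro: exI[of _ 1])
  let ?N = "grid_lebesgue \<delta> :: (real^'n) measure"
  interpret N: sigma_finite_measure ?N by (rule sigma_finite_grid_lebesgue[OF \<delta>])
  interpret P: pair_sigma_finite \<mu> ?N ..
  let ?H = "excess \<delta> x UNIV :: (real^'n \<Rightarrow> real) \<Rightarrow> ennreal"
  let ?S = "mass \<delta> UNIV :: (real^'n \<Rightarrow> real) \<Rightarrow> ennreal"
  let ?R = "mass \<eta> UNIV :: (real^'n \<Rightarrow> real) \<Rightarrow> ennreal"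
  have S_m [measurable]: "?S \<in> borel_measurable path_space" by (rule mass_measurable[OF \<delta>]) simp
  have R_m [measurable]: "?R \<in> borel_measurable path_space" by (rule mass_measurable) (use \<eta> in auto)
  have H_m [measurable]: "?H \<in> borel_measurable path_space" by (rule excess_measurable[OF \<delta>]) simp
  have ev [measurable]: "(\<lambda>f. ennreal (f t)) \<in> borel_measurable path_space" for t :: "real^'n"
    using eval_measurable by measurable
  have fin1: "AE f in \<mu>. 0 < ?R f \<and> ?R f < \<infinity> \<longrightarrow> ?S f < \<infinity>"
    by (rule AE_mass_finite_transfer[OF co\<eta> co])
  have fin2: "AE f in \<mu>. 0 < ?S f \<and> ?S f < \<infinity> \<longrightarrow> mass 0 UNIV f < \<infinity>"
  proof (cases "\<delta> = 0")
    case False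
    then have "coarser \<delta> \<delta>" "coarser 0 \<delta>" using \<delta> by (auto simp: coarser_def intro: exI[of _ 1])
    then show ?thesis by (rule AE_mass_finite_transfer)
  qed simp
  let ?g = "\<lambda>r f. ennreal (f r) / ?S f * (ennreal (f 0) / ?R f * ?H f)"
  \<comment> \<open>\<open>?g' r\<close> is \<open>?g r\<close> evaluated at the path shifted by \<open>r\<close>.\<close>
  let ?g' = "\<lambda>r f. ennreal (f 0) / ?S f * ?H f * (ennreal (f (- r)) / ?R (backshift r f))"
  have G: "homogeneous (?g r)" for r
    by (rule homogeneousI) (simp_all add: mass_scale excess_scale \<delta> ennreal_mult' ennreal_divide_scale mult_ac)
  have gm: "?g r \<in> borel_measurable path_space" for r by measurable
  have fst_m [measurable]: "(\<lambda>p. fst p) \<in> measurable (\<mu> \<Otimes>\<^sub>M ?N) path_space"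
    using measurable_fst[of \<mu> ?N] by (simp add: measurable_cong_sets[OF refl sets_law])
  have c1 [measurable]: "(\<lambda>p. fst p (snd p)) \<in> borel_measurable (\<mu> \<Otimes>\<^sub>M ?N)"
    by (rule eval_measurable_compose) measurable
  have c2 [measurable]: "(\<lambda>p. fst p (- snd p)) \<in> borel_measurable (\<mu> \<Otimes>\<^sub>M ?N)"
    by (rule eval_measurable_compose) measurable
  have c3 [measurable]: "(\<lambda>p. fst p 0) \<in> borel_measurable (\<mu> \<Otimes>\<^sub>M ?N)"
    by (rule eval_measurable_compose) measurable
  have c4 [measurable]: "(\<lambda>p. ?S (fst p)) \<in> borel_measurable (\<mu> \<Otimes>\<^sub>M ?N)"
    by (rule measurable_compose[OF fst_m S_m])
  have c5 [measurable]: "(\<lambda>p. ?R (fst p)) \<in> borel_measurable (\<mu> \<Otimes>\<^sub>M ?N)"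
    by (rule measurable_compose[OF fst_m R_m])
  have c6 [measurable]: "(\<lambda>p. ?H (fst p)) \<in> borel_measurable (\<mu> \<Otimes>\<^sub>M ?N)"
    by (rule measurable_compose[OF fst_m H_m])
  have c7 [measurable]: "(\<lambda>p. ?R (backshift (snd p) (fst p))) \<in> borel_measurable (\<mu> \<Otimes>\<^sub>M ?N)"
    by (rule measurable_compose[OF backshift_pair_measurable R_m]) measurable
  have gpm: "(\<lambda>p. ?g (snd p) (fst p)) \<in> borel_measurable (\<mu> \<Otimes>\<^sub>M ?N)" by measurable
  have gpm': "(\<lambda>p. ?g' (snd p) (fst p)) \<in> borel_measurable (\<mu> \<Otimes>\<^sub>M ?N)" by measurable
  have "(\<integral>\<^sup>+f. ennreal (f 0) / ?R f * ?H f \<partial>\<mu>) = (\<integral>\<^sup>+f. \<integral>\<^sup>+r. ?g r f \<partial>?N \<partial>\<mu>)"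
  proof (rule nn_integral_cong_AE, rule AE_mp[OF AE_conjI[OF fin1 pos]], rule AE_I2, rule impI)
    fix f assume "f \<in> space \<mu>" and A: "(0 < ?R f \<and> ?R f < \<infinity> \<longrightarrow> ?S f < \<infinity>) \<and> 0 < ?S f"
    then have f: "f \<in> cadlag_space" by simp
    note [measurable] = path_measurable[OF f]
    have "(\<integral>\<^sup>+r. ?g r f \<partial>?N) = (?S f / ?S f) * (ennreal (f 0) / ?R f * ?H f)"
    proof -
      have "(\<integral>\<^sup>+r. ?g r f \<partial>?N) = (\<integral>\<^sup>+r. ennreal (f r) / ?S f \<partial>?N) * (ennreal (f 0) / ?R f * ?H f)"
        by (rule nn_integral_multc) measurable
      also have "(\<integral>\<^sup>+r. ennreal (f r) / ?S f \<partial>?N) = (\<integral>\<^sup>+r. ennreal (f r) \<partial>?N) / ?S f"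
        by (rule nn_integral_divide) measurable
      also have "(\<integral>\<^sup>+r. ennreal (f r) \<partial>?N) = ?S f" by (simp add: mass_def)
      finally show ?thesis .
    qed
    also have "\<dots> = ennreal (f 0) / ?R f * ?H f"
    proof (cases "ennreal (f 0) / ?R f = 0")
      case False
      then have R: "?R f < \<infinity>" and f0: "0 < f 0"
        using path_nonneg[OF f, of 0] by (auto simp: divide_ennreal_def less_top)
      have "0 < ?R f"
      proof -
        have "ennreal (f 0) = (\<integral>\<^sup>+c. ennreal (f 0) * indicator {0 :: real^'n} c \<partial>count_space (grid \<eta>))"
          by (simp add: nn_integral_cmult one_ennreal_def[symmetric])
        also have "\<dots> \<le> (\<integral>\<^sup>+c. ennreal (f c) \<partial>count_space (grid \<eta>))"
          by (intro nn_integral_mono) (auto simp: indicator_def)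
        finally have le: "ennreal (f 0) \<le> (\<integral>\<^sup>+c. ennreal (f c) \<partial>count_space (grid \<eta>))" .
        have "0 < ennreal (f 0)" using f0 by simp
        then have "0 < (\<integral>\<^sup>+c. ennreal (f c) \<partial>count_space (grid \<eta>))"
          using le by (rule order_less_le_trans)
        then show ?thesis using \<eta> mass_grid_sum[OF _ f, of \<eta>] by (simp add: ennreal_zero_less_mult_iff)
      qed
      with A R have "0 < ?S f" "?S f < \<infinity>" by auto
      then have "?S f / ?S f = 1" by (simp add: ennreal_divide_self less_top)
      then show ?thesis by simp
    qed (simp only: mult_zero_left mult_zero_right)
    finally show "ennreal (f 0) / ?R f * ?H f = (\<integral>\<^sup>+r. ?g r f \<partial>?N)" by simp
  qed
  also have "\<dots> = (\<integral>\<^sup>+r. \<integral>\<^sup>+f. ?g r f \<partial>\<mu> \<partial>?N)"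
    by (rule P.Fubini'[symmetric]) (use gpm in \<open>simp add: case_prod_beta'\<close>)
  also have "\<dots> = (\<integral>\<^sup>+r. \<integral>\<^sup>+f. ?g' r f \<partial>\<mu> \<partial>?N)"
  proof (rule nn_integral_cong_AE, rule AE_mp[OF AE_grid_lebesgue], rule AE_I2, rule impI)
    fix r :: "real^'n" assume r: "r \<in> grid \<delta>"
    have "(\<integral>\<^sup>+f. ?g r f \<partial>\<mu>) = (\<integral>\<^sup>+f. ?g r (backshift r f) \<partial>\<mu>)" by (rule shift[OF gm G, symmetric])
    also have "\<dots> = (\<integral>\<^sup>+f. ?g' r f \<partial>\<mu>)"
    proof (rule nn_integral_cong)
      fix f assume "f \<in> space \<mu>"
      then have f: "f \<in> cadlag_space" by simp
      have "?S (backshift r f) = ?S f" "?H (backshift r f) = ?H f"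
        using mass_shift[OF r f, of UNIV] excess_shift[OF r f, of UNIV] by simp_all
      moreover have "backshift r f r = f 0" "backshift r f 0 = f (- r)" by (simp_all add: backshift_def)
      ultimately show "?g r (backshift r f) = ?g' r f" by (simp add: mult_ac)
    qed
    finally show "(\<integral>\<^sup>+f. ?g r f \<partial>\<mu>) = (\<integral>\<^sup>+f. ?g' r f \<partial>\<mu>)" .
  qed
  also have "\<dots> = (\<integral>\<^sup>+f. \<integral>\<^sup>+r. ?g' r f \<partial>?N \<partial>\<mu>)"
    by (rule P.Fubini') (use gpm' in \<open>simp add: case_prod_beta'\<close>)
  also have "\<dots> = (\<integral>\<^sup>+f. ennreal (f 0) / ?S f * ?H f \<partial>\<mu>)"
  proof (rule nn_integral_cong_AE, rule AE_mp[OF AE_conjI[OF fin2 AE_conjI[OF pos cond]]], rule AE_I2, rule impI)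
    fix f assume "f \<in> space \<mu>" and A: "(0 < ?S f \<and> ?S f < \<infinity> \<longrightarrow> mass 0 UNIV f < \<infinity>) \<and> 0 < ?S f \<and>
      (mass 0 UNIV f < \<infinity> \<longrightarrow> (\<integral>\<^sup>+r. ennreal (f (- r)) / ?R (backshift r f) \<partial>?N) = 1)"
    then have f: "f \<in> cadlag_space" by simp
    note [measurable] = path_measurable[OF f]
    have "(\<lambda>r. backshift r f) \<in> measurable borel path_space"
      by (rule backshift_pair_measurable) (use f in auto)
    from measurable_compose[OF this R_m]
    have [measurable]: "(\<lambda>r. ?R (backshift r f)) \<in> borel_measurable borel" .
    have "(\<integral>\<^sup>+r. ?g' r f \<partial>?N) = ennreal (f 0) / ?S f * ?H f * (\<integral>\<^sup>+r. ennreal (f (- r)) / ?R (backshift r f) \<partial>?N)"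
      by (rule nn_integral_cmult) measurable
    also have "\<dots> = ennreal (f 0) / ?S f * ?H f"
    proof (cases "?S f = \<infinity>")
      case True
      then show ?thesis by simp
    next
      case False
      then have "mass 0 UNIV f < \<infinity>" using A by (auto simp: less_top)
      then have "(\<integral>\<^sup>+r. ennreal (f (- r)) / ?R (backshift r f) \<partial>?N) = 1"
        using A by blast
      then show ?thesis by simp
    qed
    finally show "(\<integral>\<^sup>+r. ?g' r f \<partial>?N) = ennreal (f 0) / ?S f * ?H f" .
  qed
  finally show ?thesis .
qed

end

section \<open>The Berman function\<close>

text \<open>
  Exchanging the integral over levels with the expectation produces the homogeneous functional.
\<close>

lemma nn_integral_sojourn_level:
  fixes Y :: "'a \<Rightarrow> real^'n \<Rightarrow> real"
  assumes "prob_space M" and Y: "Y \<in> measurable M path_space"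
    and \<phi>: "\<phi> \<in> borel_measurable path_space" and \<delta>: "0 \<le> \<delta>" and A: "A \<in> sets borel"
  shows "(\<integral>\<^sup>+s\<in>{0..}. (\<integral>\<^sup>+\<omega>. \<phi> (Y \<omega>) * indicator {\<omega>. ennreal x < sojourn \<delta> A (Y \<omega>) s} \<omega> \<partial>M) \<partial>lborel)
    = (\<integral>\<^sup>+f. \<phi> f * excess \<delta> x A f \<partial>distr M path_space Y)"
proof -
  interpret prob_space M by fact
  interpret P: pair_sigma_finite M "lborel :: real measure" ..
  have \<phi>Y [measurable]: "(\<lambda>\<omega>. \<phi> (Y \<omega>)) \<in> borel_measurable M" by (rule measurable_compose[OF Y \<phi>])
  have "(\<lambda>p. (Y (fst p), snd p)) \<in> measurable (M \<Otimes>\<^sub>M lborel) (path_space \<Otimes>\<^sub>M borel)"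
    by (intro measurable_Pair measurable_compose[OF measurable_fst Y]) auto
  from measurable_compose[OF this sojourn_pair_measurable[OF \<delta> A]]
  have soj [measurable]: "(\<lambda>p. sojourn \<delta> A (Y (fst p)) (snd p)) \<in> borel_measurable (M \<Otimes>\<^sub>M lborel)" by simp
  let ?i = "\<lambda>\<omega> s. indicator {p. ennreal x < sojourn \<delta> A (Y (fst p)) (snd p)} (\<omega>, s) :: ennreal"
  have m: "(\<lambda>p. \<phi> (Y (fst p)) * ?i (fst p) (snd p) * indicator {0..} (snd p)) \<in> borel_measurable (M \<Otimes>\<^sub>M lborel)"
    by measurable
  have m1: "(\<lambda>\<omega>. \<phi> (Y \<omega>) * ?i \<omega> s) \<in> borel_measurable M" for s by measurable
  have m2: "(\<lambda>s. ?i \<omega> s * indicator {0..} s) \<in> borel_measurable lborel" if "\<omega> \<in> space M" for \<omega>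
    using that by measurable
  have "(\<integral>\<^sup>+s\<in>{0..}. (\<integral>\<^sup>+\<omega>. \<phi> (Y \<omega>) * indicator {\<omega>. ennreal x < sojourn \<delta> A (Y \<omega>) s} \<omega> \<partial>M) \<partial>lborel)
     = (\<integral>\<^sup>+s. \<integral>\<^sup>+\<omega>. \<phi> (Y \<omega>) * ?i \<omega> s * indicator {0..} s \<partial>M \<partial>lborel)"
  proof (rule nn_integral_cong)
    fix s :: real
    have "(\<integral>\<^sup>+\<omega>. \<phi> (Y \<omega>) * ?i \<omega> s * indicator {0..} s \<partial>M) = (\<integral>\<^sup>+\<omega>. \<phi> (Y \<omega>) * ?i \<omega> s \<partial>M) * indicator {0..} s"
      by (rule nn_integral_multc[OF m1])
    then show "(\<integral>\<^sup>+\<omega>. \<phi> (Y \<omega>) * indicator {\<omega>. ennreal x < sojourn \<delta> A (Y \<omega>) s} \<omega> \<partial>M) * indicator {0..} s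
      = (\<integral>\<^sup>+\<omega>. \<phi> (Y \<omega>) * ?i \<omega> s * indicator {0..} s \<partial>M)" by (simp add: indicator_def)
  qed
  also have "\<dots> = (\<integral>\<^sup>+\<omega>. \<integral>\<^sup>+s. \<phi> (Y \<omega>) * ?i \<omega> s * indicator {0..} s \<partial>lborel \<partial>M)"
    by (rule P.Fubini') (use m in \<open>simp add: case_prod_beta'\<close>)
  also have "\<dots> = (\<integral>\<^sup>+\<omega>. \<phi> (Y \<omega>) * excess \<delta> x A (Y \<omega>) \<partial>M)"
  proof (rule nn_integral_cong)
    fix \<omega> assume "\<omega> \<in> space M"
    from nn_integral_cmult[OF m2[OF this], of "\<phi> (Y \<omega>)"]
    show "(\<integral>\<^sup>+s. \<phi> (Y \<omega>) * ?i \<omega> s * indicator {0..} s \<partial>lborel) = \<phi> (Y \<omega>) * excess \<delta> x A (Y \<omega>)"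
      by (simp add: excess_def indicator_def mult.assoc)
  qed
  also have "\<dots> = (\<integral>\<^sup>+f. \<phi> f * excess \<delta> x A f \<partial>distr M path_space Y)"
    by (rule nn_integral_distr[symmetric, OF Y])
       (use \<phi> excess_measurable[OF \<delta> A] in \<open>simp add: measurable_distr_eq1\<close>)
  finally show ?thesis .
qed

theorem theorem2p1:
  fixes M :: "'a measure"
    and Z :: "'a \<Rightarrow> real^'n \<Rightarrow> real"
    and V :: "nat \<Rightarrow> 'a \<Rightarrow> real"
    and W :: "nat \<Rightarrow> 'a \<Rightarrow> real^'n \<Rightarrow> real"
    and \<delta> x :: real
  assumes "prob_space M" and "complete_measure M" and "non_atomic M"
    and Z_field: "Z \<in> measurable M field_borel"
    and Z_paths: "AE \<omega> in M. Z \<omega> \<in> cadlag_space"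
    and Z_mean: "\<And>t. prob_space.expectation M (\<lambda>\<omega>. Z \<omega> t) = 1"
    and Z_sup: "\<And>T::real. T > 0 \<Longrightarrow> (\<integral>\<^sup>+\<omega>. (SUP t\<in>cbox 0 (vec T). ennreal (Z \<omega> t)) \<partial>M) < \<infinity>"
    and Z_nonzero: "AE \<omega> in M. (SUP t. ennreal (Z \<omega> t)) > 0"
    and "iid_unit_exponential M V"
    and "iid_copies M Z W"
    and "indep_sequences M V W"
    and X_stationary: "stationary_field M (max_stable_field V W)"
    and "\<delta> \<ge> 0" and "x \<ge> 0"
    and S_pos: "AE \<omega> in M. S_int \<delta> (Z \<omega>) > 0"
    and S0: "prob_space.prob M {\<omega>\<in>space M. S_int 0 (Z \<omega>) = \<infinity>} < 1"
  shows "(\<exists>B. (berman_average M Z \<delta> x \<longlongrightarrow> B) at_top)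
    \<and> berman M Z \<delta> x =
        (\<integral>\<^sup>+s\<in>{0..}. (\<integral>\<^sup>+\<omega>. ennreal (Z \<omega> 0) / S_int \<delta> (Z \<omega>) *
            indicator {\<omega>. sojourn \<delta> UNIV (Z \<omega>) s > ennreal x} \<omega> \<partial>M) \<partial>lborel)
    \<and> berman M Z \<delta> x < \<infinity>
    \<and> (\<forall>\<eta>. (if \<delta> = 0 then \<eta> > 0 else (\<exists>k::nat. k \<ge> 1 \<and> \<eta> = real k * \<delta>)) \<longrightarrow>
          (AE \<omega> in M. \<forall>r\<in>grid \<delta>.
             S_int 0 (Z \<omega>) < \<infinity> \<longrightarrow> 0 < S_int \<eta> (backshift r (Z \<omega>)) \<and> S_int \<eta> (backshift r (Z \<omega>)) < \<infinity>) \<longrightarrow>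
          berman M Z \<delta> x =
            (\<integral>\<^sup>+s\<in>{0..}. (\<integral>\<^sup>+\<omega>. ennreal (Z \<omega> 0) / S_int \<eta> (Z \<omega>) *
                indicator {\<omega>. sojourn \<delta> UNIV (Z \<omega>) s > ennreal x} \<omega> \<partial>M) \<partial>lborel))"
proof -
  interpret prob_space M by fact
  interpret complete_measure M by fact
  let ?H = "excess \<delta> x :: (real^'n) set \<Rightarrow> (real^'n \<Rightarrow> real) \<Rightarrow> ennreal"

  \<comment> \<open>A version of the field all of whose paths are cadlag; it is measurable because \<open>M\<close> is complete.\<close>
  define Y where "Y \<omega> = (if Z \<omega> \<in> cadlag_space then Z \<omega> else (\<lambda>_. 0))" for \<omega>
  have ZY: "AE \<omega> in M. Z \<omega> = Y \<omega>" using Z_paths by eventually_elim (simp add: Y_def)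
  have Y_cadlag: "Y \<omega> \<in> cadlag_space" for \<omega> by (simp add: Y_def zero_cadlag)
  have path_event: "{\<omega>\<in>space M. Z \<omega> \<in> cadlag_space} \<in> sets M"
  proof (rule in_sets_AE)
    show "AE \<omega> in M. \<omega> \<in> space M \<longleftrightarrow> \<omega> \<in> {\<omega>\<in>space M. Z \<omega> \<in> cadlag_space}"
      using Z_paths by eventually_elim auto
  qed auto
  have Z_eval: "(\<lambda>\<omega>. Z \<omega> t) \<in> borel_measurable M" for t
    by (rule measurable_compose[OF Z_field]) simp
  have Y_eval: "(\<lambda>\<omega>. Y \<omega> t) \<in> borel_measurable M" for t
  proof -
    have "(\<lambda>\<omega>. if Z \<omega> \<in> cadlag_space then Z \<omega> t else 0) \<in> borel_measurable M"
      by (rule measurable_If) (use Z_eval path_event in auto)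
    moreover have "(\<lambda>\<omega>. Y \<omega> t) = (\<lambda>\<omega>. if Z \<omega> \<in> cadlag_space then Z \<omega> t else 0)" by (auto simp: Y_def)
    ultimately show ?thesis by simp
  qed
  have Y_path: "Y \<in> measurable M path_space"
    by (rule measurable_path_spaceI) (auto simp: Y_cadlag Y_eval)
  have Y_field: "Y \<in> measurable M field_borel"
    by (rule measurable_PiM_single') (auto simp: Y_eval space_PiM)
  have Y_law: "distr M field_borel Y = distr M field_borel Z"
    by (rule distr_cong_AE) (use ZY Y_field Z_field in \<open>auto elim!: AE_mp\<close>)
  have Y_copies: "iid_copies M Y W" using \<open>iid_copies M Z W\<close> by (simp add: iid_copies_def Y_law)
  have Y_mean: "(\<integral>\<^sup>+\<omega>. ennreal (Y \<omega> t) \<partial>M) = 1" for t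
  proof -
    have int: "integrable M (\<lambda>\<omega>. Z \<omega> t)"
      using Z_mean[of t] not_integrable_integral_eq[of M "\<lambda>\<omega>. Z \<omega> t"] by fastforce
    have nn: "AE \<omega> in M. 0 \<le> Z \<omega> t" using Z_paths by eventually_elim (rule path_nonneg)
    have "(\<integral>\<^sup>+\<omega>. ennreal (Y \<omega> t) \<partial>M) = (\<integral>\<^sup>+\<omega>. ennreal (Z \<omega> t) \<partial>M)"
      by (rule nn_integral_cong_AE) (use ZY in \<open>eventually_elim, simp\<close>)
    then show ?thesis using nn_integral_eq_integral[OF int nn] Z_mean[of t] by simp
  qed
  interpret Y: stationary_construction M Y V W
    by unfold_locales (use Y_field Y_copies Y_mean Y_cadlag assms in auto)

  define \<mu> where "\<mu> = distr M path_space Y"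
  have \<mu>_int: "(\<integral>\<^sup>+f. G f \<partial>\<mu>) = (\<integral>\<^sup>+\<omega>. G (Y \<omega>) \<partial>M)" if "G \<in> borel_measurable path_space" for G
    unfolding \<mu>_def by (rule nn_integral_distr[OF Y_path]) (use that in \<open>simp add: measurable_distr_eq1\<close>)
  interpret law: invariant_law \<mu>
  proof (rule invariant_law.intro)
    show "prob_space \<mu>" unfolding \<mu>_def by (rule prob_space_distr[OF Y_path])
    show "invariant_law_axioms \<mu>"
    proof
      show "sets \<mu> = sets path_space" by (simp add: \<mu>_def)
      show "(\<integral>\<^sup>+f. G (backshift h f) \<partial>\<mu>) = (\<integral>\<^sup>+f. G f \<partial>\<mu>)"
        if G: "G \<in> borel_measurable path_space" "homogeneous G" for G h
        using Y.shift_invariance[OF G, of h] \<mu>_int[OF G(1)] \<mu>_int[OF measurable_compose[OF backshift_measurable G(1)]]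
        by simp
      fix L :: real assume L: "0 < L"
      have "(\<integral>\<^sup>+f. cell_sup L 0 f \<partial>\<mu>) = (\<integral>\<^sup>+\<omega>. cell_sup L 0 (Y \<omega>) \<partial>M)" by (rule \<mu>_int) simp
      also have "\<dots> \<le> (\<integral>\<^sup>+\<omega>. (SUP t\<in>cbox 0 (vec L). ennreal (Z \<omega> t)) \<partial>M)"
      proof (rule nn_integral_mono_AE)
        show "AE \<omega> in M. cell_sup L 0 (Y \<omega>) \<le> (SUP t\<in>cbox 0 (vec L). ennreal (Z \<omega> t))"
          using ZY
        proof eventually_elim
          case (elim \<omega>)
          have "cell L 0 \<subseteq> cbox 0 (vec L :: real^'n)" by (auto simp: cell_def mem_box_cart less_imp_le)
          then show ?case unfolding cell_sup_def elim by (intro SUP_subset_mono) auto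
        qed
      qed
      also have "\<dots> < \<infinity>" by (rule Z_sup[OF L])
      finally show "(\<integral>\<^sup>+f. cell_sup L 0 f \<partial>\<mu>) < \<infinity>" .
    qed
  qed

  have S_Y: "AE \<omega> in M. S_int \<eta> (Z \<omega>) = mass \<eta> UNIV (Y \<omega>)" for \<eta>
    using ZY by eventually_elim (simp add: S_int_eq_mass[OF Y_cadlag])
  have pos: "AE f in \<mu>. 0 < mass \<delta> UNIV f"
  proof -
    have m: "mass \<delta> UNIV \<in> borel_measurable path_space" by (rule mass_measurable[OF \<open>\<delta> \<ge> 0\<close>]) simp
    have "{f\<in>space path_space. 0 < mass \<delta> UNIV f} \<in> sets path_space" using m by measurable
    moreover have "AE \<omega> in M. 0 < mass \<delta> UNIV (Y \<omega>)"
      using S_Y[of \<delta>] S_pos by eventually_elim simp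
    ultimately show ?thesis unfolding \<mu>_def by (subst AE_distr_iff[OF Y_path]) auto
  qed

  have average: "berman_average M Z \<delta> x T =
      ennreal (1 / T ^ CARD('n)) * (\<integral>\<^sup>+f. ?H (cbox 0 (vec T)) f \<partial>\<mu>)" for T
  proof -
    let ?C = "cbox 0 (vec T) :: (real^'n) set"
    have "emeasure M {\<omega>\<in>space M. ennreal x < sojourn \<delta> ?C (Z \<omega>) s} =
      (\<integral>\<^sup>+\<omega>. 1 * indicator {\<omega>. ennreal x < sojourn \<delta> ?C (Y \<omega>) s} \<omega> \<partial>M)" for s
    proof -
      have [measurable]: "(\<lambda>\<omega>. sojourn \<delta> ?C (Y \<omega>) s) \<in> borel_measurable M"
        using measurable_compose[OF measurable_Pair[OF Y_path measurable_const[of s borel]]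
            sojourn_pair_measurable[OF \<open>\<delta> \<ge> 0\<close>, of ?C]] by simp
      have E: "{\<omega>\<in>space M. ennreal x < sojourn \<delta> ?C (Y \<omega>) s} \<in> sets M" by measurable
      have same: "AE \<omega> in M. \<omega> \<in> {\<omega>\<in>space M. ennreal x < sojourn \<delta> ?C (Y \<omega>) s}
          \<longleftrightarrow> \<omega> \<in> {\<omega>\<in>space M. ennreal x < sojourn \<delta> ?C (Z \<omega>) s}"
        using ZY by eventually_elim auto
      have E': "{\<omega>\<in>space M. ennreal x < sojourn \<delta> ?C (Z \<omega>) s} \<in> sets M"
        by (rule in_sets_AE[OF same E]) auto
      have "emeasure M {\<omega>\<in>space M. ennreal x < sojourn \<delta> ?C (Z \<omega>) s}
        = emeasure M {\<omega>\<in>space M. ennreal x < sojourn \<delta> ?C (Y \<omega>) s}"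
        by (rule emeasure_eq_AE) (use same E E' in auto)
      also have "\<dots> = (\<integral>\<^sup>+\<omega>. indicator {\<omega>\<in>space M. ennreal x < sojourn \<delta> ?C (Y \<omega>) s} \<omega> \<partial>M)"
        using E by simp
      also have "\<dots> = (\<integral>\<^sup>+\<omega>. 1 * indicator {\<omega>. ennreal x < sojourn \<delta> ?C (Y \<omega>) s} \<omega> \<partial>M)"
        by (rule nn_integral_cong) (simp add: indicator_def)
      finally show ?thesis .
    qed
    then have "(\<integral>\<^sup>+s\<in>{0..}. emeasure M {\<omega>\<in>space M. ennreal x < sojourn \<delta> ?C (Z \<omega>) s} \<partial>lborel) =
      (\<integral>\<^sup>+f. 1 * ?H ?C f \<partial>\<mu>)"
      unfolding \<mu>_def
      using nn_integral_sojourn_level[OF \<open>prob_space M\<close> Y_path, of "\<lambda>_. 1" \<delta> ?C x] \<open>\<delta> \<ge> 0\<close> by simp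
    then show ?thesis by (simp add: berman_average_def)
  qed

  have formula: "(\<integral>\<^sup>+s\<in>{0..}. (\<integral>\<^sup>+\<omega>. ennreal (Z \<omega> 0) / S_int \<eta> (Z \<omega>) *
        indicator {\<omega>. sojourn \<delta> UNIV (Z \<omega>) s > ennreal x} \<omega> \<partial>M) \<partial>lborel)
      = (\<integral>\<^sup>+f. ennreal (f 0) / mass \<eta> UNIV f * ?H UNIV f \<partial>\<mu>)" if \<eta>: "0 \<le> \<eta>" for \<eta>
  proof -
    have "(\<integral>\<^sup>+\<omega>. ennreal (Z \<omega> 0) / S_int \<eta> (Z \<omega>) * indicator {\<omega>. sojourn \<delta> UNIV (Z \<omega>) s > ennreal x} \<omega> \<partial>M)
      = (\<integral>\<^sup>+\<omega>. ennreal (Y \<omega> 0) / mass \<eta> UNIV (Y \<omega>) * indicator {\<omega>. ennreal x < sojourn \<delta> UNIV (Y \<omega>) s} \<omega> \<partial>M)" for s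
    proof (rule nn_integral_cong_AE)
      show "AE \<omega> in M. ennreal (Z \<omega> 0) / S_int \<eta> (Z \<omega>) * indicator {\<omega>. sojourn \<delta> UNIV (Z \<omega>) s > ennreal x} \<omega>
        = ennreal (Y \<omega> 0) / mass \<eta> UNIV (Y \<omega>) * indicator {\<omega>. ennreal x < sojourn \<delta> UNIV (Y \<omega>) s} \<omega>"
        using ZY S_Y[of \<eta>] by eventually_elim (simp add: indicator_def)
    qed
    moreover have "(\<lambda>f. ennreal (f 0) / mass \<eta> UNIV f) \<in> borel_measurable (path_space :: (real^'n \<Rightarrow> real) measure)"
      by (intro borel_measurable_divide_ennreal mass_measurable[OF \<eta>] measurable_compose[OF eval_measurable]) auto
    ultimately show ?thesis
      unfolding \<mu>_def
      using nn_integral_sojourn_level[OF \<open>prob_space M\<close> Y_path, of "\<lambda>f. ennreal (f 0) / mass \<eta> UNIV f" \<delta> UNIV x] \<open>\<delta> \<ge> 0\<close>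
      by simp
  qed

  obtain L where L: "coarser \<delta> L" using coarser_exists[OF \<open>\<delta> \<ge> 0\<close>] by blast
  interpret B: blocks \<mu> \<delta> L x by unfold_locales (rule L)
  let ?B = "\<integral>\<^sup>+f. ennreal (f 0) / mass \<delta> UNIV f * ?H UNIV f \<partial>\<mu>"
  have lim: "(berman_average M Z \<delta> x \<longlongrightarrow> ?B) at_top"
    using B.box_density_tendsto(1)[OF pos] by (simp add: average[abs_def])
  then have berman: "berman M Z \<delta> x = ?B"
    unfolding berman_def by (intro tendsto_Lim) auto

  have other: "berman M Z \<delta> x = (\<integral>\<^sup>+s\<in>{0..}. (\<integral>\<^sup>+\<omega>. ennreal (Z \<omega> 0) / S_int \<eta> (Z \<omega>) *
        indicator {\<omega>. sojourn \<delta> UNIV (Z \<omega>) s > ennreal x} \<omega> \<partial>M) \<partial>lborel)"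
    if \<eta>: "if \<delta> = 0 then \<eta> > 0 else (\<exists>k::nat. k \<ge> 1 \<and> \<eta> = real k * \<delta>)"
      and cond: "AE \<omega> in M. \<forall>r\<in>grid \<delta>. S_int 0 (Z \<omega>) < \<infinity> \<longrightarrow>
          0 < S_int \<eta> (backshift r (Z \<omega>)) \<and> S_int \<eta> (backshift r (Z \<omega>)) < \<infinity>" for \<eta>
  proof -
    have co: "coarser \<delta> \<eta>"
      using \<eta> \<open>\<delta> \<ge> 0\<close> by (cases "\<delta> = 0") (auto simp: coarser_def)
    have \<eta>0: "0 \<le> \<eta>" using coarserD[OF co] by simp
    let ?Q = "\<lambda>f :: real^'n \<Rightarrow> real. \<integral>\<^sup>+r. ennreal (f (- r)) / mass \<eta> UNIV (backshift r f) \<partial>grid_lebesgue \<delta>"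
    have "AE \<omega> in M. mass 0 UNIV (Y \<omega>) < \<infinity> \<longrightarrow> ?Q (Y \<omega>) = 1"
      using cond ZY
    proof eventually_elim
      case (elim \<omega>)
      show ?case
      proof (intro impI normalised_grid_integral[OF co Y_cadlag])
        fix r :: "real^'n" assume "mass 0 UNIV (Y \<omega>) < \<infinity>" "r \<in> grid \<delta>"
        then show "0 < mass \<eta> UNIV (backshift r (Y \<omega>)) \<and> mass \<eta> UNIV (backshift r (Y \<omega>)) < \<infinity>"
          using elim by (simp add: S_int_eq_mass[OF Y_cadlag] S_int_eq_mass[OF backshift_cadlag[OF Y_cadlag]])
      qed
    qed
    moreover have "{f\<in>space path_space. mass 0 UNIV f < \<infinity> \<longrightarrow> ?Q f = 1} \<in> sets path_space"
    proof -
      note [measurable] = mass_measurable[OF order_refl, of UNIV] normalised_grid_integral_measurable[OF \<open>\<delta> \<ge> 0\<close> \<eta>0]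
      show ?thesis by measurable
    qed
    ultimately have "AE f in \<mu>. mass 0 UNIV f < \<infinity> \<longrightarrow> ?Q f = 1"
      unfolding \<mu>_def by (subst AE_distr_iff[OF Y_path]) auto
    then show ?thesis
      unfolding formula[OF \<eta>0] berman by (rule law.change_of_normalisation[OF co pos, symmetric])
  qed

  show ?thesis
    using lim other B.box_density_tendsto(2)[OF pos] unfolding formula[OF \<open>\<delta> \<ge> 0\<close>] berman by blast
qed

end
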